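(* Let $\mathbf a=\{a_j\}_{j\ge1}$, $\mathbf b=\{b_j\}_{j\ge1}$ be positive sequences with $0<a_1\le a_2\le\cdots$ and $\inf_j b_j>0$, and consider the approximation problem $I=\{I_d\}_{d\in\mathbb N}$ in the worst case setting. Then: (i) SPT holds iff PT holds iff $\sum_{j=1}^\infty b_j^{-1}<\infty$ and $\liminf_{j\to\infty}\frac{\ln a_j}{j}>0$; (ii) QPT holds iff $\sup_{d\in\mathbb N}\frac{\sum_{j=1}^d b_j^{-1}}{1+\ln d}<\infty$ and $\liminf_{j\to\infty}\frac{(1+\ln j)\ln a_j}{j}>0$; (iii) UWT holds iff $\lim_{j\to\infty}\frac{\ln a_j}{\ln j}=\infty$; (iv) WT holds iff $\lim_{j\to\infty}\frac{a_j}{j}=\infty$; (v) $(s,t)$-WT holds for all $s,t>0$ with $\max(s/2,t)>1$; (vi) $(2,1)$-WT holds iff $\lim_{j\to\infty}a_j=\infty$; (vii) for $0<t<1$, $(2,t)$-WT holds iff $\lim_{j\to\infty}\frac{a_j}{\ln j}=\infty$; (viii) for $0<s<2$ and $0<t\le1$, $(s,t)$-WT holds iff $\lim_{j\to\infty}\frac{a_j}{j^{(2-s)/s}}=\infty$.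
   Context: For $f\in L_2([0,1]^d)$, $\hat f(\mathbf k)=\int_{[0,1]^d}f(\mathbf x)e^{-2\pi i\mathbf k\cdot\mathbf x}d\mathbf x$. $W_2^{\mathbf a,\mathbf b}([0,1]^d)$ is the Hilbert space of $f\in L_2$ with norm $\|f\|^2=\sum_{\mathbf k\in\mathbb Z^d}(1+\sum_{j=1}^d a_j|k_j|^{2b_j})|\hat f(\mathbf k)|^2$; $I_d:W_2^{\mathbf a,\mathbf b}([0,1]^d)\to L_2([0,1]^d)$ is the identity embedding. Approximation numbers $a_n(T)=\inf\{\|T-A\|:\mathrm{rank}A<n\}$; information complexity $n(\varepsilon,I_d)=\min\{n\ge0:a_{n+1}(I_d)\le\varepsilon\}$ for $\varepsilon\in(0,1)$. Tractability notions: SPT iff $\exists C,p\ge0$: $n(\varepsilon,I_d)\le C\varepsilon^{-p}$ for all $d\in\mathbb N,\varepsilon\in(0,1)$; PT iff $\exists C,p,q\ge0$: $n(\varepsilon,I_d)\le Cd^q\varepsilon^{-p}$; QPT iff $\exists C,t>0$: $n(\varepsilon,I_d)\le C\exp[t(1+\ln\varepsilon^{-1})(1+\ln d)]$; $(s,t)$-WT iff $\lim_{\varepsilon^{-1}+d\to\infty}\frac{\ln n(\varepsilon,I_d)}{\varepsilon^{-s}+d^t}=0$; UWT iff $(\alpha,\beta)$-WT for all $\alpha,\beta>0$; WT iff $(1,1)$-WT. *)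

theory Defs
  imports "HOL-Analysis.Analysis"
begin

text \<open>Points of [0,1]^d are functions x :: nat => real with coordinates x 1, ..., x d.
  Sequences a, b are indexed from 1 (the values a 0, b 0 are irrelevant).\<close>

definition cube_measure :: "nat \<Rightarrow> (nat \<Rightarrow> real) measure" where
  "cube_measure d = PiM {1..d} (\<lambda>_. restrict_space lborel {0..1})"

definition L2 :: "nat \<Rightarrow> ((nat \<Rightarrow> real) \<Rightarrow> complex) set" where
  "L2 d = {f. f \<in> borel_measurable (cube_measure d) \<and>
              integrable (cube_measure d) (\<lambda>x. (cmod (f x))\<^sup>2)}"

definition L2_norm :: "nat \<Rightarrow> ((nat \<Rightarrow> real) \<Rightarrow> complex) \<Rightarrow> real" where
  "L2_norm d f = sqrt (integral\<^sup>L (cube_measure d) (\<lambda>x. (cmod (f x))\<^sup>2))"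

definition lattice :: "nat \<Rightarrow> (nat \<Rightarrow> int) set" where
  "lattice d = {k. \<forall>j. j \<notin> {1..d} \<longrightarrow> k j = 0}"

definition fourier_coeff :: "nat \<Rightarrow> ((nat \<Rightarrow> real) \<Rightarrow> complex) \<Rightarrow> (nat \<Rightarrow> int) \<Rightarrow> complex" where
  "fourier_coeff d f k = integral\<^sup>L (cube_measure d)
      (\<lambda>x. f x * cis (- 2 * pi * (\<Sum>j\<in>{1..d}. real_of_int (k j) * x j)))"

definition sob_weight :: "(nat \<Rightarrow> real) \<Rightarrow> (nat \<Rightarrow> real) \<Rightarrow> nat \<Rightarrow> (nat \<Rightarrow> int) \<Rightarrow> real" where
  "sob_weight a b d k = 1 + (\<Sum>j\<in>{1..d}. a j * \<bar>real_of_int (k j)\<bar> powr (2 * b j))"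

definition W2 :: "(nat \<Rightarrow> real) \<Rightarrow> (nat \<Rightarrow> real) \<Rightarrow> nat \<Rightarrow> ((nat \<Rightarrow> real) \<Rightarrow> complex) set" where
  "W2 a b d = {f \<in> L2 d. (\<lambda>k. sob_weight a b d k * (cmod (fourier_coeff d f k))\<^sup>2) summable_on lattice d}"

definition W2_norm :: "(nat \<Rightarrow> real) \<Rightarrow> (nat \<Rightarrow> real) \<Rightarrow> nat \<Rightarrow> ((nat \<Rightarrow> real) \<Rightarrow> complex) \<Rightarrow> real" where
  "W2_norm a b d f = sqrt (infsum (\<lambda>k. sob_weight a b d k * (cmod (fourier_coeff d f k))\<^sup>2) (lattice d))"

definition admissible_op ::
  "(nat \<Rightarrow> real) \<Rightarrow> (nat \<Rightarrow> real) \<Rightarrow> nat \<Rightarrow> nat \<Rightarrow>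
   (((nat \<Rightarrow> real) \<Rightarrow> complex) \<Rightarrow> ((nat \<Rightarrow> real) \<Rightarrow> complex)) \<Rightarrow> bool" where
  "admissible_op a b d n A \<longleftrightarrow>
     (\<forall>f\<in>W2 a b d. \<forall>g\<in>W2 a b d. A (\<lambda>x. f x + g x) = (\<lambda>x. A f x + A g x)) \<and>
     (\<forall>f\<in>W2 a b d. \<forall>c::complex. A (\<lambda>x. c * f x) = (\<lambda>x. c * A f x)) \<and>
     (\<forall>f\<in>W2 a b d. A f \<in> L2 d) \<and>
     (\<exists>M. \<forall>f\<in>W2 a b d. L2_norm d (A f) \<le> M * W2_norm a b d f) \<and>
     (\<exists>B. finite B \<and> card B < n \<and>
        (\<forall>f\<in>W2 a b d. \<exists>c::((nat \<Rightarrow> real) \<Rightarrow> complex) \<Rightarrow> complex.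
            A f = (\<lambda>x. \<Sum>g\<in>B. c g * g x)))"

definition diff_norm ::
  "(nat \<Rightarrow> real) \<Rightarrow> (nat \<Rightarrow> real) \<Rightarrow> nat \<Rightarrow>
   (((nat \<Rightarrow> real) \<Rightarrow> complex) \<Rightarrow> ((nat \<Rightarrow> real) \<Rightarrow> complex)) \<Rightarrow> real" where
  "diff_norm a b d A = Sup {L2_norm d (\<lambda>x. f x - A f x) / W2_norm a b d f | f.
                              f \<in> W2 a b d \<and> W2_norm a b d f \<noteq> 0}"

definition approx_num :: "(nat \<Rightarrow> real) \<Rightarrow> (nat \<Rightarrow> real) \<Rightarrow> nat \<Rightarrow> nat \<Rightarrow> real" where
  "approx_num a b d n = Inf {diff_norm a b d A | A. admissible_op a b d n A}"

definition info_compl :: "(nat \<Rightarrow> real) \<Rightarrow> (nat \<Rightarrow> real) \<Rightarrow> real \<Rightarrow> nat \<Rightarrow> nat" where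
  "info_compl a b \<epsilon> d = (LEAST n. approx_num a b d (Suc n) \<le> \<epsilon>)"

definition SPT :: "(real \<Rightarrow> nat \<Rightarrow> nat) \<Rightarrow> bool" where
  "SPT N \<longleftrightarrow> (\<exists>C\<ge>0. \<exists>p\<ge>0. \<forall>d\<ge>1. \<forall>\<epsilon>\<in>{0<..<1}. real (N \<epsilon> d) \<le> C * (1/\<epsilon>) powr p)"

definition PT :: "(real \<Rightarrow> nat \<Rightarrow> nat) \<Rightarrow> bool" where
  "PT N \<longleftrightarrow> (\<exists>C\<ge>0. \<exists>p\<ge>0. \<exists>q\<ge>0. \<forall>d\<ge>1. \<forall>\<epsilon>\<in>{0<..<1}.
              real (N \<epsilon> d) \<le> C * real d powr q * (1/\<epsilon>) powr p)"

definition QPT :: "(real \<Rightarrow> nat \<Rightarrow> nat) \<Rightarrow> bool" where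
  "QPT N \<longleftrightarrow> (\<exists>C>0. \<exists>t>0. \<forall>d\<ge>1. \<forall>\<epsilon>\<in>{0<..<1}.
              real (N \<epsilon> d) \<le> C * exp (t * (1 + ln (1/\<epsilon>)) * (1 + ln (real d))))"

definition stWT :: "real \<Rightarrow> real \<Rightarrow> (real \<Rightarrow> nat \<Rightarrow> nat) \<Rightarrow> bool" where
  "stWT s t N \<longleftrightarrow> (\<forall>e>0. \<exists>R. \<forall>d\<ge>1. \<forall>\<epsilon>\<in>{0<..<1}. 1/\<epsilon> + real d > R \<longrightarrow>
       \<bar>ln (real (N \<epsilon> d)) / ((1/\<epsilon>) powr s + real d powr t)\<bar> \<le> e)"

definition UWT :: "(real \<Rightarrow> nat \<Rightarrow> nat) \<Rightarrow> bool" where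
  "UWT N \<longleftrightarrow> (\<forall>\<alpha>>0. \<forall>\<beta>>0. stWT \<alpha> \<beta> N)"

definition WT :: "(real \<Rightarrow> nat \<Rightarrow> nat) \<Rightarrow> bool" where
  "WT N \<longleftrightarrow> stWT 1 1 N"

end

theory Submission
  imports Defs "HOL-Probability.Probability" "HOL-Real_Asymp.Real_Asymp"
begin

text \<open>
  The singular values of the embedding are the numbers \<open>weight(k)\<^sup>-\<^sup>1\<^sup>/\<^sup>2\<close>, so the information
  complexity is the number of lattice points \<open>k\<close> of weight below \<open>X = \<epsilon>\<^sup>-\<^sup>2\<close>. The upper bound needs
  Parseval's identity on the cube, i.e. density of trigonometric polynomials: the sets whose
  indicator is an \<open>L\<^sub>2\<close>-limit of trigonometric polynomials form a sigma-algebra, which by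
  Stone-Weierstrass on the circle contains the coordinate cylinders.

  The count is bounded above by the product of the coordinatewise counts, and by
  \<open>exp (\<tau> X) * \<Prod>\<^sub>j \<theta>(\<tau> a\<^sub>j)\<close> with \<open>\<theta>(y) = \<Sum>\<^sub>i exp (- y |i|\<^sup>2\<^sup>\<beta>)\<close> for every \<open>\<tau> > 0\<close>. It is bounded below by
  the number of small subsets of \<open>{1..d}\<close> (their indicator vectors) and, for fixed \<open>d\<close>, by a multiple
  of \<open>X\<close> to the power \<open>\<Sum>\<^sub>j 1/(2 b\<^sub>j)\<close>. The weak notions come from optimising \<open>\<tau>\<close>, for instance
  \<open>\<tau> = \<eta> \<epsilon>\<^sup>2\<^sup>-\<^sup>s\<close> for \<open>(s,t)\<close>-weak tractability with \<open>s < 2\<close>.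
\<close>

section \<open>Fourier coefficients on the cube\<close>

text \<open>With \<open>E = 1/\<epsilon>\<close> and \<open>X = E\<^sup>2\<close> every notion
  becomes a growth condition on the count in \<open>E\<close> and \<open>d\<close>; the count is
  strict because an error equal to \<epsilon> is allowed. In the weak notions \<open>b\<close>
  enters the upper bounds only through its lower bound \<beta>: a lattice coordinate is 0 or at
  least 1 in modulus, so putting \<beta> for \<open>b j\<close> only lowers the weight. The
  hypotheses on \<open>a\<close> are asymptotic, so finitely many initial coordinates are estimated
  crudely; they contribute a constant or a lower power of \<open>E\<close>, and constants are
  absorbed because \<open>E powr s + d powr t\<close> is large whenever \<open>E + d\<close> is. On
  the other coordinates \<open>ln \<theta>(y)\<close> is at most a multiple of
  \<open>exp (- y)\<close> for \<open>y \<ge> 1\<close>, and of \<open>y powr (- q)\<close> for any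
  \<open>q > 0\<close> and all \<open>y > 0\<close>. The choice of \<tau> decides which bound
  serves: \<tau> is a constant for \<open>s = 2\<close>; it is \<open>(1 + ln d) / a 1\<close> for
  \<open>s > 2\<close>, placing all coordinates in the exponential range; for \<open>s < 2\<close>
  it tends to 0 as \<open>E\<close> grows, and a small and a large \<open>q\<close> are needed
  together.\<close>

definition expo :: "nat \<Rightarrow> (nat \<Rightarrow> int) \<Rightarrow> (nat \<Rightarrow> real) \<Rightarrow> complex" where
  "expo d k x = cis (2 * pi * (\<Sum>j\<in>{1..d}. real_of_int (k j) * x j))"

text \<open>The square of \<open>L2_norm\<close>. Without the root, Bessel's identity is additive
  and approximation needs no square roots.\<close>

definition sqint :: "nat \<Rightarrow> ((nat \<Rightarrow> real) \<Rightarrow> complex) \<Rightarrow> real" where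
  "sqint d f = integral\<^sup>L (cube_measure d) (\<lambda>x. (cmod (f x))\<^sup>2)"

definition trig :: "nat \<Rightarrow> (nat \<Rightarrow> int) set \<Rightarrow> ((nat \<Rightarrow> int) \<Rightarrow> complex) \<Rightarrow> (nat \<Rightarrow> real) \<Rightarrow> complex" where
  "trig d K c x = (\<Sum>k\<in>K. c k * expo d k x)"

lemma prob_space_unit: "prob_space (restrict_space lborel {0..1::real})"
  by (intro prob_space_restrict_space) auto

lemma prob_space_cube: "prob_space (cube_measure d)"
  unfolding cube_measure_def by (intro prob_space_PiM prob_space_unit)

lemma component_measurable [measurable]:
  "j \<in> {1..d} \<Longrightarrow> (\<lambda>x. x j) \<in> borel_measurable (cube_measure d)"
  unfolding cube_measure_def
  by (rule measurable_compose[OF measurable_component_singleton[of j]])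
     (auto intro: measurable_restrict_space1)

lemma expo_measurable [measurable]: "expo d k \<in> borel_measurable (cube_measure d)"
proof -
  have "(\<lambda>x. \<Sum>j\<in>{1..d}. real_of_int (k j) * x j) \<in> borel_measurable (cube_measure d)"
    by (intro borel_measurable_sum borel_measurable_times component_measurable) auto
  then have "(\<lambda>x. cis (2 * pi * (\<Sum>j\<in>{1..d}. real_of_int (k j) * x j))) \<in> borel_measurable (cube_measure d)"
    by (intro measurable_compose[OF _ borel_measurable_continuous_onI[of cis]]) (auto intro!: continuous_intros)
  then show ?thesis by (simp add: expo_def[abs_def])
qed

lemma norm_expo [simp]: "cmod (expo d k x) = 1"
  by (simp add: expo_def)

lemma expo_mult: "expo d k x * expo d l x = expo d (\<lambda>j. k j + l j) x"
  by (simp add: expo_def cis_mult sum.distrib distrib_left distrib_right)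

lemma cnj_expo: "cnj (expo d k x) = expo d (\<lambda>j. - k j) x"
  by (simp add: expo_def cis_cnj sum_negf)

lemma expo_0 [simp]: "expo d (\<lambda>_. 0) x = 1"
  by (simp add: expo_def)

lemma fourier_coeff_eq: "fourier_coeff d f k = integral\<^sup>L (cube_measure d) (\<lambda>x. f x * cnj (expo d k x))"
  by (simp add: fourier_coeff_def expo_def cis_cnj)

lemma cis_prod: "finite I \<Longrightarrow> cis (\<Sum>i\<in>I. f i) = (\<Prod>i\<in>I. cis (f i))"
  by (induction rule: finite_induct) (auto simp: cis_mult[symmetric])

lemma integral_cis_unit:
  "integral\<^sup>L (restrict_space lborel {0..1}) (\<lambda>x. cis (2 * pi * (real_of_int n * x))) = (if n = 0 then 1 else 0)"
proof (cases "n = 0")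
  case True
  interpret prob_space "restrict_space lborel {0..1::real}" by (rule prob_space_unit)
  show ?thesis using True prob_space by simp
next
  case False
  define F where "F = (\<lambda>x::real. cis (2 * pi * (real_of_int n * x)) / (2 * pi * \<i> * real_of_int n))"
  have "integral\<^sup>L (restrict_space lborel {0..1}) (\<lambda>x. cis (2 * pi * (real_of_int n * x)))
     = integral\<^sup>L lborel (\<lambda>x. indicator {0..1} x *\<^sub>R cis (2 * pi * (real_of_int n * x)))"
    by (subst integral_restrict_space) auto
  also have "\<dots> = F 1 - F 0"
  proof (rule integral_FTC_Icc[where F=F])
    show "(F has_vector_derivative cis (2 * pi * (real_of_int n * x))) (at x within {0..1})" for x
    proof -
      have "((\<lambda>z. exp (2 * pi * \<i> * of_int n * z) / (2 * pi * \<i> * of_int n)) has_field_derivative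
          exp (2 * pi * \<i> * of_int n * of_real x)) (at (of_real x))"
        using False by (auto intro!: derivative_eq_intros)
      then have "((\<lambda>x::real. exp (2 * pi * \<i> * of_int n * of_real x) / (2 * pi * \<i> * of_int n)) has_vector_derivative
          exp (2 * pi * \<i> * of_int n * of_real x)) (at x within {0..1})"
        by (rule has_vector_derivative_real_field)
      then show ?thesis by (simp add: F_def cis_conv_exp mult_ac)
    qed
  qed (auto intro!: continuous_intros)
  also have "\<dots> = 0" using cis_multiple_2pi[of "real_of_int n"] by (simp add: F_def mult_ac)
  finally show ?thesis using False by simp
qed

text \<open>Fubini splits the integral into one factor per coordinate. A nonzero frequency in
  \<open>lattice d\<close> has a nonzero entry inside \<open>{1..d}\<close>, and that factor
  vanishes.\<close>

lemma integral_expo: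
  assumes "k \<in> lattice d"
  shows "integral\<^sup>L (cube_measure d) (expo d k) = (if k = (\<lambda>_. 0) then 1 else 0)"
proof -
  interpret U: prob_space "restrict_space lborel {0..1::real}" by (rule prob_space_unit)
  interpret product_sigma_finite "\<lambda>_::nat. restrict_space lborel {0..1::real}" by standard
  have "integral\<^sup>L (cube_measure d) (expo d k)
     = integral\<^sup>L (PiM {1..d} (\<lambda>_. restrict_space lborel {0..1}))
        (\<lambda>x. \<Prod>j\<in>{1..d}. cis (2 * pi * (real_of_int (k j) * x j)))"
    unfolding cube_measure_def expo_def[abs_def] by (simp add: sum_distrib_left cis_prod)
  also have "\<dots> = (\<Prod>j\<in>{1..d}. integral\<^sup>L (restrict_space lborel {0..1}) (\<lambda>x. cis (2 * pi * (real_of_int (k j) * x))))"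
  proof (rule product_integral_prod)
    fix j
    have "(\<lambda>x. cis (2 * pi * (real_of_int (k j) * x))) \<in> borel_measurable borel"
      by (intro borel_measurable_continuous_onI continuous_intros)
    then show "integrable (restrict_space lborel {0..1}) (\<lambda>x. cis (2 * pi * (real_of_int (k j) * x)))"
      by (intro U.integrable_const_bound[where B=1]) (auto intro!: measurable_restrict_space1)
  qed auto
  also have "\<dots> = (if k = (\<lambda>_. 0) then 1 else 0)"
  proof (cases "k = (\<lambda>_. 0)")
    case False
    then obtain j where "k j \<noteq> 0" by auto
    moreover from this have "j \<in> {1..d}" using assms unfolding lattice_def by blast
    ultimately show ?thesis using False by (auto simp: integral_cis_unit intro!: prod_zero)
  qed (use U.prob_space in \<open>simp add: integral_cis_unit\<close>)
  finally show ?thesis .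
qed

lemma lattice_diff: "k \<in> lattice d \<Longrightarrow> l \<in> lattice d \<Longrightarrow> (\<lambda>j. k j - l j) \<in> lattice d"
  by (simp add: lattice_def)

lemma fourier_coeff_expo:
  assumes "k \<in> lattice d" "l \<in> lattice d"
  shows "fourier_coeff d (expo d k) l = (if k = l then 1 else 0)"
proof -
  have "fourier_coeff d (expo d k) l = integral\<^sup>L (cube_measure d) (expo d (\<lambda>j. k j - l j))"
    by (simp add: fourier_coeff_eq cnj_expo expo_mult)
  also have "\<dots> = (if k = l then 1 else 0)"
    using lattice_diff[OF assms] by (simp add: integral_expo fun_eq_iff)
  finally show ?thesis .
qed

section \<open>Square-integrable functions on the cube\<close>

lemma L2_mult_integrable:
  assumes "f \<in> L2 d" "g \<in> L2 d"
  shows "integrable (cube_measure d) (\<lambda>x. f x * g x)"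
proof (rule Bochner_Integration.integrable_bound)
  show "integrable (cube_measure d) (\<lambda>x. (cmod (f x))\<^sup>2 + (cmod (g x))\<^sup>2)"
    using assms by (auto simp: L2_def)
  show "(\<lambda>x. f x * g x) \<in> borel_measurable (cube_measure d)"
    using assms by (auto simp: L2_def)
  have "cmod (f x) * cmod (g x) \<le> (cmod (f x))\<^sup>2 + (cmod (g x))\<^sup>2" for x
    using sum_squares_bound[of "cmod (f x)" "cmod (g x)"] mult_nonneg_nonneg[OF norm_ge_zero[of "f x"] norm_ge_zero[of "g x"]]
    by linarith
  then show "AE x in cube_measure d. norm (f x * g x) \<le> norm ((cmod (f x))\<^sup>2 + (cmod (g x))\<^sup>2)"
    by (auto simp: norm_mult intro: order_trans[OF _ abs_ge_self])
qed

lemma L2_bounded: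
  assumes "f \<in> borel_measurable (cube_measure d)" "\<And>x. x \<in> space (cube_measure d) \<Longrightarrow> cmod (f x) \<le> B"
  shows "f \<in> L2 d"
proof -
  interpret prob_space "cube_measure d" by (rule prob_space_cube)
  have "integrable (cube_measure d) (\<lambda>x. (cmod (f x))\<^sup>2)"
    using assms by (intro integrable_const_bound[where B="B\<^sup>2"]) (auto intro!: power_mono AE_I2)
  with assms show ?thesis by (simp add: L2_def)
qed

lemma L2_expo: "expo d k \<in> L2 d"
  by (rule L2_bounded[where B=1]) auto

lemma L2_cnj_expo: "(\<lambda>x. cnj (expo d k x)) \<in> L2 d"
  by (simp add: cnj_expo L2_expo)

lemma L2_const: "(\<lambda>_. c) \<in> L2 d"
  by (rule L2_bounded[where B="cmod c"]) auto

lemma L2_mult_bounded: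
  assumes f: "f \<in> L2 d" and g: "g \<in> borel_measurable (cube_measure d)"
    and B: "\<And>x. x \<in> space (cube_measure d) \<Longrightarrow> cmod (g x) \<le> B"
  shows "(\<lambda>x. g x * f x) \<in> L2 d" and "sqint d (\<lambda>x. g x * f x) \<le> B\<^sup>2 * sqint d f"
proof -
  have i: "integrable (cube_measure d) (\<lambda>x. B\<^sup>2 * (cmod (f x))\<^sup>2)"
    using f by (auto simp: L2_def)
  have le: "(cmod (g x * f x))\<^sup>2 \<le> B\<^sup>2 * (cmod (f x))\<^sup>2" if "x \<in> space (cube_measure d)" for x
    using B[OF that] by (auto simp: norm_mult power_mult_distrib intro!: mult_right_mono power_mono)
  have m: "(\<lambda>x. g x * f x) \<in> borel_measurable (cube_measure d)"
    using f g by (auto simp: L2_def)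
  have i2: "integrable (cube_measure d) (\<lambda>x. (cmod (g x * f x))\<^sup>2)"
    using m le by (intro Bochner_Integration.integrable_bound[OF i]) (auto intro!: AE_I2)
  show "(\<lambda>x. g x * f x) \<in> L2 d" using m i2 by (simp add: L2_def)
  show "sqint d (\<lambda>x. g x * f x) \<le> B\<^sup>2 * sqint d f"
    unfolding sqint_def using le i i2
    by (subst integral_mult_right_zero[symmetric], intro integral_mono) auto
qed

lemma L2_scale: "f \<in> L2 d \<Longrightarrow> (\<lambda>x. c * f x) \<in> L2 d"
  by (rule L2_mult_bounded(1)[where B="cmod c"]) auto

lemma sqint_scale: "sqint d (\<lambda>x. c * f x) = (cmod c)\<^sup>2 * sqint d f"
  by (simp add: sqint_def norm_mult power_mult_distrib)

text \<open>A quasi-triangle inequality for squares that stands in for Minkowski's. The factor 2 is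
  harmless: it is applied where both summands can be made small or where only boundedness
  matters.\<close>

lemma cmod_add_sq_le: "(cmod (z + w))\<^sup>2 \<le> 2 * (cmod z)\<^sup>2 + 2 * (cmod w)\<^sup>2"
proof -
  have "(cmod (z + w))\<^sup>2 \<le> (cmod z + cmod w)\<^sup>2"
    by (intro power_mono norm_triangle_ineq) auto
  also have "\<dots> \<le> 2 * (cmod z)\<^sup>2 + 2 * (cmod w)\<^sup>2"
    using sum_squares_bound[of "cmod z" "cmod w"] by (simp add: power2_sum)
  finally show ?thesis .
qed

lemma L2_add:
  assumes "f \<in> L2 d" "g \<in> L2 d"
  shows "(\<lambda>x. f x + g x) \<in> L2 d" and "sqint d (\<lambda>x. f x + g x) \<le> 2 * sqint d f + 2 * sqint d g"
proof -
  have f: "integrable (cube_measure d) (\<lambda>x. (cmod (f x))\<^sup>2)" and g: "integrable (cube_measure d) (\<lambda>x. (cmod (g x))\<^sup>2)"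
    using assms by (auto simp: L2_def)
  have m: "(\<lambda>x. f x + g x) \<in> borel_measurable (cube_measure d)"
    using assms by (auto simp: L2_def)
  have i: "integrable (cube_measure d) (\<lambda>x. 2 * (cmod (f x))\<^sup>2 + 2 * (cmod (g x))\<^sup>2)"
    using f g by auto
  have i2: "integrable (cube_measure d) (\<lambda>x. (cmod (f x + g x))\<^sup>2)"
    using m by (intro Bochner_Integration.integrable_bound[OF i] AE_I2)
      (use cmod_add_sq_le in \<open>auto intro: order_trans[OF _ abs_ge_self]\<close>)
  show "(\<lambda>x. f x + g x) \<in> L2 d" using m i2 by (simp add: L2_def)
  have "sqint d (\<lambda>x. f x + g x) \<le> integral\<^sup>L (cube_measure d) (\<lambda>x. 2 * (cmod (f x))\<^sup>2 + 2 * (cmod (g x))\<^sup>2)"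
    unfolding sqint_def by (intro integral_mono i i2 cmod_add_sq_le)
  also have "\<dots> = 2 * sqint d f + 2 * sqint d g"
    using f g by (simp add: sqint_def)
  finally show "sqint d (\<lambda>x. f x + g x) \<le> 2 * sqint d f + 2 * sqint d g" .
qed

lemma L2_diff:
  assumes "f \<in> L2 d" "g \<in> L2 d"
  shows "(\<lambda>x. f x - g x) \<in> L2 d" and "sqint d (\<lambda>x. f x - g x) \<le> 2 * sqint d f + 2 * sqint d g"
  using L2_add[OF assms(1) L2_scale[OF assms(2), of "-1"]] sqint_scale[of d "-1" g] by simp_all

lemma L2_sum: "(\<And>i. i \<in> I \<Longrightarrow> f i \<in> L2 d) \<Longrightarrow> (\<lambda>x. \<Sum>i\<in>I. f i x) \<in> L2 d"
  by (induction I rule: infinite_finite_induct) (auto simp: L2_const intro: L2_add)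

lemma L2_trig: "trig d K c \<in> L2 d"
  unfolding trig_def[abs_def] by (intro L2_sum L2_scale L2_expo)

lemma sqint_nonneg [simp]: "0 \<le> sqint d f"
  by (simp add: sqint_def)

section \<open>Linearity of the coefficients and Bessel's identity\<close>

lemma fourier_coeff_add:
  assumes "f \<in> L2 d" "g \<in> L2 d"
  shows "fourier_coeff d (\<lambda>x. f x + g x) k = fourier_coeff d f k + fourier_coeff d g k"
  unfolding fourier_coeff_eq ring_distribs
  by (intro Bochner_Integration.integral_add L2_mult_integrable L2_cnj_expo assms)

lemma fourier_coeff_scale: "fourier_coeff d (\<lambda>x. c * f x) k = c * fourier_coeff d f k"
  by (simp add: fourier_coeff_eq mult.assoc)

lemma fourier_coeff_diff:
  assumes "f \<in> L2 d" "g \<in> L2 d"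
  shows "fourier_coeff d (\<lambda>x. f x - g x) k = fourier_coeff d f k - fourier_coeff d g k"
  using fourier_coeff_add[OF assms(1) L2_scale[OF assms(2), of "-1"], of k] fourier_coeff_scale[of d "-1" g k]
  by simp

lemma trig_empty: "trig d {} c x = 0"
  by (simp add: trig_def)

lemma trig_insert: "finite K \<Longrightarrow> k \<notin> K \<Longrightarrow> trig d (insert k K) c x = c k * expo d k x + trig d K c x"
  by (simp add: trig_def)

lemma fourier_coeff_trig:
  assumes "finite K" "K \<subseteq> lattice d" "l \<in> lattice d"
  shows "fourier_coeff d (trig d K c) l = (if l \<in> K then c l else 0)"
  using assms
proof (induction K rule: finite_induct)
  case empty
  then show ?case by (simp add: trig_empty[abs_def] fourier_coeff_def)
next
  case (insert k K)
  have "fourier_coeff d (trig d (insert k K) c) l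
      = fourier_coeff d (\<lambda>x. c k * expo d k x + trig d K c x) l"
    using insert by (simp add: trig_insert[THEN ext])
  also have "\<dots> = c k * fourier_coeff d (expo d k) l + fourier_coeff d (trig d K c) l"
    by (simp add: fourier_coeff_add L2_scale L2_expo L2_trig fourier_coeff_scale)
  finally show ?case using insert by (auto simp: fourier_coeff_expo)
qed

text \<open>Expanding the square and completing it in \<open>c\<close> shows the Fourier coefficient
  to be the best choice of \<open>c\<close>, with the loss of any other choice made
  explicit.\<close>

lemma sqint_diff_expo:
  assumes f: "f \<in> L2 d"
  shows "sqint d (\<lambda>x. f x - c * expo d k x) = sqint d f - (cmod (fourier_coeff d f k))\<^sup>2 + (cmod (fourier_coeff d f k - c))\<^sup>2"
proof -
  interpret prob_space "cube_measure d" by (rule prob_space_cube)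
  have sq: "(cmod (z - w))\<^sup>2 = (cmod z)\<^sup>2 - 2 * Re (z * cnj w) + (cmod w)\<^sup>2" for z w
    unfolding cmod_power2 by (simp add: power2_eq_square algebra_simps)
  have i: "integrable (cube_measure d) (\<lambda>x. f x * cnj (expo d k x))"
    by (intro L2_mult_integrable f L2_cnj_expo)
  have i1: "integrable (cube_measure d) (\<lambda>x. cnj c * (f x * cnj (expo d k x)))"
    using i by simp
  have i2: "integrable (cube_measure d) (\<lambda>x. (cmod (f x))\<^sup>2)"
    using f by (simp add: L2_def)
  have "sqint d (\<lambda>x. f x - c * expo d k x)
     = integral\<^sup>L (cube_measure d) (\<lambda>x. (cmod (f x))\<^sup>2 - 2 * Re (cnj c * (f x * cnj (expo d k x))) + (cmod c)\<^sup>2)"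
    unfolding sqint_def sq by (simp add: norm_mult mult_ac)
  also have "\<dots> = sqint d f - 2 * Re (cnj c * fourier_coeff d f k) + (cmod c)\<^sup>2"
  proof -
    have "integral\<^sup>L (cube_measure d) (\<lambda>x. Re (cnj c * (f x * cnj (expo d k x)))) = Re (cnj c * fourier_coeff d f k)"
      using i1 by (subst integral_Re) (simp_all only: fourier_coeff_eq integral_mult_right_zero)
    moreover have "integrable (cube_measure d) (\<lambda>x. 2 * Re (cnj c * (f x * cnj (expo d k x))))"
      by (intro integrable_mult_right integrable_Re i1)
    ultimately show ?thesis using i2 
      by (simp add: prob_space sqint_def del: times_complex.sel complex_cnj)
  qed
  also have "\<dots> = sqint d f - (cmod (fourier_coeff d f k))\<^sup>2 + (cmod (fourier_coeff d f k - c))\<^sup>2"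
    unfolding sq by (simp add: mult_ac)
  finally show ?thesis .
qed

text \<open>Orthogonality lets frequencies be subtracted one at a time without disturbing the
  coefficients still to come. For \<open>c\<close> equal to the Fourier coefficients the last sum is
  0; for arbitrary \<open>c\<close> it is nonnegative, so any good approximant forces the
  coefficients on its spectrum to carry most of the norm.\<close>

lemma sqint_diff_trig:
  assumes f: "f \<in> L2 d" and "finite K" "K \<subseteq> lattice d"
  shows "sqint d (\<lambda>x. f x - trig d K c x)
     = sqint d f - (\<Sum>k\<in>K. (cmod (fourier_coeff d f k))\<^sup>2) + (\<Sum>k\<in>K. (cmod (fourier_coeff d f k - c k))\<^sup>2)"
  using assms(2,3)
proof (induction K rule: finite_induct)
  case empty
  then show ?case by (simp add: trig_empty)
next
  case (insert k K)
  have L: "(\<lambda>x. f x - trig d K c x) \<in> L2 d"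
    by (intro L2_diff f L2_trig)
  have "sqint d (\<lambda>x. f x - trig d (insert k K) c x) = sqint d (\<lambda>x. (f x - trig d K c x) - c k * expo d k x)"
    using insert by (simp add: trig_insert algebra_simps)
  moreover have "fourier_coeff d (\<lambda>x. f x - trig d K c x) k = fourier_coeff d f k"
    using insert by (simp add: fourier_coeff_diff f L2_trig fourier_coeff_trig)
  ultimately show ?case using insert by (simp add: sqint_diff_expo[OF L])
qed

lemma sqint_trig:
  assumes "finite K" "K \<subseteq> lattice d"
  shows "sqint d (trig d K c) = (\<Sum>k\<in>K. (cmod (c k))\<^sup>2)"
  using sqint_diff_trig[OF L2_const[of 0 d] assms, of c] sqint_scale[of d "-1" "trig d K c"]
  by (simp add: fourier_coeff_def sqint_def)

section \<open>Density of trigonometric polynomials\<close>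

definition trig_polys :: "nat \<Rightarrow> ((nat \<Rightarrow> real) \<Rightarrow> complex) set" where
  "trig_polys d = {trig d K c | K c. finite K \<and> K \<subseteq> lattice d}"

lemma trig_polys_expo: "k \<in> lattice d \<Longrightarrow> (\<lambda>x. c * expo d k x) \<in> trig_polys d"
  unfolding trig_polys_def
  by (rule CollectI, rule exI[of _ "{k}"], rule exI[of _ "\<lambda>_. c"]) (auto simp: trig_def)

lemma trig_polys_const: "(\<lambda>_. c) \<in> trig_polys d"
  using trig_polys_expo[of "\<lambda>_. 0" d c] by (simp add: lattice_def)

lemma trig_polys_add:
  assumes "f \<in> trig_polys d" "g \<in> trig_polys d"
  shows "(\<lambda>x. f x + g x) \<in> trig_polys d"
proof -
  obtain K c where f: "f = trig d K c" "finite K" "K \<subseteq> lattice d"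
    using assms(1) by (auto simp: trig_polys_def)
  obtain L e where g: "g = trig d L e" "finite L" "L \<subseteq> lattice d"
    using assms(2) by (auto simp: trig_polys_def)
  have "f x + g x = trig d (K \<union> L) (\<lambda>k. (if k \<in> K then c k else 0) + (if k \<in> L then e k else 0)) x" for x
  proof -
    have "trig d (K \<union> L) (\<lambda>k. (if k \<in> K then c k else 0) + (if k \<in> L then e k else 0)) x
       = (\<Sum>k\<in>K \<union> L. if k \<in> K then c k * expo d k x else 0) + (\<Sum>k\<in>K \<union> L. if k \<in> L then e k * expo d k x else 0)"
      unfolding trig_def sum.distrib[symmetric] by (intro sum.cong) (auto simp: distrib_right)
    also have "(\<Sum>k\<in>K \<union> L. if k \<in> K then c k * expo d k x else 0) = f x"
      unfolding f(1) trig_def using f(2) g(2) by (subst sum.inter_restrict[symmetric]) (auto simp: Int_absorb1)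
    also have "(\<Sum>k\<in>K \<union> L. if k \<in> L then e k * expo d k x else 0) = g x"
      unfolding g(1) trig_def using f(2) g(2) by (subst sum.inter_restrict[symmetric]) (auto simp: Int_absorb1)
    finally show ?thesis by simp
  qed
  then show ?thesis
    unfolding trig_polys_def using f(2,3) g(2,3)
    by (intro CollectI exI[of _ "K \<union> L"] exI[of _ "\<lambda>k. (if k \<in> K then c k else 0) + (if k \<in> L then e k else 0)"]) auto
qed

lemma trig_polys_sum: "(\<And>i. i \<in> I \<Longrightarrow> f i \<in> trig_polys d) \<Longrightarrow> (\<lambda>x. \<Sum>i\<in>I. f i x) \<in> trig_polys d"
  by (induction I rule: infinite_finite_induct) (auto simp: trig_polys_const intro: trig_polys_add)

lemma lattice_add: "k \<in> lattice d \<Longrightarrow> l \<in> lattice d \<Longrightarrow> (\<lambda>j. k j + l j) \<in> lattice d"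
  by (simp add: lattice_def)

lemma trig_polys_mult:
  assumes "f \<in> trig_polys d" "g \<in> trig_polys d"
  shows "(\<lambda>x. f x * g x) \<in> trig_polys d"
proof -
  obtain K c where f: "f = trig d K c" "finite K" "K \<subseteq> lattice d"
    using assms(1) by (auto simp: trig_polys_def)
  obtain L e where g: "g = trig d L e" "finite L" "L \<subseteq> lattice d"
    using assms(2) by (auto simp: trig_polys_def)
  have "(\<lambda>x. f x * g x) = (\<lambda>x. \<Sum>k\<in>K. \<Sum>l\<in>L. (c k * e l) * expo d (\<lambda>j. k j + l j) x)"
    unfolding f(1) g(1) trig_def sum_product by (simp add: expo_mult[symmetric] mult_ac)
  moreover have "(\<lambda>x. \<Sum>k\<in>K. \<Sum>l\<in>L. (c k * e l) * expo d (\<lambda>j. k j + l j) x) \<in> trig_polys d"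
    using f(3) g(3) by (intro trig_polys_sum trig_polys_expo) (auto intro!: lattice_add)
  ultimately show ?thesis by simp
qed

lemma trig_polys_bounded: "f \<in> trig_polys d \<Longrightarrow> \<exists>B. \<forall>x. cmod (f x) \<le> B"
proof -
  assume "f \<in> trig_polys d"
  then obtain K c where f: "f = trig d K c" "finite K" by (auto simp: trig_polys_def)
  have "cmod (f x) \<le> (\<Sum>k\<in>K. cmod (c k))" for x
    unfolding f(1) trig_def by (rule order_trans[OF norm_sum]) (simp add: norm_mult)
  then show ?thesis by blast
qed

lemma trig_polys_L2: "f \<in> trig_polys d \<Longrightarrow> f \<in> L2 d"
  by (auto simp: trig_polys_def L2_trig)

section \<open>The closure of the trigonometric polynomials in the mean square\<close>

definition trig_approx :: "nat \<Rightarrow> ((nat \<Rightarrow> real) \<Rightarrow> complex) set" where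
  "trig_approx d = {f \<in> L2 d. \<forall>\<eta>>0. \<exists>p\<in>trig_polys d. sqint d (\<lambda>x. f x - p x) < \<eta>}"

lemma trig_approx_L2: "f \<in> trig_approx d \<Longrightarrow> f \<in> L2 d"
  by (simp add: trig_approx_def)

lemma trig_approx_closed:
  assumes f: "f \<in> L2 d" and "\<And>\<eta>. \<eta> > 0 \<Longrightarrow> \<exists>g\<in>trig_approx d. sqint d (\<lambda>x. f x - g x) < \<eta>"
  shows "f \<in> trig_approx d"
  unfolding trig_approx_def
proof (intro CollectI conjI f allI impI)
  fix \<eta> :: real assume "\<eta> > 0"
  then obtain g where g: "g \<in> trig_approx d" "sqint d (\<lambda>x. f x - g x) < \<eta> / 4"
    using assms(2)[of "\<eta> / 4"] by auto
  obtain p where p: "p \<in> trig_polys d" "sqint d (\<lambda>x. g x - p x) < \<eta> / 4"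
    using g(1) \<open>\<eta> > 0\<close> unfolding trig_approx_def by (auto dest: spec[of _ "\<eta> / 4"])
  have "sqint d (\<lambda>x. (f x - g x) + (g x - p x)) \<le> 2 * sqint d (\<lambda>x. f x - g x) + 2 * sqint d (\<lambda>x. g x - p x)"
    by (intro L2_add L2_diff f trig_approx_L2 g trig_polys_L2 p)
  with g p show "\<exists>p\<in>trig_polys d. sqint d (\<lambda>x. f x - p x) < \<eta>"
    by (intro bexI[of _ p]) auto
qed

lemma trig_polys_approx: "f \<in> trig_polys d \<Longrightarrow> f \<in> trig_approx d"
  unfolding trig_approx_def
  by (auto simp: trig_polys_L2 intro!: bexI[of _ f] simp: sqint_def)

lemma trig_approx_add:
  assumes f: "f \<in> trig_approx d" and g: "g \<in> trig_approx d"
  shows "(\<lambda>x. f x + g x) \<in> trig_approx d"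
  unfolding trig_approx_def
proof (intro CollectI conjI L2_add trig_approx_L2 f g allI impI)
  fix \<eta> :: real assume "\<eta> > 0"
  then obtain p q where p: "p \<in> trig_polys d" "sqint d (\<lambda>x. f x - p x) < \<eta> / 4"
    and q: "q \<in> trig_polys d" "sqint d (\<lambda>x. g x - q x) < \<eta> / 4"
    using f g unfolding trig_approx_def by (auto dest!: spec[of _ "\<eta> / 4"])
  have "sqint d (\<lambda>x. (f x - p x) + (g x - q x)) \<le> 2 * sqint d (\<lambda>x. f x - p x) + 2 * sqint d (\<lambda>x. g x - q x)"
    by (intro L2_add L2_diff f g trig_approx_L2 p q trig_polys_L2)
  with p q show "\<exists>p\<in>trig_polys d. sqint d (\<lambda>x. f x + g x - p x) < \<eta>"
    by (intro bexI[of _ "\<lambda>x. p x + q x"] trig_polys_add) (auto simp: algebra_simps)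
qed

text \<open>One factor must be bounded for the product to stay square-integrable. The factor
  \<open>f\<close> is replaced by a polynomial \<open>p\<close> with \<open>g\<close> as bounded
  multiplier; \<open>p\<close> is bounded in turn, so it can serve as multiplier while
  \<open>g\<close> is replaced by \<open>q\<close>. Adding 1 to \<open>B\<^sup>2\<close> and
  \<open>C\<^sup>2\<close> keeps the denominators positive.\<close>

lemma trig_approx_mult:
  assumes f: "f \<in> trig_approx d" and g: "g \<in> trig_approx d"
    and B: "\<And>x. x \<in> space (cube_measure d) \<Longrightarrow> cmod (g x) \<le> B"
  shows "(\<lambda>x. g x * f x) \<in> trig_approx d"
proof (rule trig_approx_closed)
  have gm: "g \<in> borel_measurable (cube_measure d)" using trig_approx_L2[OF g] by (simp add: L2_def)
  show "(\<lambda>x. g x * f x) \<in> L2 d"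
    using trig_approx_L2[OF f] gm B by (rule L2_mult_bounded)
  fix \<eta> :: real assume "\<eta> > 0"
  have "\<eta> / (2 * (B\<^sup>2 + 1)) > 0" using \<open>\<eta> > 0\<close> by (intro divide_pos_pos) (auto intro: add_nonneg_pos)
  then obtain p where p: "p \<in> trig_polys d" "sqint d (\<lambda>x. f x - p x) < \<eta> / (2 * (B\<^sup>2 + 1))"
    using f unfolding trig_approx_def by blast
  obtain C where C: "\<And>x. cmod (p x) \<le> C" using trig_polys_bounded[OF p(1)] by blast
  have "(\<lambda>x. g x * p x) \<in> trig_approx d"
    unfolding trig_approx_def
  proof (intro CollectI conjI L2_mult_bounded[OF trig_polys_L2[OF p(1)] gm B] allI impI)
    fix e :: real assume "e > 0"
    then have "e / (C\<^sup>2 + 1) > 0" by (intro divide_pos_pos) (auto intro: add_nonneg_pos)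
    then obtain q where q: "q \<in> trig_polys d" "sqint d (\<lambda>x. g x - q x) < e / (C\<^sup>2 + 1)"
      using g unfolding trig_approx_def by blast
    have "sqint d (\<lambda>x. p x * (g x - q x)) \<le> C\<^sup>2 * sqint d (\<lambda>x. g x - q x)"
      using trig_polys_L2[OF p(1)] C
      by (intro L2_mult_bounded L2_diff trig_approx_L2 g trig_polys_L2 q) (auto simp: L2_def)
    also have "\<dots> \<le> (C\<^sup>2 + 1) * sqint d (\<lambda>x. g x - q x)"
      by (intro mult_right_mono) auto
    also have "\<dots> < e"
      using q(2) by (subst (asm) pos_less_divide_eq) (auto intro: add_nonneg_pos simp: mult.commute)
    finally show "\<exists>r\<in>trig_polys d. sqint d (\<lambda>x. g x * p x - r x) < e"
      using trig_polys_mult[OF p(1) q(1)]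
      by (intro bexI[of _ "\<lambda>x. p x * q x"]) (auto simp: algebra_simps)
  qed
  moreover have "sqint d (\<lambda>x. g x * (f x - p x)) < \<eta>"
  proof -
    have "sqint d (\<lambda>x. g x * (f x - p x)) \<le> B\<^sup>2 * sqint d (\<lambda>x. f x - p x)"
      by (intro L2_mult_bounded L2_diff trig_approx_L2 f trig_polys_L2 p gm B)
    also have "\<dots> \<le> 2 * (B\<^sup>2 + 1) * sqint d (\<lambda>x. f x - p x)"
      by (intro mult_right_mono) auto
    also have "\<dots> < \<eta>"
      using p(2) by (subst (asm) pos_less_divide_eq) (auto intro: add_nonneg_pos simp: mult.commute)
    finally show ?thesis .
  qed
  ultimately show "\<exists>h\<in>trig_approx d. sqint d (\<lambda>x. g x * f x - h x) < \<eta>"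
    by (intro bexI[of _ "\<lambda>x. g x * p x"]) (auto simp: algebra_simps)
qed

lemma trig_approx_limit:
  assumes u: "\<And>n. u n \<in> trig_approx d" and f: "f \<in> L2 d" and w: "w \<in> L2 d"
    and bound: "\<And>n. AE x in cube_measure d. cmod (f x - u n x) \<le> cmod (w x)"
    and lim: "AE x in cube_measure d. (\<lambda>n. u n x) \<longlonglongrightarrow> f x"
  shows "f \<in> trig_approx d"
proof (rule trig_approx_closed[OF f])
  fix \<eta> :: real assume "\<eta> > 0"
  have "(\<lambda>n. sqint d (\<lambda>x. f x - u n x)) \<longlonglongrightarrow> integral\<^sup>L (cube_measure d) (\<lambda>_. 0)"
    unfolding sqint_def
  proof (rule integral_dominated_convergence[where w = "\<lambda>x. (cmod (w x))\<^sup>2"])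
    show "(\<lambda>x. (cmod (f x - u n x))\<^sup>2) \<in> borel_measurable (cube_measure d)" for n
      using L2_diff(1)[OF f trig_approx_L2[OF u[of n]]] by (auto simp: L2_def)
    show "integrable (cube_measure d) (\<lambda>x. (cmod (w x))\<^sup>2)" using w by (simp add: L2_def)
    show "AE x in cube_measure d. (\<lambda>n. (cmod (f x - u n x))\<^sup>2) \<longlonglongrightarrow> 0"
      using lim
    proof eventually_elim
      fix x assume "(\<lambda>n. u n x) \<longlonglongrightarrow> f x"
      then have "(\<lambda>n. (cmod (f x - u n x))\<^sup>2) \<longlonglongrightarrow> (cmod (f x - f x))\<^sup>2"
        by (intro tendsto_intros)
      then show "(\<lambda>n. (cmod (f x - u n x))\<^sup>2) \<longlonglongrightarrow> 0" by simp
    qed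
    show "AE x in cube_measure d. norm ((cmod (f x - u n x))\<^sup>2) \<le> (cmod (w x))\<^sup>2" for n
      using bound[of n] by eventually_elim (simp add: power_mono)
  qed auto
  then have "eventually (\<lambda>n. sqint d (\<lambda>x. f x - u n x) < \<eta>) sequentially"
    using \<open>\<eta> > 0\<close> by (intro order_tendstoD(2)) auto
  then show "\<exists>g\<in>trig_approx d. sqint d (\<lambda>x. f x - g x) < \<eta>"
    using u by (auto simp: eventually_sequentially)
qed

text \<open>Members of \<open>trig_approx\<close> are functions, not classes modulo null sets. The
  constant sequence \<open>f\<close> converges to \<open>g\<close> almost everywhere, with
  dominating function 0.\<close>

lemma trig_approx_AE_cong:
  assumes "f \<in> trig_approx d" "g \<in> borel_measurable (cube_measure d)" "AE x in cube_measure d. f x = g x"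
  shows "g \<in> trig_approx d"
proof -
  have f: "f \<in> L2 d" by (rule trig_approx_L2[OF assms(1)])
  have "integrable (cube_measure d) (\<lambda>x. (cmod (g x))\<^sup>2)"
    using f assms(2,3) by (subst integrable_cong_AE[of _ _ "\<lambda>x. (cmod (f x))\<^sup>2"]) (auto simp: L2_def)
  then have "g \<in> L2 d" using assms(2) by (simp add: L2_def)
  then show ?thesis
    using assms by (intro trig_approx_limit[of "\<lambda>_. f" d g "\<lambda>_. 0"]) (auto simp: L2_const)
qed

section \<open>Functions of a single coordinate\<close>

lemma sqint_le_bound:
  assumes "f \<in> borel_measurable (cube_measure d)" "\<And>x. cmod (f x) \<le> B"
  shows "sqint d f \<le> B\<^sup>2"
proof -
  interpret prob_space "cube_measure d" by (rule prob_space_cube)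
  have "sqint d f \<le> integral\<^sup>L (cube_measure d) (\<lambda>_. B\<^sup>2)"
    unfolding sqint_def using L2_bounded[OF assms] assms(2)
    by (intro integral_mono) (auto simp: L2_def intro!: power_mono)
  then show ?thesis by (simp add: prob_space)
qed

text \<open>Continuous functions of \<open>circ j\<close> are the continuous functions of coordinate
  \<open>j\<close> whose values at 0 and 1 agree, which are those that trigonometric polynomials can
  approximate uniformly.\<close>

definition circ :: "nat \<Rightarrow> (nat \<Rightarrow> real) \<Rightarrow> complex" where
  "circ j x = cis (2 * pi * x j)"

lemma circ_eq_expo: "j \<in> {1..d} \<Longrightarrow> circ j = expo d (\<lambda>i. if i = j then 1 else 0)"
proof -
  assume "j \<in> {1..d}"
  then have "(\<Sum>i\<in>{1..d}. real_of_int (if i = j then 1 else 0) * x i) = x j" for x :: "nat \<Rightarrow> real"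
    by (subst sum.mono_neutral_right[of _ "{j}"]) auto
  then show ?thesis by (simp add: circ_def[abs_def] expo_def[abs_def])
qed

lemma trig_polys_circ:
  assumes "j \<in> {1..d}"
  shows "(\<lambda>x. c * circ j x) \<in> trig_polys d" "(\<lambda>x. c * cnj (circ j x)) \<in> trig_polys d"
  using assms unfolding circ_eq_expo[OF assms] cnj_expo by (auto intro!: trig_polys_expo simp: lattice_def)

text \<open>Real polynomial functions on the plane are generated by the real-linear functionals, and
  a real-linear functional involves only \<open>z\<close> and its conjugate, hence on the circle
  only the frequencies 1 and -1.\<close>

lemma trig_polys_real_polynomial:
  assumes j: "j \<in> {1..d}" and "real_polynomial_function g"
  shows "(\<lambda>x. complex_of_real (g (circ j x))) \<in> trig_polys d"
  using assms(2)
proof induction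
  case (linear g)
  interpret bounded_linear g by fact
  \<comment> \<open>Solves \<open>c * z + cnj c * cnj z = Re z * g 1 + Im z * g \<i>\<close> for
    \<open>c\<close>.\<close>
  define c where "c = Complex (g 1 / 2) (- g \<i> / 2)"
  have "complex_of_real (g z) = c * z + cnj c * cnj z" for z
  proof -
    have "z = Re z *\<^sub>R 1 + Im z *\<^sub>R \<i>" by (simp add: complex_eq_iff)
    then have "g z = g (Re z *\<^sub>R 1 + Im z *\<^sub>R \<i>)" by simp
    also have "\<dots> = Re z * g 1 + Im z * g \<i>" unfolding add scaleR by simp
    finally show ?thesis by (simp add: complex_eq_iff c_def)
  qed
  then show ?case using trig_polys_add[OF trig_polys_circ[OF j]] by simp
qed (auto intro: trig_polys_const trig_polys_add trig_polys_mult)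

lemma circ_measurable: "j \<in> {1..d} \<Longrightarrow> circ j \<in> borel_measurable (cube_measure d)"
  by (subst circ_eq_expo) (auto simp: expo_measurable)

text \<open>Stone-Weierstrass gives a uniform error \<open>e\<close> on the circle, and on a
  probability space the squared norm of the error is then at most \<open>e\<^sup>2\<close>.\<close>

lemma trig_approx_continuous:
  fixes h :: "complex \<Rightarrow> real"
  assumes j: "j \<in> {1..d}" and h: "continuous_on UNIV h"
  shows "(\<lambda>x. complex_of_real (h (circ j x))) \<in> trig_approx d"
proof (rule trig_approx_closed)
  have m: "(\<lambda>x. complex_of_real (h (circ j x))) \<in> borel_measurable (cube_measure d)"
    using measurable_compose[OF circ_measurable[OF j] borel_measurable_continuous_onI[OF h]] by simp
  have "compact (h ` sphere 0 1)"
    by (intro compact_continuous_image continuous_on_subset[OF h]) auto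
  then obtain B where B: "\<And>z. z \<in> sphere 0 1 \<Longrightarrow> \<bar>h z\<bar> \<le> B"
    by (force dest!: compact_imp_bounded simp: bounded_iff)
  show "(\<lambda>x. complex_of_real (h (circ j x))) \<in> L2 d"
    using m by (rule L2_bounded[where B=B]) (auto simp: circ_def intro!: B)
  fix \<eta> :: real assume "\<eta> > 0"
  define e where "e = sqrt (\<eta> / 2)"
  have e: "e > 0" "e\<^sup>2 < \<eta>" using \<open>\<eta> > 0\<close> by (auto simp: e_def)
  obtain g where g: "real_polynomial_function g" "\<And>z. z \<in> sphere 0 1 \<Longrightarrow> \<bar>h z - g z\<bar> < e"
    using Stone_Weierstrass_real_polynomial_function[of "sphere 0 1" h e] e(1) continuous_on_subset[OF h] by auto
  have p: "(\<lambda>x. complex_of_real (g (circ j x))) \<in> trig_polys d"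
    by (rule trig_polys_real_polynomial[OF j g(1)])
  have "sqint d (\<lambda>x. complex_of_real (h (circ j x)) - complex_of_real (g (circ j x))) \<le> e\<^sup>2"
  proof (rule sqint_le_bound)
    show "(\<lambda>x. complex_of_real (h (circ j x)) - complex_of_real (g (circ j x))) \<in> borel_measurable (cube_measure d)"
      using m trig_polys_L2[OF p] by (intro borel_measurable_diff) (auto simp: L2_def)
    show "cmod (complex_of_real (h (circ j x)) - complex_of_real (g (circ j x))) \<le> e" for x
      using g(2)[of "circ j x"] unfolding of_real_diff[symmetric] norm_of_real by (auto simp: circ_def)
  qed
  then show "\<exists>g\<in>trig_approx d. sqint d (\<lambda>x. complex_of_real (h (circ j x)) - g x) < \<eta>"
    using e p trig_polys_approx by force
qed

text \<open>The continuous functions \<open>max 0 (1 - n * infdist z C)\<close> decrease pointwise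
  to the indicator of the closed set \<open>C\<close>.\<close>

lemma trig_approx_indicator_closed_circle:
  assumes j: "j \<in> {1..d}" and C: "closed C"
  shows "(\<lambda>x. indicator C (circ j x)) \<in> trig_approx d"
proof (cases "C = {}")
  \<comment> \<open>\<open>infdist z {} = 0\<close> by convention, so these functions would be
    constantly 1 for the empty set.\<close>
  case True
  then show ?thesis using trig_polys_approx[OF trig_polys_const[of 0 d]] by simp
next
  case False
  define h where "h = (\<lambda>n z. max 0 (1 - real n * infdist z C))"
  have bound: "\<bar>h n z\<bar> \<le> 1" for n z by (auto simp: h_def infdist_nonneg)
  have lim: "(\<lambda>n. h n z) \<longlonglongrightarrow> indicator C z" for z
  proof (cases "z \<in> C")
    case True
    then show ?thesis by (simp add: h_def)
  next
    case False
    then have "infdist z C > 0" using C \<open>C \<noteq> {}\<close> by (intro infdist_pos_not_in_closed)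
    then have "eventually (\<lambda>n. real n * infdist z C \<ge> 1) sequentially"
      using reals_Archimedean3[of "infdist z C"] 
      by (auto simp: eventually_sequentially) (metis less_eq_real_def mult_right_mono of_nat_le_iff order_less_le_trans order_trans)
    then have "eventually (\<lambda>n. h n z = indicator C z) sequentially"
      by eventually_elim (use False in \<open>simp add: h_def\<close>)
    then show ?thesis by (rule tendsto_eventually)
  qed
  have m: "(\<lambda>x. indicator C (circ j x) :: complex) \<in> borel_measurable (cube_measure d)"
    using C by (intro measurable_compose[OF circ_measurable[OF j]] borel_measurable_indicator) auto
  show ?thesis
  proof (rule trig_approx_limit[of "\<lambda>n x. complex_of_real (h n (circ j x))" _ _ "\<lambda>_. 2"])
    show "(\<lambda>x. complex_of_real (h n (circ j x))) \<in> trig_approx d" for n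
      unfolding h_def by (intro trig_approx_continuous[OF j] continuous_intros)
    show "(\<lambda>x. indicator C (circ j x)) \<in> L2 d"
      by (rule L2_bounded[OF m, where B=1]) (auto simp: indicator_def)
    have "cmod (indicator C z - complex_of_real (h n z)) \<le> 1 + 1" for n z
      by (intro order_trans[OF norm_triangle_ineq4] add_mono) (use bound in \<open>auto simp: indicator_def\<close>)
    then show "AE x in cube_measure d. cmod (indicator C (circ j x) - complex_of_real (h n (circ j x))) \<le> cmod 2" for n
      by auto
    have "(\<lambda>n. complex_of_real (h n z)) \<longlonglongrightarrow> indicator C z" for z
      using tendsto_of_real[OF lim[of z], where 'a=complex] by (cases "z \<in> C") auto
    then show "AE x in cube_measure d. (\<lambda>n. complex_of_real (h n (circ j x))) \<longlonglongrightarrow> indicator C (circ j x)"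
      by auto
  qed (rule L2_const)
qed

lemma AE_cube_component_interior:
  assumes "j \<in> {1..d}"
  shows "AE x in cube_measure d. 0 < x j \<and> x j < 1"
proof -
  have "AE y in lborel. y \<noteq> 0 \<and> y \<noteq> (1::real)"
    using AE_lborel_singleton[of 0] AE_lborel_singleton[of 1] by eventually_elim auto
  then have "AE y in restrict_space lborel {0..1::real}. 0 < y \<and> y < 1"
    by (subst AE_restrict_space_iff) (auto elim: eventually_mono)
  then have "AE y in distr (cube_measure d) (restrict_space lborel {0..1::real}) (\<lambda>x. x j). 0 < y \<and> y < 1"
    using distr_PiM_component[of "{1..d}" "\<lambda>_. restrict_space lborel {0..1::real}", OF prob_space_unit assms]
    by (simp only: cube_measure_def)
  then show ?thesis
  proof (subst (asm) AE_distr_iff)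
    show "(\<lambda>x. x j) \<in> cube_measure d \<rightarrow>\<^sub>M restrict_space lborel {0..1}"
      unfolding cube_measure_def by (rule measurable_component_singleton[OF assms])
    have "{0<..<1} \<in> sets (restrict_space lborel {0..1::real})"
      by (subst sets_restrict_space_iff) auto
    then show "{x \<in> space (restrict_space lborel {0..1}). 0 < x \<and> x < (1::real)} \<in> sets (restrict_space lborel {0..1})"
      by (rule back_subst[of "\<lambda>S. S \<in> _"]) (auto simp: space_restrict_space)
  qed
qed

text \<open>The difference of the arguments is an integer, and one point in the open interval
  already puts it strictly between -1 and 1.\<close>

lemma cis_2pi_inj:
  assumes "cis (2 * pi * x) = cis (2 * pi * y)" "0 < x" "x < 1" "0 \<le> y" "y \<le> 1"
  shows "x = y"
proof -
  have "cis (2 * pi * x - 2 * pi * y) = 1"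
    unfolding cis_divide[symmetric] assms(1) by simp
  then have "cos (2 * pi * x - 2 * pi * y) = 1"
    by (metis cis.sel(1) one_complex.sel(1))
  then obtain n :: int where "2 * pi * x - 2 * pi * y = of_int n * 2 * pi"
    unfolding cos_one_2pi_int by blast
  then have "2 * pi * (x - y) = 2 * pi * of_int n" by (simp add: algebra_simps)
  then have n: "x - y = of_int n" by simp
  then have "of_int n < (1::real)" "of_int n > (-1::real)" using assms by linarith+
  then have "n = 0" by linarith
  with n show ?thesis by simp
qed

text \<open>Wrapping \<open>[0,1]\<close> onto the circle identifies only the end points, which form a null set.\<close>

lemma trig_approx_indicator_closed:
  assumes j: "j \<in> {1..d}" and A: "closed A"
  shows "(\<lambda>x. indicator A (x j)) \<in> trig_approx d"
proof (rule trig_approx_AE_cong[OF trig_approx_indicator_closed_circle[OF j]])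
  \<comment> \<open>Cutting \<open>A\<close> down to the unit interval makes it compact, so that its
    image on the circle is closed again.\<close>
  define C where "C = (\<lambda>y. cis (2 * pi * y)) ` (A \<inter> {0..1})"
  have "compact (A \<inter> {0..1})" using A by (intro closed_Int_compact) auto
  then have "compact C" unfolding C_def
    by (intro compact_continuous_image continuous_intros)
  then show "closed C" by (rule compact_imp_closed)
  have "A \<in> sets borel" using A by simp
  then show "(\<lambda>x. indicator A (x j)) \<in> borel_measurable (cube_measure d)"
    by (intro measurable_compose[OF component_measurable[OF j]] borel_measurable_indicator)
  show "AE x in cube_measure d. indicator C (circ j x) = (indicator A (x j) :: complex)"
    using AE_cube_component_interior[OF j]
  proof eventually_elim
    fix x :: "nat \<Rightarrow> real" assume "0 < x j \<and> x j < 1"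
    then have "circ j x \<in> C \<longleftrightarrow> x j \<in> A"
      using cis_2pi_inj[of "x j"] by (force simp: C_def circ_def)
    then show "indicator C (circ j x) = (indicator A (x j) :: complex)" by (simp add: indicator_def)
  qed
qed

section \<open>The sigma-algebra of approximable sets\<close>

definition trig_sets :: "nat \<Rightarrow> (nat \<Rightarrow> real) set set" where
  "trig_sets d = {E \<in> sets (cube_measure d). (indicator E :: _ \<Rightarrow> complex) \<in> trig_approx d}"

text \<open>Inclusion-exclusion, grouped so that the closure of \<open>trig_approx\<close> under
  sums and bounded products applies directly.\<close>

lemma indicator_complex_Un:
  "(indicator (A \<union> B) x :: complex) = indicator A x + (indicator B x + (- indicator A x) * indicator B x)"
  by (auto simp: indicator_def)

lemma trig_approx_scale: "f \<in> trig_approx d \<Longrightarrow> (\<lambda>x. c * f x) \<in> trig_approx d"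
  by (rule trig_approx_mult[OF _ trig_polys_approx[OF trig_polys_const], of _ _ _ "cmod c"]) auto

lemma trig_sets_Un:
  assumes "A \<in> trig_sets d" "B \<in> trig_sets d"
  shows "A \<union> B \<in> trig_sets d"
proof -
  have A: "A \<in> sets (cube_measure d)" "(indicator A :: _ \<Rightarrow> complex) \<in> trig_approx d"
    and B: "B \<in> sets (cube_measure d)" "(indicator B :: _ \<Rightarrow> complex) \<in> trig_approx d"
    using assms by (auto simp: trig_sets_def)
  have A': "(\<lambda>x. - indicator A x) \<in> trig_approx d"
    using trig_approx_scale[OF A(2), of "-1"] by simp
  have "(\<lambda>x. indicator A x + (indicator B x + (- indicator A x) * indicator B x)) \<in> trig_approx d"
    by (intro trig_approx_add A(2) B(2) trig_approx_mult[OF B(2) A', of 1]) (auto simp: indicator_def)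
  then have "(indicator (A \<union> B) :: _ \<Rightarrow> complex) \<in> trig_approx d"
    unfolding indicator_complex_Un[symmetric] by simp
  with A B show ?thesis by (simp add: trig_sets_def)
qed

lemma trig_sets_empty: "{} \<in> trig_sets d"
  using trig_polys_approx[OF trig_polys_const[of 0 d]] by (simp add: trig_sets_def indicator_def[abs_def])

lemma trig_sets_Compl:
  assumes "A \<in> trig_sets d"
  shows "space (cube_measure d) - A \<in> trig_sets d"
proof -
  have A: "A \<in> sets (cube_measure d)" "(indicator A :: _ \<Rightarrow> complex) \<in> trig_approx d"
    using assms by (auto simp: trig_sets_def)
  have "(\<lambda>x. 1 + (-1) * indicator A x) \<in> trig_approx d"
    by (intro trig_approx_add trig_approx_scale A(2) trig_polys_approx trig_polys_const)
  then have "(indicator (space (cube_measure d) - A) :: _ \<Rightarrow> complex) \<in> trig_approx d"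
    by (rule trig_approx_AE_cong) (use A in \<open>auto intro!: borel_measurable_indicator AE_I2 simp: indicator_def\<close>)
  with A show ?thesis by (auto simp: trig_sets_def)
qed

text \<open>The finite unions \<open>B n\<close> increase to the whole union, so their indicators
  converge pointwise under a constant bound.\<close>

lemma trig_sets_UN:
  fixes A :: "nat \<Rightarrow> _"
  assumes "\<And>n. A n \<in> trig_sets d"
  shows "(\<Union>n. A n) \<in> trig_sets d"
proof -
  define B where "B n = (\<Union>i<n. A i)" for n
  have B: "B n \<in> trig_sets d" for n
    unfolding B_def by (induction n) (use assms in \<open>auto simp: trig_sets_empty lessThan_Suc intro: trig_sets_Un\<close>)
  have m: "(\<Union>n. A n) \<in> sets (cube_measure d)"
    using assms by (auto simp: trig_sets_def)
  have "(indicator (\<Union>n. A n) :: _ \<Rightarrow> complex) \<in> trig_approx d"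
  proof (rule trig_approx_limit[of "\<lambda>n. indicator (B n)" _ _ "\<lambda>_. 2"])
    show "(indicator (B n) :: _ \<Rightarrow> complex) \<in> trig_approx d" for n
      using B by (auto simp: trig_sets_def)
    show "indicator (\<Union>n. A n) \<in> L2 d"
      using m by (intro L2_bounded[where B=1]) (auto simp: indicator_def)
    show "AE x in cube_measure d. (\<lambda>n. indicator (B n) x :: complex) \<longlonglongrightarrow> indicator (\<Union>n. A n) x"
      unfolding B_def by (intro AE_I2 LIMSEQ_indicator_UN)
    show "AE x in cube_measure d. cmod (indicator (\<Union>n. A n) x - indicator (B n) x) \<le> cmod 2" for n
      by (auto simp: indicator_def)
  qed (rule L2_const)
  with m show ?thesis by (simp add: trig_sets_def)
qed

text \<open>Closed sets generate the Borel sets, and taking preimages under a coordinate commutes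
  with complements and countable unions.\<close>

lemma trig_sets_component:
  assumes j: "j \<in> {1..d}" and A: "A \<in> sets borel"
  shows "{x \<in> space (cube_measure d). x j \<in> A} \<in> trig_sets d"
proof -
  have "A \<in> sigma_sets UNIV (Collect closed)"
    using A by (simp add: borel_eq_closed)
  then show ?thesis
  proof induction
    case (Basic A)
    then have A: "closed A" by simp
    then have "A \<in> sets borel" by simp
    then have m: "{x \<in> space (cube_measure d). x j \<in> A} \<in> sets (cube_measure d)"
      using component_measurable[OF j] by measurable
    have "indicator {x \<in> space (cube_measure d). x j \<in> A} \<in> trig_approx d"
      using m by (intro trig_approx_AE_cong[OF trig_approx_indicator_closed[OF j A]] borel_measurable_indicator)
        (auto intro!: AE_I2 simp: indicator_def)
    with m show ?case by (simp add: trig_sets_def)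
  next
    case (Compl A)
    have "{x \<in> space (cube_measure d). x j \<in> UNIV - A} = space (cube_measure d) - {x \<in> space (cube_measure d). x j \<in> A}"
      by auto
    with trig_sets_Compl[OF Compl.IH] show ?case by simp
  next
    case (Union A)
    have "{x \<in> space (cube_measure d). x j \<in> (\<Union>i. A i)} = (\<Union>i. {x \<in> space (cube_measure d). x j \<in> A i})"
      by auto
    with trig_sets_UN[OF Union.IH] show ?case by simp
  qed (simp add: trig_sets_empty)
qed

text \<open>Cylinders over a single coordinate generate the product sigma-algebra. Boxes in several
  coordinates come from the closure under complements and unions, which rests on multiplying
  trigonometric polynomials in different coordinates.\<close>

lemma trig_sets_eq: "trig_sets d = sets (cube_measure d)"
proof
  show "sets (cube_measure d) \<subseteq> trig_sets d"
  proof
    fix E assume "E \<in> sets (cube_measure d)"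
    then have "E \<in> sigma_sets (space (cube_measure d))
      {{f \<in> space (cube_measure d). f i \<in> A} | i A. i \<in> {1..d} \<and> A \<in> sets (restrict_space lborel {0..1})}"
      unfolding cube_measure_def sets_PiM_single space_PiM by simp
    then show "E \<in> trig_sets d"
    proof induction
      case (Basic E)
      then obtain i A where E: "E = {f \<in> space (cube_measure d). f i \<in> A}" "i \<in> {1..d}" "A \<in> sets (restrict_space lborel {0..1})"
        by blast
      then have "A \<in> sets borel"
        by (subst (asm) sets_restrict_space_iff) auto
      with E show ?case by (simp add: trig_sets_component del: One_nat_def)
    qed (auto intro: trig_sets_empty trig_sets_Compl trig_sets_UN)
  qed
qed (auto simp: trig_sets_def)

section \<open>From indicators to all square-integrable functions\<close>

lemma trig_approx_simple:
  fixes s :: "_ \<Rightarrow> complex"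
  assumes s: "simple_function (cube_measure d) s"
  shows "s \<in> trig_approx d"
proof -
  define S where "S = s ` space (cube_measure d)"
  have fin: "finite S" using s by (simp add: S_def simple_functionD)
  have 0: "finite T \<Longrightarrow> (\<lambda>x. \<Sum>y\<in>T. y * indicator (s -` {y} \<inter> space (cube_measure d)) x) \<in> trig_approx d" for T
  proof (induction T rule: finite_induct)
    case empty
    then show ?case by (simp add: trig_polys_approx[OF trig_polys_const])
  next
    case (insert y T)
    have "s -` {y} \<inter> space (cube_measure d) \<in> trig_sets d"
      unfolding trig_sets_eq by (rule simple_functionD(2)[OF s])
    then have "(indicator (s -` {y} \<inter> space (cube_measure d)) :: _ \<Rightarrow> complex) \<in> trig_approx d"
      by (simp add: trig_sets_def)
    from trig_approx_add[OF trig_approx_scale[OF this] insert.IH] show ?case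
      unfolding sum.insert[OF insert.hyps] .
  qed
  show ?thesis
  proof (rule trig_approx_AE_cong[OF 0[OF fin]])
    show "s \<in> borel_measurable (cube_measure d)" using s by (rule borel_measurable_simple_function)
    show "AE x in cube_measure d. (\<Sum>y\<in>S. y * indicator (s -` {y} \<inter> space (cube_measure d)) x) = s x"
    proof (rule AE_I2)
      fix x assume x: "x \<in> space (cube_measure d)"
      have "(\<Sum>y\<in>S. y * indicator (s -` {y} \<inter> space (cube_measure d)) x) = (\<Sum>y\<in>S. if y = s x then y else 0)"
        using x by (intro sum.cong) (auto simp: indicator_def)
      also have "\<dots> = s x" using x fin by (simp add: S_def)
      finally show "(\<Sum>y\<in>S. y * indicator (s -` {y} \<inter> space (cube_measure d)) x) = s x" .
    qed
  qed
qed

lemma trig_approx_eq_L2: "trig_approx d = L2 d"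
proof
  show "L2 d \<subseteq> trig_approx d"
  proof
    fix f assume f: "f \<in> L2 d"
    then have "f \<in> borel_measurable (cube_measure d)" by (simp add: L2_def)
    from borel_measurable_implies_sequence_metric[OF this, of 0]
    obtain F where F: "\<And>i. simple_function (cube_measure d) (F i)"
      "\<And>x. x \<in> space (cube_measure d) \<Longrightarrow> (\<lambda>i. F i x) \<longlonglongrightarrow> f x"
      "\<And>i x. x \<in> space (cube_measure d) \<Longrightarrow> cmod (F i x) \<le> 2 * cmod (f x)"
      by (simp add: dist_norm) blast
    show "f \<in> trig_approx d"
    \<comment> \<open>The simple functions satisfy \<open>cmod (F i x) \<le> 2 * cmod (f x)\<close>,
      so \<open>3 * f x\<close> dominates the difference.\<close>
    proof (rule trig_approx_limit[of F d f "\<lambda>x. 3 * f x"])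
      show "AE x in cube_measure d. cmod (f x - F n x) \<le> cmod (3 * f x)" for n
        using F(3)[of _ n] by (intro AE_I2 order_trans[OF norm_triangle_ineq4]) (force simp: norm_mult)
    qed (auto intro: trig_approx_simple F f L2_scale)
  qed
qed (auto dest: trig_approx_L2)

text \<open>The half of Parseval's identity that Bessel's inequality does not give: replacing the
  coefficients of an approximating polynomial by the Fourier coefficients can only improve it. The
  prescribed set \<open>K\<close> is added because the truncation estimate compares the norm with
  the coefficients outside \<open>K\<close>.\<close>

theorem fourier_series_L2:
  assumes f: "f \<in> L2 d" and K: "finite K" "K \<subseteq> lattice d" and "\<eta> > 0"
  obtains F where "finite F" "K \<subseteq> F" "F \<subseteq> lattice d" 
    "sqint d f < (\<Sum>k\<in>F. (cmod (fourier_coeff d f k))\<^sup>2) + \<eta>"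
proof -
  obtain p where "p \<in> trig_polys d" "sqint d (\<lambda>x. f x - p x) < \<eta>"
    using f \<open>\<eta> > 0\<close> trig_approx_eq_L2[of d] unfolding trig_approx_def by blast
  then obtain L c where L: "finite L" "L \<subseteq> lattice d" "sqint d (\<lambda>x. f x - trig d L c x) < \<eta>"
    unfolding trig_polys_def by blast
  have "sqint d f < (\<Sum>k\<in>L. (cmod (fourier_coeff d f k))\<^sup>2) + \<eta>"
    using L(3) unfolding sqint_diff_trig[OF f L(1,2)]
    using sum_nonneg[of L "\<lambda>k. (cmod (fourier_coeff d f k - c k))\<^sup>2"] by simp
  also have "(\<Sum>k\<in>L. (cmod (fourier_coeff d f k))\<^sup>2) \<le> (\<Sum>k\<in>K \<union> L. (cmod (fourier_coeff d f k))\<^sup>2)"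
    using K L by (intro sum_mono2) auto
  finally show ?thesis using that[of "K \<union> L"] K L by simp
qed

section \<open>Approximation numbers\<close>

text \<open>Gaussian elimination on the number of equations: a pivot \<open>p\<close> with
  \<open>m p g \<noteq> 0\<close> removes one equation and one unknown, and \<open>u p\<close> is
  recovered from the removed equation.\<close>

lemma underdetermined_system:
  fixes m :: "'k \<Rightarrow> 'g \<Rightarrow> complex"
  assumes "finite B" "finite K" "card B < card K"
  shows "\<exists>u. (\<exists>k\<in>K. u k \<noteq> 0) \<and> (\<forall>g\<in>B. (\<Sum>k\<in>K. u k * m k g) = 0)"
  using assms
proof (induction B arbitrary: K m rule: finite_induct)
  case empty
  then have "K \<noteq> {}" by auto
  then show ?case by (intro exI[of _ "\<lambda>_. 1"]) auto
next
  case (insert g B)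
  show ?case
  proof (cases "\<forall>k\<in>K. m k g = 0")
    case True
    have "card B < card K" using insert by simp
    from insert.IH[OF insert.prems(1) this, of m] show ?thesis using True by auto
  next
    case False
    then obtain p where p: "p \<in> K" "m p g \<noteq> 0" by blast
    define K' where "K' = K - {p}"
    define m' where "m' k h = m k h - m k g / m p g * m p h" for k h
    have K': "finite K'" "card B < card K'" using insert p by (auto simp: K'_def)
    obtain v where v: "\<exists>k\<in>K'. v k \<noteq> 0" "\<And>h. h \<in> B \<Longrightarrow> (\<Sum>k\<in>K'. v k * m' k h) = 0"
      using insert.IH[OF K', of m'] by blast
    define u where "u = v(p := - (\<Sum>k\<in>K'. v k * m k g) / m p g)"
    have sum_u: "(\<Sum>k\<in>K. u k * m k h) = (\<Sum>k\<in>K'. v k * m' k h)" for h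
    proof -
      have "(\<Sum>k\<in>K. u k * m k h) = u p * m p h + (\<Sum>k\<in>K'. u k * m k h)"
        unfolding K'_def using insert.prems(1) p(1) by (rule sum.remove)
      also have "(\<Sum>k\<in>K'. u k * m k h) = (\<Sum>k\<in>K'. v k * m k h)"
        by (intro sum.cong) (auto simp: u_def K'_def)
      also have "u p * m p h = - (\<Sum>k\<in>K'. v k * (m k g / m p g * m p h))"
        by (simp add: u_def sum_divide_distrib sum_distrib_right mult.assoc)
      finally show ?thesis by (simp add: m'_def right_diff_distrib sum_subtractf)
    qed
    have "\<exists>k\<in>K. u k \<noteq> 0" using v(1) by (auto simp: u_def K'_def)
    moreover have "(\<Sum>k\<in>K. u k * m k g) = 0"
      unfolding sum_u using p(2) by (simp add: m'_def)
    ultimately show ?thesis using v(2) sum_u by auto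
  qed
qed

lemma L2_norm_eq: "L2_norm d f = sqrt (sqint d f)"
  by (simp add: L2_norm_def sqint_def)

lemma W2_L2: "f \<in> W2 a b d \<Longrightarrow> f \<in> L2 d"
  by (simp add: W2_def)

lemma W2_trig:
  assumes K: "finite K" "K \<subseteq> lattice d"
  shows "trig d K c \<in> W2 a b d"
    and "W2_norm a b d (trig d K c) = sqrt (\<Sum>k\<in>K. sob_weight a b d k * (cmod (c k))\<^sup>2)"
proof -
  let ?f = "\<lambda>k. sob_weight a b d k * (cmod (fourier_coeff d (trig d K c) k))\<^sup>2"
  have z: "?f k = 0" if "k \<in> lattice d - K" for k
    using that K by (simp add: fourier_coeff_trig)
  have "?f summable_on lattice d"
    using z K by (subst summable_on_cong_neutral[of K "lattice d" ?f ?f]) auto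
  then show "trig d K c \<in> W2 a b d" by (simp add: W2_def L2_trig)
  have "infsum ?f (lattice d) = infsum ?f K"
    using z K by (intro infsum_cong_neutral) auto
  also have "\<dots> = (\<Sum>k\<in>K. sob_weight a b d k * (cmod (c k))\<^sup>2)"
    using K by (auto simp: fourier_coeff_trig subset_iff intro!: sum.cong)
  finally show "W2_norm a b d (trig d K c) = sqrt (\<Sum>k\<in>K. sob_weight a b d k * (cmod (c k))\<^sup>2)"
    by (simp add: W2_norm_def)
qed

section \<open>Approximation errors in a fixed dimension\<close>

locale weights =
  fixes a b :: "nat \<Rightarrow> real" and d :: nat
  assumes a_pos: "\<And>j. j \<in> {1..d} \<Longrightarrow> a j > 0"
    and b_pos: "\<And>j. j \<in> {1..d} \<Longrightarrow> b j > 0"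
begin

lemma weight_ge1: "sob_weight a b d k \<ge> 1"
  unfolding sob_weight_def by (auto intro!: sum_nonneg mult_nonneg_nonneg order_less_imp_le[OF a_pos])

lemma W2_norm_nonneg: "W2_norm a b d f \<ge> 0"
  using weight_ge1 by (auto simp: W2_norm_def intro!: infsum_nonneg mult_nonneg_nonneg intro: order_trans[OF zero_le_one])

lemma sum_le_W2_norm:
  assumes "f \<in> W2 a b d" "finite F" "F \<subseteq> lattice d"
  shows "(\<Sum>k\<in>F. sob_weight a b d k * (cmod (fourier_coeff d f k))\<^sup>2) \<le> (W2_norm a b d f)\<^sup>2"
proof -
  have nn: "0 \<le> sob_weight a b d k * (cmod (fourier_coeff d f k))\<^sup>2" for k
    using weight_ge1[of k] by simp
  then have "(W2_norm a b d f)\<^sup>2 = infsum (\<lambda>k. sob_weight a b d k * (cmod (fourier_coeff d f k))\<^sup>2) (lattice d)"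
    unfolding W2_norm_def by (intro real_sqrt_pow2 infsum_nonneg)
  also have "\<dots> \<ge> (\<Sum>k\<in>F. sob_weight a b d k * (cmod (fourier_coeff d f k))\<^sup>2)"
    using assms nn by (intro finite_sum_le_infsum) (auto simp: W2_def)
  finally show ?thesis .
qed

text \<open>Outside \<open>K\<close> a weight of at least \<open>X\<close> multiplies each squared
  coefficient in the Sobolev norm. The norm is matched by finitely many coefficients only up to an
  arbitrary \<eta>, which is why the inequality is proved with a slack.\<close>

lemma truncation_error:
  assumes f: "f \<in> W2 a b d" and K: "finite K" "K \<subseteq> lattice d" and "X > 0"
    and X: "\<And>k. k \<in> lattice d - K \<Longrightarrow> X \<le> sob_weight a b d k"
  shows "sqint d (\<lambda>x. f x - trig d K (fourier_coeff d f) x) \<le> (W2_norm a b d f)\<^sup>2 / X"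
proof (rule field_le_epsilon)
  fix \<eta> :: real assume "\<eta> > 0"
  then obtain F where F: "finite F" "K \<subseteq> F" "F \<subseteq> lattice d"
    "sqint d f < (\<Sum>k\<in>F. (cmod (fourier_coeff d f k))\<^sup>2) + \<eta>"
    using fourier_series_L2[OF W2_L2[OF f] K] by blast
  have "sqint d (\<lambda>x. f x - trig d K (fourier_coeff d f) x)
      = sqint d f - (\<Sum>k\<in>K. (cmod (fourier_coeff d f k))\<^sup>2)"
    by (simp add: sqint_diff_trig[OF W2_L2[OF f] K])
  also have "\<dots> \<le> (\<Sum>k\<in>F - K. (cmod (fourier_coeff d f k))\<^sup>2) + \<eta>"
    using F K by (simp add: sum_diff)
  also have "(\<Sum>k\<in>F - K. (cmod (fourier_coeff d f k))\<^sup>2)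
      \<le> (\<Sum>k\<in>F - K. sob_weight a b d k * (cmod (fourier_coeff d f k))\<^sup>2 / X)"
  proof (intro sum_mono)
    fix k assume "k \<in> F - K"
    then have "X \<le> sob_weight a b d k" using X F by auto
    then show "(cmod (fourier_coeff d f k))\<^sup>2 \<le> sob_weight a b d k * (cmod (fourier_coeff d f k))\<^sup>2 / X"
      using \<open>X > 0\<close> by (simp add: pos_le_divide_eq mult_right_mono mult.commute[of _ X])
  qed
  also have "\<dots> \<le> (W2_norm a b d f)\<^sup>2 / X"
    unfolding sum_divide_distrib[symmetric] using F \<open>X > 0\<close>
    by (intro divide_right_mono sum_le_W2_norm f) auto
  finally show "sqint d (\<lambda>x. f x - trig d K (fourier_coeff d f) x) \<le> (W2_norm a b d f)\<^sup>2 / X + \<eta>"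
    by simp
qed

lemma sqint_le_W2_norm:
  assumes "f \<in> W2 a b d"
  shows "sqint d f \<le> (W2_norm a b d f)\<^sup>2"
  using truncation_error[OF assms, of "{}" 1] weight_ge1 by (simp add: trig_empty)

abbreviation error_ratios where
  "error_ratios A \<equiv> {L2_norm d (\<lambda>x. f x - A f x) / W2_norm a b d f | f. f \<in> W2 a b d \<and> W2_norm a b d f \<noteq> 0}"

text \<open>\<open>Sup\<close> of an unbounded set of reals is unspecified. The continuity constant
  \<open>M\<close> in \<open>admissible_op\<close> is what makes \<open>diff_norm\<close> a genuine
  supremum.\<close>

lemma error_ratios_bdd:
  assumes "admissible_op a b d n A"
  shows "bdd_above (error_ratios A)"
proof -
  obtain M where M: "\<And>f. f \<in> W2 a b d \<Longrightarrow> L2_norm d (A f) \<le> M * W2_norm a b d f"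
    and L: "\<And>f. f \<in> W2 a b d \<Longrightarrow> A f \<in> L2 d"
    using assms unfolding admissible_op_def by blast
  have "L2_norm d (\<lambda>x. f x - A f x) / W2_norm a b d f \<le> sqrt (2 + 2 * M\<^sup>2)"
    if f: "f \<in> W2 a b d" "W2_norm a b d f \<noteq> 0" for f
  proof -
    have "sqrt (sqint d (A f)) \<le> M * W2_norm a b d f"
      using M[OF f(1)] by (simp add: L2_norm_eq)
    then have "(sqrt (sqint d (A f)))\<^sup>2 \<le> (M * W2_norm a b d f)\<^sup>2"
      by (intro power_mono) auto
    then have "sqint d (A f) \<le> M\<^sup>2 * (W2_norm a b d f)\<^sup>2" by (simp add: power_mult_distrib)
    moreover have "sqint d (\<lambda>x. f x - A f x) \<le> 2 * sqint d f + 2 * sqint d (A f)"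
      by (rule L2_diff(2)[OF W2_L2[OF f(1)] L[OF f(1)]])
    ultimately have "sqint d (\<lambda>x. f x - A f x) \<le> (2 + 2 * M\<^sup>2) * (W2_norm a b d f)\<^sup>2"
      using sqint_le_W2_norm[OF f(1)] by (simp add: algebra_simps)
    then have "L2_norm d (\<lambda>x. f x - A f x) \<le> sqrt ((2 + 2 * M\<^sup>2) * (W2_norm a b d f)\<^sup>2)"
      unfolding L2_norm_eq by (rule real_sqrt_le_mono)
    also have "\<dots> = sqrt (2 + 2 * M\<^sup>2) * W2_norm a b d f"
      using W2_norm_nonneg by (simp add: real_sqrt_mult)
    finally show ?thesis using f(2) W2_norm_nonneg[of f] by (simp add: pos_divide_le_eq)
  qed
  then show ?thesis by (intro bdd_aboveI[of _ "sqrt (2 + 2 * M\<^sup>2)"]) auto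
qed

lemma ratio_le_diff_norm:
  assumes "admissible_op a b d n A" "f \<in> W2 a b d" "W2_norm a b d f \<noteq> 0"
  shows "L2_norm d (\<lambda>x. f x - A f x) / W2_norm a b d f \<le> diff_norm a b d A"
  unfolding diff_norm_def using assms
  by (intro cSup_upper error_ratios_bdd) auto

text \<open>An operator of rank less than \<open>card K\<close> annihilates a nonzero combination of the exponentials in \<open>K\<close>.\<close>

lemma diff_norm_ge:
  assumes A: "admissible_op a b d n A" and K: "finite K" "K \<subseteq> lattice d" "n \<le> card K"
    and Y: "Y > 0" "\<And>k. k \<in> K \<Longrightarrow> sob_weight a b d k \<le> Y"
  shows "diff_norm a b d A \<ge> 1 / sqrt Y"
proof -
  obtain B where B: "finite B" "card B < n"
    "\<And>f. f \<in> W2 a b d \<Longrightarrow> \<exists>c. A f = (\<lambda>x. \<Sum>g\<in>B. c g * g x)"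
    using A unfolding admissible_op_def by blast
  have add: "A (\<lambda>x. f x + g x) = (\<lambda>x. A f x + A g x)" if "f \<in> W2 a b d" "g \<in> W2 a b d" for f g
    using A that unfolding admissible_op_def by blast
  have scale: "A (\<lambda>x. c * f x) = (\<lambda>x. c * A f x)" if "f \<in> W2 a b d" for f c
    using A that unfolding admissible_op_def by blast
  have e: "(\<lambda>x. c * expo d k x) \<in> W2 a b d" if "k \<in> lattice d" for k c
    using W2_trig(1)[of "{k}" d "\<lambda>_. c" a b] that by (simp add: trig_def[abs_def])
  have e1: "expo d k \<in> W2 a b d" if "k \<in> lattice d" for k
    using e[OF that, of 1] by simp
  \<comment> \<open>The matrix of \<open>A\<close> on the exponentials of \<open>K\<close>,
    expressed through the fewer than \<open>n\<close> functions in \<open>B\<close>; a kernel vector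
    of it gives a combination that \<open>A\<close> annihilates.\<close>
  obtain m where m: "\<And>k. k \<in> K \<Longrightarrow> A (expo d k) = (\<lambda>x. \<Sum>g\<in>B. m k g * g x)"
    using B(3)[OF e1] K(2) by (metis subsetD)
  obtain u where u: "\<exists>k\<in>K. u k \<noteq> 0" "\<And>g. g \<in> B \<Longrightarrow> (\<Sum>k\<in>K. u k * m k g) = 0"
    using underdetermined_system[OF B(1) K(1), of m] B(2) K(3) by auto
  have A_trig: "A (trig d L u) = (\<lambda>x. \<Sum>k\<in>L. u k * A (expo d k) x)" if "finite L" "L \<subseteq> lattice d" for L
    using that
  proof (induction L rule: finite_induct)
    case empty
    \<comment> \<open>Homogeneity with the factor 0 supplies \<open>A 0 = 0\<close>.\<close>
    have "A (\<lambda>x. 0 * trig d {} u x) = (\<lambda>x. 0 * A (trig d {} u) x)"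
      by (intro scale W2_trig) auto
    then show ?case by (simp add: trig_empty[THEN ext])
  next
    case (insert k L)
    have "trig d (insert k L) u = (\<lambda>x. u k * expo d k x + trig d L u x)"
      using insert by (simp add: trig_insert[THEN ext])
    then have "A (trig d (insert k L) u) = (\<lambda>x. A (\<lambda>x. u k * expo d k x) x + A (trig d L u) x)"
      using insert.prems insert.hyps by (simp only:) (intro add e W2_trig, auto)
    with insert show ?case by (simp add: scale e1)
  qed
  have "A (trig d K u) x = 0" for x
  proof -
    have "A (trig d K u) x = (\<Sum>k\<in>K. \<Sum>g\<in>B. u k * m k g * g x)"
      using A_trig[OF K(1,2)] by (simp add: m sum_distrib_left mult.assoc)
    also have "\<dots> = (\<Sum>g\<in>B. (\<Sum>k\<in>K. u k * m k g) * g x)"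
      by (subst sum.swap) (simp add: sum_distrib_right)
    also have "\<dots> = 0" by (simp add: u(2))
    finally show ?thesis .
  qed
  then have L2: "L2_norm d (\<lambda>x. trig d K u x - A (trig d K u) x) = sqrt (\<Sum>k\<in>K. (cmod (u k))\<^sup>2)"
    using sqint_trig[OF K(1,2), of u] by (simp add: L2_norm_eq)
  have W: "W2_norm a b d (trig d K u) = sqrt (\<Sum>k\<in>K. sob_weight a b d k * (cmod (u k))\<^sup>2)"
    using K by (intro W2_trig)
  obtain k where k: "k \<in> K" "u k \<noteq> 0" using u(1) by blast
  have pos: "(\<Sum>k\<in>K. (cmod (u k))\<^sup>2) > 0"
    using k K(1) by (intro sum_pos2[of _ k]) auto
  have le1: "(\<Sum>k\<in>K. (cmod (u k))\<^sup>2) \<le> (\<Sum>k\<in>K. sob_weight a b d k * (cmod (u k))\<^sup>2)"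
    using mult_right_mono[OF weight_ge1] by (intro sum_mono) force
  have le2: "(\<Sum>k\<in>K. sob_weight a b d k * (cmod (u k))\<^sup>2) \<le> Y * (\<Sum>k\<in>K. (cmod (u k))\<^sup>2)"
    unfolding sum_distrib_left by (intro sum_mono mult_right_mono Y) auto
  \<comment> \<open>The error of \<open>A\<close> at the annihilated combination is the combination
    itself, and on the span of \<open>K\<close> the Sobolev norm is at most \<open>sqrt Y\<close>
    times the mean-square norm.\<close>
  have "1 / sqrt Y = sqrt (\<Sum>k\<in>K. (cmod (u k))\<^sup>2) / sqrt (Y * (\<Sum>k\<in>K. (cmod (u k))\<^sup>2))"
    using pos by (simp add: real_sqrt_mult)
  also have "\<dots> \<le> sqrt (\<Sum>k\<in>K. (cmod (u k))\<^sup>2) / sqrt (\<Sum>k\<in>K. sob_weight a b d k * (cmod (u k))\<^sup>2)"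
    using le2 le1 pos by (intro divide_left_mono real_sqrt_le_mono mult_pos_pos) (auto intro: Y)
  also have "\<dots> = L2_norm d (\<lambda>x. trig d K u x - A (trig d K u) x) / W2_norm a b d (trig d K u)"
    by (simp only: L2 W)
  also have "\<dots> \<le> diff_norm a b d A"
    using le1 pos W K by (intro ratio_le_diff_norm[OF A] W2_trig) auto
  finally show ?thesis .
qed

text \<open>Keeps the set under the infimum in \<open>approx_num\<close> nonempty, as bounding that
  infimum from below requires.\<close>

lemma admissible_zero: "admissible_op a b d (Suc n) (\<lambda>f x. 0)"
  unfolding admissible_op_def
  by (auto simp: L2_const L2_norm_def intro!: exI[of _ "{}"] exI[of _ 0])

text \<open>The rank condition in \<open>admissible_op\<close> sums over a set of functions, so the
  frequency has to be recoverable from its exponential.\<close>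

lemma expo_inj: "inj_on (expo d) (lattice d)"
proof (rule inj_onI)
  fix k l assume "k \<in> lattice d" "l \<in> lattice d" "expo d k = expo d l"
  then show "k = l"
    using fourier_coeff_expo[of k d l] fourier_coeff_expo[of l d l] by (metis zero_neq_one)
qed

lemma admissible_truncation:
  assumes K: "finite K" "K \<subseteq> lattice d"
  shows "admissible_op a b d (Suc (card K)) (\<lambda>f. trig d K (fourier_coeff d f))"
  unfolding admissible_op_def
proof (intro conjI ballI allI)
  fix f g assume f: "f \<in> W2 a b d" and g: "g \<in> W2 a b d"
  show "trig d K (fourier_coeff d (\<lambda>x. f x + g x)) = (\<lambda>x. trig d K (fourier_coeff d f) x + trig d K (fourier_coeff d g) x)"
    by (rule ext) (simp add: trig_def fourier_coeff_add W2_L2[OF f] W2_L2[OF g] distrib_right sum.distrib)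
next
  fix f c assume f: "f \<in> W2 a b d"
  show "trig d K (fourier_coeff d (\<lambda>x. c * f x)) = (\<lambda>x. c * trig d K (fourier_coeff d f) x)"
    by (rule ext) (simp add: trig_def fourier_coeff_scale sum_distrib_left mult.assoc)
next
  fix f assume f: "f \<in> W2 a b d"
  show "trig d K (fourier_coeff d f) \<in> L2 d" by (rule L2_trig)
next
  show "\<exists>M. \<forall>f\<in>W2 a b d. L2_norm d (trig d K (fourier_coeff d f)) \<le> M * W2_norm a b d f"
  proof (intro exI[of _ 1] ballI)
    fix f assume f: "f \<in> W2 a b d"
    have "sqint d (trig d K (fourier_coeff d f)) \<le> (\<Sum>k\<in>K. sob_weight a b d k * (cmod (fourier_coeff d f k))\<^sup>2)"
      unfolding sqint_trig[OF K] using mult_right_mono[OF weight_ge1] by (intro sum_mono) force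
    also have "\<dots> \<le> (W2_norm a b d f)\<^sup>2" by (rule sum_le_W2_norm[OF f K])
    finally have "L2_norm d (trig d K (fourier_coeff d f)) \<le> sqrt ((W2_norm a b d f)\<^sup>2)"
      unfolding L2_norm_eq by (rule real_sqrt_le_mono)
    then show "L2_norm d (trig d K (fourier_coeff d f)) \<le> 1 * W2_norm a b d f"
      using W2_norm_nonneg[of f] by simp
  qed
next
  have inj: "inj_on (expo d) K" using inj_on_subset[OF expo_inj K(2)] .
  show "\<exists>B. finite B \<and> card B < Suc (card K) \<and>
         (\<forall>f\<in>W2 a b d. \<exists>c. trig d K (fourier_coeff d f) = (\<lambda>x. \<Sum>g\<in>B. c g * g x))"
  proof (intro exI[of _ "expo d ` K"] conjI ballI)
    fix f
    have "trig d K (fourier_coeff d f) x = (\<Sum>g\<in>expo d ` K. fourier_coeff d f (the_inv_into K (expo d) g) * g x)" for x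
      unfolding sum.reindex[OF inj] trig_def by (intro sum.cong) (auto simp: the_inv_into_f_f[OF inj])
    then show "\<exists>c. trig d K (fourier_coeff d f) = (\<lambda>x. \<Sum>g\<in>expo d ` K. c g * g x)"
      by (intro exI ext)
  qed (use K in \<open>auto simp: card_image_le less_Suc_eq_le\<close>)
qed

text \<open>The constant function 1 keeps the set under the supremum in \<open>diff_norm\<close>
  nonempty, also for \<open>d = 0\<close>.\<close>

lemma W2_norm_nonzero: "\<exists>f\<in>W2 a b d. W2_norm a b d f \<noteq> 0"
proof -
  have "W2_norm a b d (trig d {\<lambda>_. 0} (\<lambda>_. 1)) = sqrt (sob_weight a b d (\<lambda>_. 0))"
    by (subst W2_trig) (auto simp: lattice_def)
  moreover have "trig d {\<lambda>_. 0} (\<lambda>_. 1) \<in> W2 a b d"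
    by (intro W2_trig) (auto simp: lattice_def)
  ultimately show ?thesis using weight_ge1[of "\<lambda>_. 0"] by (intro bexI) auto
qed

lemma diff_norm_truncation_le:
  assumes K: "finite K" "K \<subseteq> lattice d" and "X > 0"
    and X: "\<And>k. k \<in> lattice d - K \<Longrightarrow> X \<le> sob_weight a b d k"
  shows "diff_norm a b d (\<lambda>f. trig d K (fourier_coeff d f)) \<le> 1 / sqrt X"
  unfolding diff_norm_def
proof (rule cSup_least)
  show "error_ratios (\<lambda>f. trig d K (fourier_coeff d f)) \<noteq> {}"
    using W2_norm_nonzero by auto
  fix y assume "y \<in> error_ratios (\<lambda>f. trig d K (fourier_coeff d f))"
  then obtain f where f: "f \<in> W2 a b d" "W2_norm a b d f \<noteq> 0"
    and y: "y = L2_norm d (\<lambda>x. f x - trig d K (fourier_coeff d f) x) / W2_norm a b d f" by auto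
  have "L2_norm d (\<lambda>x. f x - trig d K (fourier_coeff d f) x) \<le> sqrt ((W2_norm a b d f)\<^sup>2 / X)"
    unfolding L2_norm_eq by (intro real_sqrt_le_mono truncation_error f K assms)
  also have "\<dots> = W2_norm a b d f / sqrt X"
    using W2_norm_nonneg[of f] by (simp add: real_sqrt_divide)
  finally show "y \<le> 1 / sqrt X"
    unfolding y using f(2) W2_norm_nonneg[of f] by (simp add: pos_divide_le_eq)
qed

section \<open>Information complexity as a lattice point count\<close>

lemma finite_below: "finite {k \<in> lattice d. sob_weight a b d k < X}"
proof -
  define m where "m j = \<lceil>(X / a j) powr (1 / (2 * b j))\<rceil>" for j
  \<comment> \<open>One common finite range for all coordinates, as the finiteness of the function
    set is stated for a single codomain.\<close>
  define R where "R = (\<Union>j\<in>{1..d}. {- m j..m j}) \<union> {0}"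
  have "{k \<in> lattice d. sob_weight a b d k < X} \<subseteq> {k. \<forall>j. (j \<in> {1..d} \<longrightarrow> k j \<in> R) \<and> (j \<notin> {1..d} \<longrightarrow> k j = 0)}"
  proof (intro subsetI CollectI allI conjI impI)
    fix k j assume k: "k \<in> {k \<in> lattice d. sob_weight a b d k < X}"
    show "k j = 0" if "j \<notin> {1..d}" using k that by (auto simp: lattice_def)
    assume j: "j \<in> {1..d}"
    have "a j * \<bar>real_of_int (k j)\<bar> powr (2 * b j) \<le> (\<Sum>j\<in>{1..d}. a j * \<bar>real_of_int (k j)\<bar> powr (2 * b j))"
      using j by (intro member_le_sum) (auto intro!: mult_nonneg_nonneg order_less_imp_le[OF a_pos])
    also have "\<dots> < X" using k by (simp add: sob_weight_def)
    finally have "\<bar>real_of_int (k j)\<bar> powr (2 * b j) \<le> X / a j"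
      using a_pos[OF j] by (simp add: field_simps)
    then have "(\<bar>real_of_int (k j)\<bar> powr (2 * b j)) powr (1 / (2 * b j)) \<le> (X / a j) powr (1 / (2 * b j))"
      using b_pos[OF j] by (intro powr_mono2) auto
    then have "\<bar>real_of_int (k j)\<bar> \<le> (X / a j) powr (1 / (2 * b j))"
      using b_pos[OF j] by (simp add: powr_powr)
    then have "k j \<in> {- m j..m j}" unfolding m_def by simp linarith
    then show "k j \<in> R" using j by (auto simp: R_def)
  qed
  moreover have "finite {k. \<forall>j. (j \<in> {1..d} \<longrightarrow> k j \<in> R) \<and> (j \<notin> {1..d} \<longrightarrow> k j = 0)}"
    by (rule finite_set_of_finite_funs) (auto simp: R_def)
  ultimately show ?thesis by (rule finite_subset)
qed

text \<open>Truncation to the frequencies of weight below \<open>1 / \<epsilon>\<^sup>2\<close> has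
  error at most \<epsilon>; weights equal to the threshold may be dropped since equality is allowed.
  With fewer dimensions the kernel argument on the same finite set gives an error above
  \<epsilon>.\<close>

theorem info_compl_eq:
  assumes \<epsilon>: "\<epsilon> > 0"
  shows "info_compl a b \<epsilon> d = card {k \<in> lattice d. sob_weight a b d k < 1 / \<epsilon>\<^sup>2}"
  unfolding info_compl_def
proof (rule Least_equality)
  define K where "K = {k \<in> lattice d. sob_weight a b d k < 1 / \<epsilon>\<^sup>2}"
  have K: "finite K" "K \<subseteq> lattice d" unfolding K_def using finite_below by auto
  have nonneg: "diff_norm a b d A \<ge> 0" if A: "admissible_op a b d n A" for n A
  proof -
    obtain f where f: "f \<in> W2 a b d" "W2_norm a b d f \<noteq> 0" using W2_norm_nonzero by blast
    have "0 \<le> L2_norm d (\<lambda>x. f x - A f x) / W2_norm a b d f"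
      using W2_norm_nonneg by (simp add: L2_norm_eq)
    with ratio_le_diff_norm[OF A f] show ?thesis by linarith
  qed
  have "approx_num a b d (Suc (card K)) \<le> diff_norm a b d (\<lambda>f. trig d K (fourier_coeff d f))"
    unfolding approx_num_def using nonneg admissible_truncation[OF K]
    by (intro cInf_lower bdd_belowI[of _ 0]) auto
  also have "\<dots> \<le> 1 / sqrt (1 / \<epsilon>\<^sup>2)"
    using \<epsilon> by (intro diff_norm_truncation_le K) (auto simp: K_def)
  finally show "approx_num a b d (Suc (card K)) \<le> \<epsilon>"
    using \<epsilon> by (simp add: real_sqrt_divide)
  fix n assume n: "approx_num a b d (Suc n) \<le> \<epsilon>"
  show "card K \<le> n"
  proof (rule ccontr)
    assume "\<not> card K \<le> n"
    then have cK: "Suc n \<le> card K" by simp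
    then have "K \<noteq> {}" by auto
    \<comment> \<open>The maximum over a finite set is still strictly below
      \<open>1 / \<epsilon>\<^sup>2\<close>. This gap is uniform over all operators and therefore
      survives the infimum in \<open>approx_num\<close>.\<close>
    define Y where "Y = Max (sob_weight a b d ` K)"
    have Y: "sob_weight a b d k \<le> Y" if "k \<in> K" for k
      unfolding Y_def using that K by auto
    have "Y \<in> sob_weight a b d ` K" unfolding Y_def using K \<open>K \<noteq> {}\<close> by (intro Max_in) auto
    then have Y2: "Y \<ge> 1" "Y < 1 / \<epsilon>\<^sup>2" using weight_ge1 by (auto simp: K_def)
    have "1 / sqrt Y \<le> approx_num a b d (Suc n)"
      unfolding approx_num_def
    proof (rule cInf_greatest)
      show "{diff_norm a b d A |A. admissible_op a b d (Suc n) A} \<noteq> {}"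
        using admissible_zero by blast
      fix y assume "y \<in> {diff_norm a b d A |A. admissible_op a b d (Suc n) A}"
      then show "1 / sqrt Y \<le> y" using diff_norm_ge[OF _ K cK _ Y] Y2 by auto
    qed
    with n have "1 / sqrt Y \<le> \<epsilon>" by simp
    moreover have "sqrt Y < 1 / \<epsilon>"
      using real_sqrt_less_mono[OF Y2(2)] \<epsilon> by (simp add: real_sqrt_divide)
    ultimately show False using Y2 \<epsilon> by (simp add: field_simps)
  qed
qed

end

section \<open>Lattice point counting\<close>

text \<open>Lattice points are 0 off \<open>{1..d}\<close> whereas \<open>PiE\<close> uses
  \<open>undefined\<close> there; restriction translates between the two conventions, and
  distributivity turns the sum over the box into a product.\<close>

lemma sum_prod_lattice_le:
  fixes \<phi> :: "nat \<Rightarrow> int \<Rightarrow> real"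
  assumes K: "finite K" "K \<subseteq> lattice d" and S: "\<And>j. j \<in> {1..d} \<Longrightarrow> finite (S j)"
    and KS: "\<And>k j. k \<in> K \<Longrightarrow> j \<in> {1..d} \<Longrightarrow> k j \<in> S j" and nonneg: "\<And>j i. \<phi> j i \<ge> 0"
  shows "(\<Sum>k\<in>K. \<Prod>j\<in>{1..d}. \<phi> j (k j)) \<le> (\<Prod>j\<in>{1..d}. \<Sum>i\<in>S j. \<phi> j i)"
proof -
  have inj: "inj_on (\<lambda>k. restrict k {1..d}) K"
  proof (rule inj_onI, rule ext)
    fix k l j assume kl: "k \<in> K" "l \<in> K" and eq: "restrict k {1..d} = restrict l {1..d}"
    show "k j = l j"
    proof (cases "j \<in> {1..d}")
      case True
      then show ?thesis using fun_cong[OF eq, of j] by simp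
    next
      case False
      then have "k j = 0" "l j = 0" using kl K(2) unfolding lattice_def by blast+
      then show ?thesis by simp
    qed
  qed
  have "(\<Sum>k\<in>K. \<Prod>j\<in>{1..d}. \<phi> j (k j)) = (\<Sum>g\<in>(\<lambda>k. restrict k {1..d}) ` K. \<Prod>j\<in>{1..d}. \<phi> j (g j))"
    by (subst sum.reindex[OF inj]) (auto intro!: sum.cong prod.cong)
  also have "\<dots> \<le> (\<Sum>g\<in>PiE {1..d} S. \<Prod>j\<in>{1..d}. \<phi> j (g j))"
    using S KS by (intro sum_mono2 finite_PiE prod_nonneg) (auto simp: nonneg)
  also have "\<dots> = (\<Prod>j\<in>{1..d}. \<Sum>i\<in>S j. \<phi> j i)"
    using S by (intro prod_sum_PiE[symmetric]) auto
  finally show ?thesis .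
qed

lemma card_lattice_le:
  assumes K: "finite K" "K \<subseteq> lattice d" and S: "\<And>j. j \<in> {1..d} \<Longrightarrow> finite (S j)"
    and KS: "\<And>k j. k \<in> K \<Longrightarrow> j \<in> {1..d} \<Longrightarrow> k j \<in> S j"
  shows "real (card K) \<le> (\<Prod>j\<in>{1..d}. real (card (S j)))"
proof -
  have "(\<Sum>k\<in>K. \<Prod>j\<in>{1..d}. 1) \<le> (\<Prod>j\<in>{1..d}. \<Sum>i\<in>S j. (1::real))"
    by (rule sum_prod_lattice_le[of K d S "\<lambda>_ _. 1"]) (use assms in auto)
  then show ?thesis by simp
qed

lemma card_lattice_ge:
  assumes K: "finite K" and S: "\<And>k. k \<in> lattice d \<Longrightarrow> (\<And>j. j \<in> {1..d} \<Longrightarrow> k j \<in> S j) \<Longrightarrow> k \<in> K"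
  shows "(\<Prod>j\<in>{1..d}. real (card (S j))) \<le> real (card K)"
proof -
  define h where "h = (\<lambda>(g::nat\<Rightarrow>int) j. if j \<in> {1..d} then g j else 0)"
  have "inj_on h (PiE {1..d} S)"
  proof (rule inj_onI, rule ext)
    fix f g j assume f: "f \<in> PiE {1..d} S" and g: "g \<in> PiE {1..d} S" and "h f = h g"
    then have "h f j = h g j" by simp
    then show "f j = g j" using PiE_arb[OF f, of j] PiE_arb[OF g, of j]
      by (cases "j \<in> {1..d}") (auto simp: h_def)
  qed
  moreover have "h ` PiE {1..d} S \<subseteq> K"
    by (intro image_subsetI S) (auto simp: h_def lattice_def)
  ultimately have "card (PiE {1..d} S) \<le> card K"
    using K by (rule card_inj_on_le)
  then show ?thesis by (simp add: card_PiE flip: of_nat_prod)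
qed

text \<open>With \<open>n\<close> the ceiling of \<open>Y\<close> there are at least
  \<open>2 * n - 1\<close> such integers, and \<open>n \<ge> 1\<close>. For small \<open>Y\<close>
  the integer 0 does the work.\<close>

lemma card_int_abs_less:
  fixes Y :: real
  assumes "Y > 0"
  shows "Y \<le> real (card {i::int. \<bar>real_of_int i\<bar> < Y})"
proof -
  define n where "n = nat \<lceil>Y\<rceil>"
  have n: "real n \<ge> Y" "real n < Y + 1" "n \<ge> 1" using assms unfolding n_def by linarith+
  have "{- int (n - 1)..int (n - 1)} \<subseteq> {i::int. \<bar>real_of_int i\<bar> < Y}"
  proof
    fix i assume "i \<in> {- int (n - 1)..int (n - 1)}"
    then have "\<bar>i\<bar> \<le> int (n - 1)" by auto
    then have "real_of_int \<bar>i\<bar> \<le> real_of_int (int (n - 1))" by (rule of_int_le_iff[THEN iffD2])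
    also have "\<dots> < Y" using n by (simp add: of_nat_diff)
    finally show "i \<in> {i. \<bar>real_of_int i\<bar> < Y}" by simp
  qed
  moreover have "finite {i::int. \<bar>real_of_int i\<bar> < Y}"
    by (rule finite_subset[of _ "{- int n..int n}"]) (use n in auto)
  ultimately have "card {- int (n - 1)..int (n - 1)} \<le> card {i::int. \<bar>real_of_int i\<bar> < Y}"
    by (intro card_mono)
  then have "2 * n - 1 \<le> card {i::int. \<bar>real_of_int i\<bar> < Y}" using n by simp
  then have "n \<le> card {i::int. \<bar>real_of_int i\<bar> < Y}" using n(3) by linarith
  then show ?thesis using n(1) by linarith
qed

lemma card_int_abs_le:
  fixes Y :: real
  assumes "Y \<ge> 1"
  shows "finite {i::int. \<bar>real_of_int i\<bar> \<le> Y}" "real (card {i::int. \<bar>real_of_int i\<bar> \<le> Y}) \<le> 3 * Y"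
proof -
  have eq: "{i::int. \<bar>real_of_int i\<bar> \<le> Y} = {- \<lfloor>Y\<rfloor>..\<lfloor>Y\<rfloor>}"
    by (auto simp: le_floor_iff minus_le_iff abs_le_iff)
  show "finite {i::int. \<bar>real_of_int i\<bar> \<le> Y}" unfolding eq by simp
  show "real (card {i::int. \<bar>real_of_int i\<bar> \<le> Y}) \<le> 3 * Y"
    unfolding eq using assms by simp linarith
qed

section \<open>The theta function of one coordinate\<close>

definition theta_sum :: "real \<Rightarrow> nat \<Rightarrow> real \<Rightarrow> real" where
  "theta_sum \<beta> L y = (\<Sum>i\<in>{- int L..int L}. exp (- y * \<bar>real_of_int i\<bar> powr (2 * \<beta>)))"

text \<open>The summand at \<open>i = 0\<close> is 1 because \<open>0 powr x = 0\<close>. The cutoff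
  \<open>L\<close> suffices for finite counts, and the later bounds are uniform in \<open>L\<close>,
  so no infinite series has to be handled.\<close>

lemma theta_sum_eq: "theta_sum \<beta> L y = 1 + 2 * (\<Sum>n=1..L. exp (- y * real n powr (2 * \<beta>)))"
proof (induction L)
  case 0
  then show ?case by (simp add: theta_sum_def)
next
  case (Suc L)
  have "{- int (Suc L)..int (Suc L)} = insert (- int (Suc L)) (insert (int (Suc L)) {- int L..int L})"
    by auto
  then have "theta_sum \<beta> (Suc L) y = theta_sum \<beta> L y + 2 * exp (- y * real (Suc L) powr (2 * \<beta>))"
    by (simp add: theta_sum_def add.commute)
  then show ?case using Suc by simp
qed

lemma theta_sum_ge1: "theta_sum \<beta> L y \<ge> 1"
  unfolding theta_sum_eq by (simp add: sum_nonneg)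

text \<open>Telescoping: the next term is at most \<open>1 / n - 1 / (n + 1)\<close>, so the
  induction carries the sharper bound \<open>2 - 1 / L\<close>.\<close>

lemma sum_inverse_squares_le: "(\<Sum>n=1..L. 1 / (real n)\<^sup>2) \<le> 2"
proof -
  have "(\<Sum>n=1..L. 1 / (real n)\<^sup>2) \<le> 2 - 1 / real L" if "L \<ge> 1"
    using that
  proof (induction L rule: dec_induct)
    case (step n)
    have "1 / (real (Suc n))\<^sup>2 \<le> 1 / (real n * real (Suc n))"
      using step(1) by (intro divide_left_mono) (auto simp: power2_eq_square)
    also have "\<dots> = 1 / real n - 1 / real (Suc n)" using step(1) by (simp add: field_simps)
    finally show ?case using step by simp
  qed simp
  then show ?thesis by (cases "L \<ge> 1") (auto intro: order_trans[of _ "2 - 1 / real L"])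
qed

lemma exp_minus_le_power:
  assumes "z > (0::real)" "N > 0"
  shows "exp (- z) \<le> (real N / z) ^ N"
proof -
  have "(z / real N) ^ N \<le> (1 + z / real N) ^ N"
    using assms by (intro power_mono) auto
  also have "\<dots> \<le> exp z"
    using assms by (intro exp_ge_one_plus_x_over_n_power_n) auto
  finally have "1 / exp z \<le> 1 / (z / real N) ^ N"
    using assms by (intro divide_left_mono) auto
  then show ?thesis by (simp add: exp_minus power_divide field_simps)
qed

text \<open>Linear growth governs small \<open>z\<close>, logarithmic growth large \<open>z\<close>,
  and \<open>z powr \<kappa>\<close> dominates both. This trades an integer power in a bound for
  theta against any smaller real power in a bound for its logarithm.\<close>

lemma ln_one_plus_le_powr:
  assumes "z > (0::real)" "0 < \<kappa>" "\<kappa> \<le> 1"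
  shows "ln (1 + z) \<le> z powr \<kappa> / \<kappa>"
proof (cases "z \<le> 1")
  case True
  have "ln (1 + z) \<le> z" using assms by (intro ln_add_one_self_le_self) auto
  also have "z = z powr 1" using assms by simp
  also have "\<dots> \<le> z powr \<kappa>" using assms True by (intro powr_mono') auto
  also have "\<dots> \<le> z powr \<kappa> / \<kappa>" using assms by (simp add: field_simps mult_left_le)
  finally show ?thesis .
next
  case False
  have "ln (1 + z) \<le> ln (2 * z)" using False by simp
  also have "\<dots> = ln 2 + ln z" using assms by (simp add: ln_mult)
  also have "\<dots> \<le> 1 / \<kappa> + (z powr \<kappa> - 1) / \<kappa>"
  proof (rule add_mono)
    have "ln (2::real) \<le> 1" using ln_le_minus_one[of "2::real"] by simp
    also have "1 \<le> 1 / \<kappa>" using assms by simp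
    finally show "ln 2 \<le> 1 / \<kappa>" .
    have "\<kappa> * ln z = ln (z powr \<kappa>)" using assms by (simp add: ln_powr)
    also have "\<dots> \<le> z powr \<kappa> - 1" using assms by (intro ln_le_minus_one) auto
    finally show "ln z \<le> (z powr \<kappa> - 1) / \<kappa>" using assms by (simp add: field_simps)
  qed
  also have "\<dots> = z powr \<kappa> / \<kappa>" by (simp add: diff_divide_distrib)
  finally show ?thesis .
qed

text \<open>The condition \<open>\<beta> * N \<ge> 1\<close> makes the decay in \<open>n\<close> at
  least quadratic, so the sum over \<open>n\<close> is bounded uniformly in the cutoff.\<close>

lemma theta_term_le:
  assumes "\<beta> > 0" "y > 0" "n \<ge> 1" "N > 0" "\<beta> * real N \<ge> 1"
  shows "exp (- y * real n powr (2 * \<beta>)) \<le> (real N / y) ^ N * (1 / (real n)\<^sup>2)"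
proof -
  have "exp (- (y * real n powr (2 * \<beta>))) \<le> (real N / (y * real n powr (2 * \<beta>))) ^ N"
    using assms by (intro exp_minus_le_power) auto
  also have "\<dots> = (real N / y) ^ N * (1 / (real n powr (2 * \<beta>)) ^ N)"
    by (simp add: power_divide power_mult_distrib)
  also have "(real n powr (2 * \<beta>)) ^ N = real n powr (2 * \<beta> * real N)"
    using assms by (simp add: powr_powr flip: powr_realpow)
  also have "(real N / y) ^ N * (1 / real n powr (2 * \<beta> * real N)) \<le> (real N / y) ^ N * (1 / real n powr 2)"
    using assms by (intro mult_left_mono divide_left_mono powr_mono) auto
  finally show ?thesis using assms by simp
qed

text \<open>Theta is at most \<open>1 + D * y powr (- N)\<close> for a large integer
  \<open>N\<close>; the logarithm with \<kappa> equal to \<open>q / N\<close> turns this into the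
  power \<open>q\<close>. Hence \<open>N\<close> must exceed both \<open>q\<close> and
  \<open>1 / \<beta>\<close>. Small \<open>q\<close> is sharp enough near 0, large \<open>q\<close>
  at infinity.\<close>

lemma ln_theta_sum_powr:
  assumes "\<beta> > 0" "q > 0"
  obtains C where "C > 0" "\<And>y L. y > 0 \<Longrightarrow> ln (theta_sum \<beta> L y) \<le> C * y powr (- q)"
proof -
  obtain N :: nat where "real N \<ge> max 1 (max q (1 / \<beta>))" using real_arch_simple by blast
  then have N: "N > 0" "real N \<ge> q" "\<beta> * real N \<ge> 1" using assms by (auto simp: field_simps)
  define D where "D = 4 * real N ^ N"
  have D: "D > 0" using N by (simp add: D_def)
  define C where "C = (real N / q) * D powr (q / real N)"
  have "C > 0" using D N assms by (simp add: C_def)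
  moreover have "ln (theta_sum \<beta> L y) \<le> C * y powr (- q)" if y: "y > 0" for y L
  proof -
    have "theta_sum \<beta> L y \<le> 1 + 2 * (\<Sum>n=1..L. (real N / y) ^ N * (1 / (real n)\<^sup>2))"
      unfolding theta_sum_eq using assms y N by (intro add_left_mono mult_left_mono sum_mono theta_term_le) auto
    also have "\<dots> \<le> 1 + 2 * ((real N / y) ^ N * 2)"
      unfolding sum_distrib_left[symmetric] using N y
      by (intro add_left_mono mult_left_mono sum_inverse_squares_le) auto
    also have "\<dots> = 1 + D * y powr (- real N)"
      using y by (simp add: D_def power_divide powr_minus powr_realpow field_simps)
    finally have "ln (theta_sum \<beta> L y) \<le> ln (1 + D * y powr (- real N))"
      using theta_sum_ge1[of \<beta> L y] by simp
    also have "\<dots> \<le> (D * y powr (- real N)) powr (q / real N) / (q / real N)"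
      using D y N assms by (intro ln_one_plus_le_powr) auto
    also have "\<dots> = C * y powr (- q)"
      using D y N by (simp add: C_def powr_mult powr_powr)
    finally show ?thesis .
  qed
  ultimately show ?thesis by (rule that)
qed

text \<open>For \<open>y \<ge> 1\<close> and \<open>n \<ge> 1\<close> the exponent
  \<open>y * n powr (2 * \<beta>)\<close> is at least \<open>(y - 1) + n powr (2 * \<beta>)\<close>:
  the first part gives the decay in \<open>y\<close>, the second makes the sum converge.\<close>

lemma ln_theta_sum_exp:
  assumes "\<beta> > 0"
  obtains C where "C > 0" "\<And>y L. y \<ge> 1 \<Longrightarrow> ln (theta_sum \<beta> L y) \<le> C * exp (- y)"
proof -
  obtain N :: nat where "real N \<ge> max 1 (1 / \<beta>)" using real_arch_simple by blast
  then have N: "N > 0" "\<beta> * real N \<ge> 1" using assms by (auto simp: field_simps)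
  define C where "C = 4 * exp 1 * real N ^ N"
  have "C > 0" using N by (simp add: C_def)
  moreover have "ln (theta_sum \<beta> L y) \<le> C * exp (- y)" if y: "y \<ge> 1" for y L
  proof -
    have "exp (- y * real n powr (2 * \<beta>)) \<le> exp (1 - y) * real N ^ N * (1 / (real n)\<^sup>2)" if n: "n \<in> {1..L}" for n
    proof -
      have "real n powr (2 * \<beta>) \<ge> 1" using n assms by (intro ge_one_powr_ge_zero) auto
      then have "(y - 1) * 1 \<le> (y - 1) * real n powr (2 * \<beta>)" using y by (intro mult_left_mono) auto
      then have "- y * real n powr (2 * \<beta>) \<le> (1 - y) + (- 1 * real n powr (2 * \<beta>))"
        by (simp add: algebra_simps)
      then have "exp (- y * real n powr (2 * \<beta>)) \<le> exp (1 - y) * exp (- 1 * real n powr (2 * \<beta>))"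
        unfolding exp_add[symmetric] by simp
      also have "\<dots> \<le> exp (1 - y) * ((real N / 1) ^ N * (1 / (real n)\<^sup>2))"
        using assms n N by (intro mult_left_mono theta_term_le) auto
      finally show ?thesis by simp
    qed
    then have "theta_sum \<beta> L y \<le> 1 + 2 * (\<Sum>n=1..L. exp (1 - y) * real N ^ N * (1 / (real n)\<^sup>2))"
      unfolding theta_sum_eq by (intro add_left_mono mult_left_mono sum_mono) auto
    also have "\<dots> \<le> 1 + 2 * (exp (1 - y) * real N ^ N * 2)"
      unfolding sum_distrib_left[symmetric]
      by (intro add_left_mono mult_left_mono sum_inverse_squares_le) auto
    also have "\<dots> = 1 + C * exp (- y)" by (simp add: C_def exp_diff exp_minus field_simps)
    finally have "ln (theta_sum \<beta> L y) \<le> ln (1 + C * exp (- y))"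
      using theta_sum_ge1[of \<beta> L y] by simp
    also have "\<dots> \<le> C * exp (- y)"
      using \<open>C > 0\<close> by (intro ln_add_one_self_le_self) auto
    finally show ?thesis .
  qed
  ultimately show ?thesis by (rule that)
qed

section \<open>Elementary growth comparisons\<close>

lemma ln_le_eps_powr:
  fixes p t \<eta> :: real
  assumes "p > 0" "t > 0" "\<eta> > 0"
  obtains C where "\<And>y. y \<ge> 1 \<Longrightarrow> (1 + ln y) powr p \<le> \<eta> * y powr t + C"
proof -
  have "((\<lambda>y::real. (1 + ln y) powr p / y powr t) \<longlongrightarrow> 0) at_top"
    using assms by real_asymp
  then have "eventually (\<lambda>y::real. (1 + ln y) powr p / y powr t < \<eta>) at_top"
    using assms by (intro order_tendstoD)
  then obtain Y where Y: "\<And>y. y \<ge> Y \<Longrightarrow> (1 + ln y) powr p / y powr t < \<eta>"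
    by (auto simp: eventually_at_top_linorder)
  show ?thesis
  proof (rule that[of "(1 + ln (max 1 Y)) powr p"])
    fix y :: real assume y: "y \<ge> 1"
    show "(1 + ln y) powr p \<le> \<eta> * y powr t + (1 + ln (max 1 Y)) powr p"
    proof (cases "y \<ge> Y")
      case True
      then have "(1 + ln y) powr p \<le> \<eta> * y powr t" using Y[OF True] y by (simp add: pos_divide_less_eq)
      then show ?thesis by (simp add: add_increasing2)
    next
      case False
      then have "(1 + ln y) powr p \<le> (1 + ln (max 1 Y)) powr p"
        using y assms by (intro powr_mono2) auto
      then show ?thesis using assms by (simp add: add_increasing)
    qed
  qed
qed

lemma powr_le_eps_powr:
  fixes p s \<eta> D :: real
  assumes "0 < p" "p < s" "\<eta> > 0"
  obtains C where "\<And>u. u \<ge> 1 \<Longrightarrow> D * u powr p \<le> \<eta> * u powr s + (C::real)"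
proof -
  have "((\<lambda>u::real. D * (u powr p / u powr s)) \<longlongrightarrow> D * 0) at_top"
    using assms by (intro tendsto_mult tendsto_const) real_asymp
  then have "eventually (\<lambda>u::real. D * (u powr p / u powr s) < \<eta>) at_top"
    using assms by (intro order_tendstoD) auto
  then obtain U where U: "\<And>u. u \<ge> U \<Longrightarrow> D * u powr p / u powr s < \<eta>"
    unfolding times_divide_eq_right by (auto simp: eventually_at_top_linorder)
  show ?thesis
  proof (rule that[of "\<bar>D\<bar> * (max 1 U) powr p"])
    fix u :: real assume u: "u \<ge> 1"
    show "D * u powr p \<le> \<eta> * u powr s + \<bar>D\<bar> * (max 1 U) powr p"
    proof (cases "u \<ge> U")
      case True
      then have "D * u powr p \<le> \<eta> * u powr s" using U[OF True] u by (simp add: pos_divide_less_eq)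
      then show ?thesis by (simp add: add_increasing2)
    next
      case False
      then have "D * u powr p \<le> \<bar>D\<bar> * (max 1 U) powr p"
        using u assms by (intro mult_mono powr_mono2) auto
      then show ?thesis using assms by (simp add: add_increasing)
    qed
  qed
qed

text \<open>Either \<open>1 + ln v\<close> is at most \<open>\<eta> * u powr (s - p)\<close>, or \<open>u\<close> is bounded by a power of \<open>1 + ln v\<close>.\<close>

lemma powr_times_ln_le:
  fixes p s t \<eta> :: real
  assumes "0 < p" "p < s" "0 < t" "\<eta> > 0"
  obtains C where "\<And>u v. u \<ge> 1 \<Longrightarrow> v \<ge> 1 \<Longrightarrow> u powr p * (1 + ln v) \<le> \<eta> * (u powr s + v powr t) + C"
proof -
  define r where "r = 1 / (s - p)"
  have r: "r > 0" using assms by (simp add: r_def)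
  define D where "D = (1 / \<eta>) powr (p * r)"
  have D: "D > 0" using assms by (simp add: D_def)
  \<comment> \<open>When \<open>u\<close> is at most \<open>(l / \<eta>) powr r\<close>, the product
    \<open>u powr p * l\<close> is at most \<open>D * l powr (p * r + 1)\<close>, and a power of a
    logarithm of \<open>v\<close> is negligible against \<open>v powr t\<close>.\<close>
  obtain C where C: "\<And>y. y \<ge> 1 \<Longrightarrow> (1 + ln y) powr (p * r + 1) \<le> \<eta> / D * y powr t + C"
    by (rule ln_le_eps_powr[of "p * r + 1" t "\<eta> / D"]) (use assms D r in \<open>auto intro: add_pos_pos\<close>)
  show ?thesis
  proof (rule that[of "max 0 (D * C)"])
    fix u v :: real assume u: "u \<ge> 1" and v: "v \<ge> 1"
    define l where "l = 1 + ln v"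
    have l: "l \<ge> 1" using v by (simp add: l_def)
    show "u powr p * (1 + ln v) \<le> \<eta> * (u powr s + v powr t) + max 0 (D * C)"
    proof (cases "l \<le> \<eta> * u powr (s - p)")
      case True
      have "u powr p * l \<le> u powr p * (\<eta> * u powr (s - p))" using True by (intro mult_left_mono) auto
      also have "\<dots> = \<eta> * u powr s" by (simp add: powr_add[symmetric] mult.left_commute)
      also have "\<dots> \<le> \<eta> * (u powr s + v powr t) + max 0 (D * C)"
        using assms by (simp add: distrib_left add_increasing2)
      finally show ?thesis by (simp add: l_def)
    next
      case False
      then have "u powr (s - p) \<le> l / \<eta>" using assms by (simp add: field_simps)
      then have "(u powr (s - p)) powr r \<le> (l / \<eta>) powr r" using r by (intro powr_mono2) auto
      then have "u \<le> (l / \<eta>) powr r" using assms u by (simp add: powr_powr r_def)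
      then have "u powr p \<le> ((l / \<eta>) powr r) powr p" using assms u by (intro powr_mono2) auto
      also have "\<dots> = D * l powr (p * r)"
        using assms l by (simp add: powr_powr D_def powr_divide mult.commute)
      finally have "u powr p * l \<le> D * l powr (p * r) * l" using l by (intro mult_right_mono) auto
      also have "\<dots> = D * l powr (p * r + 1)" using l by (simp add: powr_add)
      also have "\<dots> \<le> D * (\<eta> / D * v powr t + C)"
        using C[OF v] D unfolding l_def by (intro mult_left_mono) auto
      also have "\<dots> = \<eta> * v powr t + D * C" using D by (simp add: field_simps)
      also have "\<dots> \<le> \<eta> * (u powr s + v powr t) + max 0 (D * C)"
        using assms by (simp add: distrib_left add_increasing add_mono)
      finally show ?thesis by (simp add: l_def)
    qed
  qed
qed

text \<open>The summand is \<open>min ((m/j)\<^sup>1\<^sup>/\<^sup>2) ((m/j)\<^sup>2)\<close>; the first term is used up to \<open>\<lceil>m\<rceil>\<close>.\<close>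

lemma sum_two_sided_powr_le:
  fixes g :: "nat \<Rightarrow> real"
  assumes "m > 0" and g: "\<And>j. j \<in> {1..d} \<Longrightarrow> g j \<le> sqrt (m / real j)" "\<And>j. j \<in> {1..d} \<Longrightarrow> g j \<le> (m / real j)\<^sup>2"
  shows "(\<Sum>j=1..d. g j) \<le> 3 * m + 3"
proof -
  have A: "(\<Sum>j=1..n. g j) \<le> 2 * sqrt (m * real n)" if "n \<le> d" for n
    using that
  proof (induction n)
    case (Suc n)
    \<comment> \<open>Comparison with the increments of \<open>2 * sqrt n\<close>, which
      telescope.\<close>
    have "sqrt (m / real (Suc n)) \<le> 2 * (sqrt (m * real (Suc n)) - sqrt (m * real n))"
    proof -
      define x y where "x = sqrt (real n)" and "y = sqrt (real (Suc n))"
      have xy: "x \<ge> 0" "y > 0" "y\<^sup>2 = x\<^sup>2 + 1" "x \<le> y" by (auto simp: x_def y_def)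
      have "(y - x) * (y + x) = 1" using xy(3) by (simp add: power2_eq_square algebra_simps)
      then have "1 \<le> (y - x) * (2 * y)"
        using mult_left_mono[of "y + x" "2 * y" "y - x"] xy by simp
      then have "1 / y \<le> 2 * (y - x)" using xy by (simp add: field_simps)
      then have "sqrt m * (1 / y) \<le> sqrt m * (2 * (y - x))" using \<open>m > 0\<close> by (intro mult_left_mono) auto
      then show ?thesis unfolding x_def y_def real_sqrt_divide real_sqrt_mult
        by (simp add: right_diff_distrib mult.left_commute)
    qed
    then show ?case using Suc g(1)[of "Suc n"] by simp
  qed simp
  define D where "D = nat \<lceil>m\<rceil>"
  have D: "m \<le> real D" "real D \<le> m + 1" "D \<ge> 1" using \<open>m > 0\<close> unfolding D_def by linarith+
  have s: "2 * sqrt (m * real n) \<le> 2 * m + 2" if "real n \<le> m + 1" for n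
  proof -
    have "sqrt (m * real n) \<le> sqrt ((m + 1)\<^sup>2)"
      using that \<open>m > 0\<close> by (intro real_sqrt_le_mono) (auto simp: power2_eq_square intro!: mult_mono)
    then show ?thesis using \<open>m > 0\<close> by simp
  qed
  show ?thesis
  proof (cases "d \<le> D")
    case True
    then have "real d \<le> m + 1" using D by linarith
    then show ?thesis using A[of d] s[of d] \<open>m > 0\<close> by simp
  next
    case False
    then have Dd: "D \<le> d" by simp
    \<comment> \<open>Beyond \<open>D\<close> the quadratic bound telescopes as in the sum of
      inverse squares; the subtracted \<open>m\<^sup>2 / n\<close> is what lets the induction
      close.\<close>
    have "(\<Sum>j=1..n. g j) \<le> 2 * sqrt (m * real D) + m\<^sup>2 / real D - m\<^sup>2 / real n" if "D \<le> n" "n \<le> d" for n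
      using that
    proof (induction n rule: dec_induct)
      case base
      then show ?case using A[OF Dd] by simp
    next
      case (step n)
      have "n \<ge> 1" using step D by simp
      have "(m / real (Suc n))\<^sup>2 \<le> m\<^sup>2 / (real n * real (Suc n))"
        unfolding power_divide using \<open>n \<ge> 1\<close> by (intro divide_left_mono) (auto simp: power2_eq_square)
      also have "\<dots> = m\<^sup>2 / real n - m\<^sup>2 / real (Suc n)" using \<open>n \<ge> 1\<close> by (simp add: field_simps)
      finally show ?case using step g(2)[of "Suc n"] by simp
    qed
    from this[OF Dd order.refl] have "(\<Sum>j=1..d. g j) \<le> 2 * sqrt (m * real D) + m\<^sup>2 / real D - m\<^sup>2 / real d" .
    also have "\<dots> \<le> 2 * sqrt (m * real D) + m\<^sup>2 / real D" by simp
    also have "m\<^sup>2 / real D \<le> m"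
    proof -
      have "m * m \<le> m * real D" using D \<open>m > 0\<close> by (intro mult_left_mono) auto
      then show ?thesis using D by (simp add: power2_eq_square pos_divide_le_eq)
    qed
    also have "2 * sqrt (m * real D) + m \<le> 3 * m + 3" using s[OF D(2)] by simp
    finally show ?thesis by simp
  qed
qed

section \<open>Bounds for the count under the standing hypotheses\<close>

locale weight_seq =
  fixes a b :: "nat \<Rightarrow> real" and \<beta> :: real
  assumes a1_pos: "a 1 > 0" and a_step: "\<And>j. j \<ge> 1 \<Longrightarrow> a j \<le> a (Suc j)"
    and \<beta>_pos: "\<beta> > 0" and b_ge: "\<And>j. j \<ge> 1 \<Longrightarrow> \<beta> \<le> b j"
begin

lemma a_mono:
  assumes "1 \<le> i" "i \<le> j"
  shows "a i \<le> a j"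
  using assms(2)
proof (induction rule: dec_induct)
  case (step n)
  then show ?case using a_step[of n] assms(1) by linarith
qed simp

lemma a_ge: "j \<ge> 1 \<Longrightarrow> a 1 \<le> a j"
  by (rule a_mono) auto

lemma seq_a_pos: "j \<ge> 1 \<Longrightarrow> a j > 0"
  using a_ge a1_pos by (rule less_le_trans[rotated])

lemma seq_b_pos: "j \<ge> 1 \<Longrightarrow> b j > 0"
  using b_ge \<beta>_pos by (rule less_le_trans[rotated])

sublocale weights a b d for d
  by standard (auto intro: seq_a_pos seq_b_pos)

definition cnt :: "nat \<Rightarrow> real \<Rightarrow> nat" where
  "cnt d X = card {k \<in> lattice d. sob_weight a b d k < X}"

lemma cnt_ge1: "X > 1 \<Longrightarrow> cnt d X \<ge> 1"
proof -
  assume "X > 1"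
  then have "(\<lambda>_. 0) \<in> {k \<in> lattice d. sob_weight a b d k < X}"
    by (simp add: lattice_def sob_weight_def)
  then have "cnt d X > 0" unfolding cnt_def using finite_below[of d X] by (subst card_gt_0_iff) blast
  then show ?thesis by simp
qed

lemma coordinate_less:
  assumes "sob_weight a b d k < X" "j \<in> {1..d}"
  shows "a j * \<bar>real_of_int (k j)\<bar> powr (2 * b j) < X"
proof -
  have "a j * \<bar>real_of_int (k j)\<bar> powr (2 * b j) \<le> (\<Sum>j\<in>{1..d}. a j * \<bar>real_of_int (k j)\<bar> powr (2 * b j))"
    using assms(2) by (intro member_le_sum) (auto intro!: mult_nonneg_nonneg order_less_imp_le[OF seq_a_pos])
  then show ?thesis using assms(1) by (simp add: sob_weight_def)
qed

text \<open>A coordinate with \<open>a j \<ge> X\<close> must vanish, as any nonzero integer there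
  costs at least \<open>a j\<close>. The others take at most \<open>3 * Y j\<close> values. So the
  factor 3 is paid only where \<open>a j < X\<close>, while the power of
  \<open>max 1 (X / a 1)\<close> is charged to every coordinate, giving the full sum as
  exponent.\<close>

lemma cnt_le_product:
  assumes "X > 0"
  shows "real (cnt d X) \<le> 3 ^ card {j \<in> {1..d}. a j < X} * (max 1 (X / a 1)) powr (\<Sum>j\<in>{1..d}. 1 / (2 * b j))"
proof -
  define Y where "Y j = (X / a j) powr (1 / (2 * b j))" for j
  define Z where "Z = max 1 (X / a 1)"
  define S where "S j = (if a j < X then {i::int. \<bar>real_of_int i\<bar> \<le> Y j} else {0})" for j
  have Y1: "Y j \<ge> 1" if "j \<ge> 1" "a j < X" for j
    using that seq_a_pos[of j] seq_b_pos[of j] unfolding Y_def by (intro ge_one_powr_ge_zero) auto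
  have fin: "finite (S j)" if "j \<in> {1..d}" for j
    using that Y1[of j] card_int_abs_le(1)[of "Y j"] by (auto simp: S_def)
  have "real (cnt d X) \<le> (\<Prod>j\<in>{1..d}. real (card (S j)))"
    unfolding cnt_def
  proof (rule card_lattice_le[OF finite_below _ fin])
    fix k j assume k: "k \<in> {k \<in> lattice d. sob_weight a b d k < X}" and j: "j \<in> {1..d}"
    have less: "a j * \<bar>real_of_int (k j)\<bar> powr (2 * b j) < X"
      using k j by (intro coordinate_less) auto
    have pos: "a j > 0" "b j > 0" using j seq_a_pos seq_b_pos by auto
    show "k j \<in> S j"
    proof (cases "a j < X")
      case True
      have "\<bar>real_of_int (k j)\<bar> powr (2 * b j) \<le> X / a j"
        using less pos by (simp add: field_simps)
      then have "(\<bar>real_of_int (k j)\<bar> powr (2 * b j)) powr (1 / (2 * b j)) \<le> Y j"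
        unfolding Y_def using pos by (intro powr_mono2) auto
      then show ?thesis using True pos by (simp add: S_def powr_powr)
    next
      case False
      have "k j = 0"
      proof (rule ccontr)
        assume "k j \<noteq> 0"
        then have "\<bar>real_of_int (k j)\<bar> powr (2 * b j) \<ge> 1"
          using pos by (intro ge_one_powr_ge_zero) auto
        then have "a j * 1 \<le> a j * \<bar>real_of_int (k j)\<bar> powr (2 * b j)"
          using pos by (intro mult_left_mono) auto
        with less False show False by linarith
      qed
      then show ?thesis using False by (simp add: S_def)
    qed
  qed auto
  also have "\<dots> \<le> (\<Prod>j\<in>{1..d}. (if a j < X then 3 else 1) * Z powr (1 / (2 * b j)))"
  proof (intro prod_mono conjI)
    fix j assume j: "j \<in> {1..d}"
    have pos: "a j > 0" "b j > 0" using j seq_a_pos seq_b_pos by auto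
    have Z: "1 \<le> Z powr (1 / (2 * b j))" using pos by (intro ge_one_powr_ge_zero) (auto simp: Z_def)
    show "real (card (S j)) \<le> (if a j < X then 3 else 1) * Z powr (1 / (2 * b j))"
    proof (cases "a j < X")
      case True
      have "X / a j \<le> X / a 1" using a_ge[of j] a1_pos pos j assms by (intro divide_left_mono) auto
      then have "Y j \<le> Z powr (1 / (2 * b j))"
        unfolding Y_def Z_def using pos assms by (intro powr_mono2) auto
      moreover have "real (card (S j)) \<le> 3 * Y j"
        using card_int_abs_le(2)[OF Y1[of j]] True j by (simp add: S_def)
      ultimately show ?thesis using True by simp
    qed (use Z in \<open>simp add: S_def\<close>)
  qed auto
  also have "\<dots> = 3 ^ card {j \<in> {1..d}. a j < X} * Z powr (\<Sum>j\<in>{1..d}. 1 / (2 * b j))"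
  proof -
    have "(\<Prod>j\<in>{1..d}. if a j < X then 3 else 1) = (3::real) ^ card {j \<in> {1..d}. a j < X}"
      unfolding Collect_conj_eq Collect_mem_eq by (subst prod.If_cases) auto
    then show ?thesis
      by (subst powr_sum) (auto simp: prod.distrib Z_def)
  qed
  finally show ?thesis by (simp add: Z_def)
qed

text \<open>Rankin's trick: every counted \<open>k\<close> contributes at least \<open>1\<close> to \<open>\<Sum>\<^sub>k exp (\<tau> * (X - weight k))\<close>.\<close>

lemma ln_cnt_le_theta:
  assumes "\<tau> > 0" "X > 1"
  obtains L where "ln (real (cnt d X)) \<le> \<tau> * X + (\<Sum>j\<in>{1..d}. ln (theta_sum \<beta> L (\<tau> * a j)))"
proof -
  define K where "K = {k \<in> lattice d. sob_weight a b d k < X}"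
  have K: "finite K" "K \<subseteq> lattice d" using finite_below by (auto simp: K_def)
  \<comment> \<open>All entries of the finitely many counted points; their maximum gives a box that
    contains \<open>K\<close>.\<close>
  define V where "V = (\<Union>k\<in>K. (\<lambda>j. nat \<bar>k j\<bar>) ` {1..d})"
  have "finite V" using K by (auto simp: V_def)
  define L where "L = Max (insert 0 V)"
  have L: "k j \<in> {- int L..int L}" if "k \<in> K" "j \<in> {1..d}" for k j
  proof -
    have "nat \<bar>k j\<bar> \<in> V" using that unfolding V_def by blast
    then have "nat \<bar>k j\<bar> \<le> L" unfolding L_def using \<open>finite V\<close> by (intro Max_ge) auto
    then show ?thesis by auto
  qed
  define \<phi> where "\<phi> j i = exp (- (\<tau> * a j) * \<bar>real_of_int i\<bar> powr (2 * \<beta>))" for j i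
  have "real (card K) \<le> (\<Sum>k\<in>K. exp (\<tau> * X) * (\<Prod>j\<in>{1..d}. \<phi> j (k j)))"
  proof -
    have "1 \<le> exp (\<tau> * X) * (\<Prod>j\<in>{1..d}. \<phi> j (k j))" if "k \<in> K" for k
    proof -
      \<comment> \<open>An integer is 0 or has modulus at least 1, so lowering the exponent from
        \<open>b j\<close> to \<beta> does not raise the weight.\<close>
      have "(\<Sum>j\<in>{1..d}. a j * \<bar>real_of_int (k j)\<bar> powr (2 * \<beta>)) \<le> (\<Sum>j\<in>{1..d}. a j * \<bar>real_of_int (k j)\<bar> powr (2 * b j))"
      proof (intro sum_mono mult_left_mono)
        fix j assume j: "j \<in> {1..d}"
        show "\<bar>real_of_int (k j)\<bar> powr (2 * \<beta>) \<le> \<bar>real_of_int (k j)\<bar> powr (2 * b j)"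
          using b_ge[of j] j by (cases "k j = 0") (auto intro!: powr_mono)
      qed (use seq_a_pos in \<open>auto intro: less_imp_le\<close>)
      also have "\<dots> \<le> X" using that by (simp add: K_def sob_weight_def)
      finally have "\<tau> * (\<Sum>j\<in>{1..d}. a j * \<bar>real_of_int (k j)\<bar> powr (2 * \<beta>)) \<le> \<tau> * X"
        using assms by (intro mult_left_mono) auto
      then have "0 \<le> \<tau> * X + (\<Sum>j\<in>{1..d}. - (\<tau> * a j) * \<bar>real_of_int (k j)\<bar> powr (2 * \<beta>))"
        by (simp add: sum_distrib_left sum_negf mult.assoc)
      then have "exp 0 \<le> exp (\<tau> * X + (\<Sum>j\<in>{1..d}. - (\<tau> * a j) * \<bar>real_of_int (k j)\<bar> powr (2 * \<beta>)))"
        by (rule exp_le_cancel_iff[THEN iffD2])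
      then show ?thesis unfolding \<phi>_def by (simp add: exp_add exp_sum)
    qed
    then have "(\<Sum>k\<in>K. 1) \<le> (\<Sum>k\<in>K. exp (\<tau> * X) * (\<Prod>j\<in>{1..d}. \<phi> j (k j)))" by (intro sum_mono)
    then show ?thesis by simp
  qed
  also have "\<dots> \<le> exp (\<tau> * X) * (\<Prod>j\<in>{1..d}. \<Sum>i\<in>{- int L..int L}. \<phi> j i)"
    unfolding sum_distrib_left[symmetric]
    by (intro mult_left_mono sum_prod_lattice_le K L) (auto simp: \<phi>_def)
  also have "\<dots> = exp (\<tau> * X) * (\<Prod>j\<in>{1..d}. theta_sum \<beta> L (\<tau> * a j))"
    by (simp add: theta_sum_def \<phi>_def)
  finally have le: "real (card K) \<le> exp (\<tau> * X) * (\<Prod>j\<in>{1..d}. theta_sum \<beta> L (\<tau> * a j))" .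
  have pos: "theta_sum \<beta> L y > 0" for y using theta_sum_ge1[of \<beta> L y] by linarith
  have "card K \<ge> 1" using cnt_ge1[OF assms(2), of d] by (simp add: cnt_def K_def)
  then have "ln (real (card K)) \<le> ln (exp (\<tau> * X) * (\<Prod>j\<in>{1..d}. theta_sum \<beta> L (\<tau> * a j)))"
    using le by (intro ln_mono) auto
  also have "\<dots> = \<tau> * X + ln (\<Prod>j\<in>{1..d}. theta_sum \<beta> L (\<tau> * a j))"
    using prod_pos[of "{1..d}" "\<lambda>j. theta_sum \<beta> L (\<tau> * a j)"] pos
    by (subst ln_mult_pos) (auto simp del: prod_pos)
  also have "ln (\<Prod>j\<in>{1..d}. theta_sum \<beta> L (\<tau> * a j)) = (\<Sum>j\<in>{1..d}. ln (theta_sum \<beta> L (\<tau> * a j)))"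
  proof (rule ln_prod[OF finite_atLeastAtMost])
    show "theta_sum \<beta> L (\<tau> * a j) \<noteq> 0" for j using pos[of "\<tau> * a j"] by simp
  qed
  finally show ?thesis by (intro that[of L]) (simp add: cnt_def K_def)
qed

text \<open>A 0-1 vector has weight one plus the sum of \<open>a j\<close> over its support,
  whatever \<open>b\<close> is, and monotonicity bounds each of these terms by
  \<open>a d\<close>.\<close>

lemma cnt_ge_subsets:
  assumes "1 + real m * a d < X" "d \<ge> 1"
  shows "card {T. T \<subseteq> {1..d} \<and> card T \<le> m} \<le> cnt d X"
  unfolding cnt_def
proof (rule card_inj_on_le[OF _ _ finite_below])
  show "inj_on (\<lambda>T j. if j \<in> T then 1 else 0 :: int) {T. T \<subseteq> {1..d} \<and> card T \<le> m}"
    by (rule inj_onI) (auto simp: fun_eq_iff split: if_splits)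
  show "(\<lambda>T j. if j \<in> T then 1 else 0) ` {T. T \<subseteq> {1..d} \<and> card T \<le> m} \<subseteq> {k \<in> lattice d. sob_weight a b d k < X}"
  proof (rule image_subsetI)
    fix T assume "T \<in> {T. T \<subseteq> {1..d} \<and> card T \<le> m}"
    then have T: "T \<subseteq> {1..d}" "card T \<le> m" by auto
    have "(\<Sum>j\<in>{1..d}. a j * \<bar>real_of_int (if j \<in> T then 1 else 0)\<bar> powr (2 * b j)) = (\<Sum>j\<in>{1..d}. if j \<in> T then a j else 0)"
      by (intro sum.cong) auto
    also have "\<dots> = (\<Sum>j\<in>T. a j)" using T by (subst sum.inter_restrict[symmetric]) (auto simp: Int_absorb1)
    also have "\<dots> \<le> (\<Sum>j\<in>T. a d)" using T by (intro sum_mono a_mono) auto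
    also have "\<dots> \<le> real m * a d" using T seq_a_pos[OF assms(2)] by (simp add: mult_right_mono)
    finally show "(\<lambda>j. if j \<in> T then 1 else 0) \<in> {k \<in> lattice d. sob_weight a b d k < X}"
      using T assms(1) by (auto simp: lattice_def sob_weight_def)
  qed
qed

lemma cnt_ge_power2:
  assumes "1 + real d * a d < X" "d \<ge> 1"
  shows "2 ^ d \<le> real (cnt d X)"
proof -
  have "{T. T \<subseteq> {1..d} \<and> card T \<le> d} = Pow {1..d}"
    using card_mono[of "{1..d}"] by fastforce
  then have "2 ^ d \<le> cnt d X" using cnt_ge_subsets[OF assms] by (simp add: card_Pow)
  then have "real (2 ^ d) \<le> real (cnt d X)" by (simp only: of_nat_le_iff)
  then show ?thesis by simp
qed

lemma cnt_ge_binomial: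
  assumes "1 + real m * a d < X" "d \<ge> 1"
  shows "d choose m \<le> cnt d X"
proof -
  have "d choose m = card {T. T \<subseteq> {1..d} \<and> card T = m}"
    by (subst n_subsets) auto
  also have "\<dots> \<le> card {T. T \<subseteq> {1..d} \<and> card T \<le> m}"
    by (rule card_mono) (auto intro: finite_subset[of _ "Pow {1..d}"])
  finally show ?thesis using cnt_ge_subsets[OF assms] by linarith
qed

text \<open>Each coordinate gets an equal share \<open>X / (2 * d)\<close> of the budget. The other
  half of \<open>X\<close> pays for the constant 1 in the weight, hence
  \<open>X \<ge> 2\<close>.\<close>

lemma cnt_ge_powr:
  assumes d: "d \<ge> 1"
  obtains c where "c > 0" "\<And>X. X \<ge> 2 \<Longrightarrow> c * X powr (\<Sum>j\<in>{1..d}. 1 / (2 * b j)) \<le> real (cnt d X)"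
proof -
  define c where "c = (\<Prod>j\<in>{1..d}. (1 / (2 * real d * a j)) powr (1 / (2 * b j)))"
  have pos: "2 * real d * a j > 0" "b j > 0" "a j > 0" "d > 0" if "j \<in> {1..d}" for j
    using that seq_a_pos[of j] seq_b_pos[of j] d by auto
  have "c > 0" unfolding c_def
  proof (rule prod_pos)
    fix j assume "j \<in> {1..d}"
    from pos(1)[OF this] have "1 / (2 * real d * a j) \<noteq> 0" by (metis divide_eq_0_iff less_irrefl zero_neq_one)
    then show "(1 / (2 * real d * a j)) powr (1 / (2 * b j)) > 0" unfolding powr_gt_zero .
  qed
  moreover have "c * X powr (\<Sum>j\<in>{1..d}. 1 / (2 * b j)) \<le> real (cnt d X)" if X: "X \<ge> 2" for X
  proof -
    define Y where "Y j = (X / (2 * real d * a j)) powr (1 / (2 * b j))" for j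
    have Y: "Y j > 0" if "j \<in> {1..d}" for j using pos[OF that] X by (simp add: Y_def)
    have "c * X powr (\<Sum>j\<in>{1..d}. 1 / (2 * b j)) = (\<Prod>j\<in>{1..d}. (1 / (2 * real d * a j)) powr (1 / (2 * b j)) * X powr (1 / (2 * b j)))"
      using X by (subst powr_sum) (auto simp: c_def prod.distrib)
    also have "\<dots> = (\<Prod>j\<in>{1..d}. Y j)"
      unfolding Y_def using pos X by (intro prod.cong refl) (subst powr_mult[symmetric], auto simp: less_imp_le)
    also have "\<dots> \<le> (\<Prod>j\<in>{1..d}. real (card {i::int. \<bar>real_of_int i\<bar> < Y j}))"
      using Y by (intro prod_mono conjI card_int_abs_less less_imp_le[OF Y])
    also have "\<dots> \<le> real (cnt d X)"
      unfolding cnt_def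
    proof (rule card_lattice_ge[OF finite_below])
      fix k assume k: "k \<in> lattice d" "\<And>j. j \<in> {1..d} \<Longrightarrow> k j \<in> {i. \<bar>real_of_int i\<bar> < Y j}"
      have "(\<Sum>j\<in>{1..d}. a j * \<bar>real_of_int (k j)\<bar> powr (2 * b j)) < (\<Sum>j\<in>{1..d}. X / (2 * real d))"
      proof (rule sum_strict_mono)
        fix j assume j: "j \<in> {1..d}"
        have "\<bar>real_of_int (k j)\<bar> powr (2 * b j) < Y j powr (2 * b j)"
          using k(2)[OF j] pos[OF j] by (intro powr_less_mono2) auto
        also have "\<dots> = X / (2 * real d * a j)"
          using pos[OF j] X by (simp add: Y_def powr_powr)
        finally show "a j * \<bar>real_of_int (k j)\<bar> powr (2 * b j) < X / (2 * real d)"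
          using seq_a_pos[of j] j d by (simp add: field_simps)
      qed (use d in auto)
      also have "\<dots> = X / 2" using d by simp
      finally show "k \<in> {k \<in> lattice d. sob_weight a b d k < X}"
        using k(1) X by (simp add: sob_weight_def)
    qed
    finally show ?thesis .
  qed
  ultimately show ?thesis by (rule that)
qed

lemma info_compl_eq_cnt: "\<epsilon> > 0 \<Longrightarrow> info_compl a b \<epsilon> d = cnt d ((1 / \<epsilon>)\<^sup>2)"
  by (simp add: info_compl_eq cnt_def power_divide)

end

section \<open>Weak tractability\<close>

lemma filterlim_at_topD_frequently:
  fixes f :: "nat \<Rightarrow> real"
  assumes "\<not> filterlim f at_top sequentially"
  obtains Z where "Z \<ge> 1" "\<And>n. \<exists>m\<ge>n. f m < Z"
proof -
  obtain Z where "\<not> eventually (\<lambda>x. Z \<le> f x) sequentially"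
    using assms unfolding filterlim_at_top by blast
  then have "\<exists>m\<ge>n. f m < Z" for n
    unfolding eventually_sequentially by (auto simp: not_le)
  then show ?thesis by (intro that[of "max 1 Z"]) (auto, meson less_max_iff_disj)
qed

text \<open>Isolates the indices below \<open>J\<close>, about which an asymptotic hypothesis says
  nothing, at a cost independent of \<open>d\<close>.\<close>

lemma sum_split_bound:
  fixes g h :: "nat \<Rightarrow> real"
  assumes "\<And>j. j \<in> {1..d} \<Longrightarrow> j < J \<Longrightarrow> g j \<le> M" "\<And>j. j \<in> {1..d} \<Longrightarrow> j \<ge> J \<Longrightarrow> g j \<le> h j"
    and "M \<ge> 0" "\<And>j. j \<in> {1..d} \<Longrightarrow> h j \<ge> 0"
  shows "(\<Sum>j\<in>{1..d}. g j) \<le> real J * M + (\<Sum>j\<in>{1..d}. h j)"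
proof -
  have "(\<Sum>j\<in>{1..d}. g j) \<le> (\<Sum>j\<in>{1..d}. (if j \<in> {..<J} then M else 0) + h j)"
    using assms by (intro sum_mono) (force simp: not_less)
  also have "\<dots> = real (card ({1..d} \<inter> {..<J})) * M + (\<Sum>j\<in>{1..d}. h j)"
    unfolding sum.distrib by (subst sum.inter_restrict[symmetric]) auto
  also have "card ({1..d} \<inter> {..<J}) \<le> card {..<J}" by (intro card_mono) auto
  then have "real (card ({1..d} \<inter> {..<J})) * M \<le> real J * M"
    using assms(3) by (intro mult_right_mono) auto
  finally show ?thesis by simp
qed

lemma stWT_mono:
  assumes "stWT s t N" "s \<le> s'" "t \<le> t'"
  shows "stWT s' t' N"
  unfolding stWT_def
proof (intro allI impI)
  fix e :: real assume "e > 0"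
  then obtain R where R: "\<And>d \<epsilon>. d \<ge> 1 \<Longrightarrow> \<epsilon> \<in> {0<..<1} \<Longrightarrow> 1 / \<epsilon> + real d > R \<Longrightarrow>
      \<bar>ln (real (N \<epsilon> d)) / ((1 / \<epsilon>) powr s + real d powr t)\<bar> \<le> e"
    using assms(1) unfolding stWT_def by blast
  show "\<exists>R. \<forall>d\<ge>1. \<forall>\<epsilon>\<in>{0<..<1}. 1 / \<epsilon> + real d > R \<longrightarrow>
      \<bar>ln (real (N \<epsilon> d)) / ((1 / \<epsilon>) powr s' + real d powr t')\<bar> \<le> e"
  proof (intro exI[of _ R] allI ballI impI)
    fix d :: nat and \<epsilon> :: real assume d: "d \<ge> 1" and \<epsilon>: "\<epsilon> \<in> {0<..<1}" and gt: "1 / \<epsilon> + real d > R"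
    have pos: "0 < (1 / \<epsilon>) powr s + real d powr t" using d by (intro add_nonneg_pos) auto
    have "(1 / \<epsilon>) powr s + real d powr t \<le> (1 / \<epsilon>) powr s' + real d powr t'"
      using d \<epsilon> assms by (intro add_mono powr_mono) auto
    then have "\<bar>ln (real (N \<epsilon> d))\<bar> / ((1 / \<epsilon>) powr s' + real d powr t') \<le> \<bar>ln (real (N \<epsilon> d))\<bar> / ((1 / \<epsilon>) powr s + real d powr t)"
      using pos by (intro divide_left_mono) auto
    also have "\<dots> \<le> e" using R[OF d \<epsilon> gt] pos by (simp add: abs_divide)
    finally show "\<bar>ln (real (N \<epsilon> d)) / ((1 / \<epsilon>) powr s' + real d powr t')\<bar> \<le> e"
      by (simp add: abs_divide)
  qed
qed

lemma Liminf_pos_iff: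
  "Liminf sequentially (\<lambda>j. ereal (f j)) > 0 \<longleftrightarrow> (\<exists>\<delta>>0. eventually (\<lambda>j. f j \<ge> \<delta>) sequentially)"
proof
  assume "Liminf sequentially (\<lambda>j. ereal (f j)) > 0"
  then obtain y where y: "0 < y" "y < Liminf sequentially (\<lambda>j. ereal (f j))" using dense by blast
  then obtain \<delta> where \<delta>: "y = ereal \<delta>" by (cases y) auto
  from less_LiminfD[OF y(2)] have "eventually (\<lambda>j. f j \<ge> \<delta>) sequentially"
    unfolding \<delta> by eventually_elim simp
  then show "\<exists>\<delta>>0. eventually (\<lambda>j. f j \<ge> \<delta>) sequentially" using y(1) \<delta> by auto
next
  assume "\<exists>\<delta>>0. eventually (\<lambda>j. f j \<ge> \<delta>) sequentially"
  then obtain \<delta> where "\<delta> > 0" "eventually (\<lambda>j. f j \<ge> \<delta>) sequentially" by blast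
  then have "ereal \<delta> \<le> Liminf sequentially (\<lambda>j. ereal (f j))"
    by (intro Liminf_bounded) (auto elim: eventually_mono)
  then show "Liminf sequentially (\<lambda>j. ereal (f j)) > 0" using \<open>\<delta> > 0\<close> by (metis ereal_less(2) less_le_trans)
qed

context weight_seq
begin

lemma ln_cnt_nonneg: "E > 1 \<Longrightarrow> 0 \<le> ln (real (cnt d (E\<^sup>2)))"
  using cnt_ge1[of "E\<^sup>2" d] by (intro ln_ge_zero) (auto simp: one_less_power)

text \<open>\<open>E powr s + d powr t\<close> is at least \<open>max E d powr min s t\<close>. A
  large \<open>E + d\<close> therefore pushes it above \<open>2 * C / e\<close>, in whichever way
  the sum becomes large, and \<open>C\<close> costs at most half of \<open>e\<close>.\<close>

lemma stWT_I:
  assumes "s > 0" "t > 0"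
    and bound: "\<And>\<eta>. \<eta> > 0 \<Longrightarrow> \<exists>C. \<forall>d\<ge>1. \<forall>E>1. ln (real (cnt d (E\<^sup>2))) \<le> \<eta> * (E powr s + real d powr t) + C"
  shows "stWT s t (info_compl a b)"
  unfolding stWT_def
proof (intro allI impI)
  fix e :: real assume e: "e > 0"
  obtain C where C: "\<And>d E. d \<ge> 1 \<Longrightarrow> E > 1 \<Longrightarrow> ln (real (cnt d (E\<^sup>2))) \<le> e / 2 * (E powr s + real d powr t) + C"
    using bound[of "e / 2"] e by (auto simp del: divide_eq_eq)
  define m where "m = min s t"
  have m: "m > 0" "m \<le> s" "m \<le> t" using assms by (auto simp: m_def)
  define W where "W = max 1 (2 * C / e)"
  define R where "R = 2 * W powr (1 / m)"
  show "\<exists>R. \<forall>d\<ge>1. \<forall>\<epsilon>\<in>{0<..<1}. 1 / \<epsilon> + real d > R \<longrightarrow>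
      \<bar>ln (real (info_compl a b \<epsilon> d)) / ((1 / \<epsilon>) powr s + real d powr t)\<bar> \<le> e"
  proof (intro exI[of _ R] allI ballI impI)
    fix d :: nat and \<epsilon> :: real assume d: "d \<ge> 1" and \<epsilon>: "\<epsilon> \<in> {0<..<1}" and gt: "1 / \<epsilon> + real d > R"
    define E where "E = 1 / \<epsilon>"
    have E: "E > 1" using \<epsilon> by (simp add: E_def)
    define D where "D = E powr s + real d powr t"
    have D: "D > 0" using d by (auto simp: D_def intro: add_nonneg_pos)
    have "W powr (1 / m) < max E (real d)" using gt by (simp add: R_def E_def)
    then have "(W powr (1 / m)) powr m < (max E (real d)) powr m"
      using m by (intro powr_less_mono2) auto
    then have "W < (max E (real d)) powr m" using m by (simp add: powr_powr W_def)
    also have "\<dots> \<le> D"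
    proof (cases "E \<le> real d")
      case True
      have "real d powr m \<le> real d powr t" using m d by (intro powr_mono) auto
      then show ?thesis using True by (simp add: D_def add_increasing)
    next
      case False
      have "E powr m \<le> E powr s" using m E by (intro powr_mono) auto
      then show ?thesis using False by (simp add: D_def add_increasing2)
    qed
    finally have "2 * C / e \<le> D" by (simp add: W_def)
    then have "C \<le> e / 2 * D" using e by (simp add: field_simps)
    with C[OF d E] have "ln (real (cnt d (E\<^sup>2))) \<le> e * D" by (simp add: D_def)
    then have "ln (real (cnt d (E\<^sup>2))) / D \<le> e" using D by (simp add: pos_divide_le_eq)
    moreover have "info_compl a b \<epsilon> d = cnt d (E\<^sup>2)" using \<epsilon> by (simp add: info_compl_eq_cnt E_def)
    ultimately show "\<bar>ln (real (info_compl a b \<epsilon> d)) / ((1 / \<epsilon>) powr s + real d powr t)\<bar> \<le> e"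
      using D ln_cnt_nonneg[OF E, of d] unfolding E_def[symmetric] D_def[symmetric] by (simp add: abs_of_nonneg)
  qed
qed

section \<open>Necessary conditions from 0-1 vectors\<close>

lemma stWT_D:
  assumes "stWT s t (info_compl a b)" "e > 0"
  obtains R where "\<And>d E. d \<ge> 1 \<Longrightarrow> E > 1 \<Longrightarrow> E + real d > R \<Longrightarrow> ln (real (cnt d (E\<^sup>2))) \<le> e * (E powr s + real d powr t)"
proof -
  obtain R where R: "\<And>d \<epsilon>. d \<ge> 1 \<Longrightarrow> \<epsilon> \<in> {0<..<1} \<Longrightarrow> 1 / \<epsilon> + real d > R \<Longrightarrow>
      \<bar>ln (real (info_compl a b \<epsilon> d)) / ((1 / \<epsilon>) powr s + real d powr t)\<bar> \<le> e"
    using assms unfolding stWT_def by blast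
  show ?thesis
  proof (rule that[of R])
    fix d :: nat and E :: real assume d: "d \<ge> 1" and E: "E > 1" and gt: "E + real d > R"
    have "\<bar>ln (real (cnt d (E\<^sup>2))) / (E powr s + real d powr t)\<bar> \<le> e"
      using R[of d "1 / E"] d E gt by (simp add: info_compl_eq_cnt)
    moreover have "0 < E powr s + real d powr t" using d by (intro add_nonneg_pos) auto
    ultimately show "ln (real (cnt d (E\<^sup>2))) \<le> e * (E powr s + real d powr t)"
      by (simp add: pos_divide_le_eq abs_le_iff)
  qed
qed

text \<open>If the quotient stays below \<open>A\<close> at infinitely many \<open>d\<close>, all
  \<open>2 ^ d\<close> zero-one vectors have weight below a threshold of order
  \<open>d powr (2 / s)\<close>. Then \<open>E powr s\<close> is of order \<open>d\<close>, as is
  the logarithm of the count, and \<open>t \<le> 1\<close> keeps \<open>d powr t\<close> below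
  \<open>d\<close>. At \<open>s = 2\<close> the conclusion says that \<open>a\<close>
  diverges.\<close>

lemma stWT_imp_filterlim_powr:
  assumes wt: "stWT s t (info_compl a b)" and st: "0 < s" "0 < t" "t \<le> 1"
  shows "filterlim (\<lambda>j. a j / real j powr ((2 - s) / s)) at_top sequentially"
proof (rule ccontr)
  assume "\<not> ?thesis"
  then obtain A where A: "A \<ge> 1" "\<And>n. \<exists>m\<ge>n. a m / real m powr ((2 - s) / s) < A"
    by (rule filterlim_at_topD_frequently) blast
  define B where "B = (2 + A) powr (s / 2) + 1"
  have B: "B > 0" unfolding B_def by (intro add_nonneg_pos) auto
  \<comment> \<open>\<open>B\<close> satisfies \<open>E powr s + d powr t \<le> B * d\<close>, so
    this \<open>e\<close> allows only half of the lower bound \<open>d * ln 2\<close>.\<close>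
  define e where "e = ln 2 / (2 * B)"
  have e: "e > 0" using B by (simp add: e_def)
  obtain R where R: "\<And>d E. d \<ge> 1 \<Longrightarrow> E > 1 \<Longrightarrow> E + real d > R \<Longrightarrow> ln (real (cnt d (E\<^sup>2))) \<le> e * (E powr s + real d powr t)"
    using stWT_D[OF wt e] by blast
  obtain d where d: "d \<ge> max 1 (nat \<lceil>R\<rceil>)" "a d / real d powr ((2 - s) / s) < A" using A(2) by blast
  have d1: "d \<ge> 1" "real d \<ge> R" using d(1) by linarith+
  define X where "X = 2 + A * real d powr (2 / s)"
  have X: "X \<ge> 2" using A by (simp add: X_def)
  have "real d * a d \<le> real d * (A * real d powr ((2 - s) / s))"
    using d(2) d1 by (intro mult_left_mono) (auto simp: pos_divide_less_eq)
  also have "\<dots> = A * (real d powr 1 * real d powr ((2 - s) / s))" using d1 by simp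
  also have "\<dots> = A * real d powr (2 / s)"
    unfolding powr_add[symmetric] using st by (simp add: diff_divide_distrib)
  finally have "2 ^ d \<le> real (cnt d X)" using d1 by (intro cnt_ge_power2) (auto simp: X_def)
  then have "ln (2 ^ d) \<le> ln (real (cnt d X))" by (intro ln_mono) auto
  then have lower: "real d * ln 2 \<le> ln (real (cnt d X))" by (simp add: ln_realpow)
  define E where "E = sqrt X"
  have E: "E > 1" "E\<^sup>2 = X" using X by (auto simp: E_def)
  have "X \<le> (2 + A) * real d powr (2 / s)"
    using ge_one_powr_ge_zero[of "real d" "2 / s"] d1 st by (simp add: X_def distrib_right)
  then have "X powr (s / 2) \<le> ((2 + A) * real d powr (2 / s)) powr (s / 2)"
    using X st by (intro powr_mono2) auto
  also have "\<dots> = (2 + A) powr (s / 2) * real d" using A d1 st by (simp add: powr_mult powr_powr)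
  finally have "E powr s \<le> (2 + A) powr (s / 2) * real d"
    using X by (simp add: E_def powr_half_sqrt[symmetric] powr_powr)
  moreover have "real d powr t \<le> real d powr 1" using d1 st by (intro powr_mono) auto
  ultimately have "E powr s + real d powr t \<le> B * real d" using d1 by (simp add: B_def distrib_right)
  then have "e * (E powr s + real d powr t) \<le> e * (B * real d)" using e by (intro mult_left_mono) auto
  also have "\<dots> = real d * ln 2 / 2" using B by (simp add: e_def)
  finally have "real d * ln 2 \<le> real d * ln 2 / 2"
    using R[OF d1(1) E(1)] d1(2) E lower by simp
  then show False using d1 by simp
qed

text \<open>Only supports of size \<open>m\<close>, about \<open>d powr t\<close>, are used. There
  are at least \<open>(d / m) ^ m\<close> of them, with logarithm of order \<open>m * ln d\<close>
  because \<open>t < 1\<close>. If \<open>a d\<close> is below \<open>A * ln d\<close>, the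
  threshold \<open>E\<^sup>2\<close> is also of order \<open>m * ln d\<close>.\<close>

lemma stWT_2_imp_filterlim_ln:
  assumes wt: "stWT 2 t (info_compl a b)" and t: "0 < t" "t < 1"
  shows "filterlim (\<lambda>j. a j / ln (real j)) at_top sequentially"
proof (rule ccontr)
  assume "\<not> ?thesis"
  then obtain A where A: "A \<ge> 1" "\<And>n. \<exists>m\<ge>n. a m / ln (real m) < A"
    by (rule filterlim_at_topD_frequently) blast
  \<comment> \<open>\<open>A + 3\<close> comes from
    \<open>E\<^sup>2 + d powr t \<le> (A + 3) * m * ln d\<close>; the 4 leaves half of the lower
    constant \<open>(1 - t) / 2\<close>.\<close>
  define e where "e = (1 - t) / (4 * (A + 3))"
  have e: "e > 0" using A t by (simp add: e_def)
  obtain R where R: "\<And>d E. d \<ge> 1 \<Longrightarrow> E > 1 \<Longrightarrow> E + real d > R \<Longrightarrow> ln (real (cnt d (E\<^sup>2))) \<le> e * (E powr 2 + real d powr t)"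
    using stWT_D[OF wt e] by blast
  have "filterlim (\<lambda>d. ln (real d)) at_top sequentially" by real_asymp
  \<comment> \<open>The second bound absorbs the factor 2 lost in rounding \<open>m\<close>
    up.\<close>
  then have "eventually (\<lambda>d. ln (real d) \<ge> max 1 (2 * ln 2 / (1 - t))) sequentially"
    by (simp only: filterlim_at_top)
  then obtain D where D: "\<And>d. d \<ge> D \<Longrightarrow> ln (real d) \<ge> max 1 (2 * ln 2 / (1 - t))"
    by (auto simp: eventually_sequentially)
  obtain d where d: "d \<ge> max (max 1 (nat \<lceil>R\<rceil>)) D" "a d / ln (real d) < A" using A(2) by blast
  have d1: "d \<ge> 1" "real d \<ge> R" using d(1) by linarith+
  have l: "ln (real d) \<ge> 1" "ln (real d) \<ge> 2 * ln 2 / (1 - t)" using D[of d] d(1) by auto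
  have ad: "a d \<le> A * ln (real d)" using d(2) l by (simp add: pos_divide_less_eq)
  define m where "m = nat \<lceil>real d powr t\<rceil>"
  have dt: "real d powr t \<ge> 1" using d1 t by (intro ge_one_powr_ge_zero) auto
  have "real d powr t \<le> real d powr 1" using d1 t by (intro powr_mono) auto
  then have m: "real d powr t \<le> real m" "real m \<le> 2 * real d powr t" "m \<le> d" "m \<ge> 1"
    using dt d1 unfolding m_def by (auto, linarith+)
  define X where "X = 2 + real m * (A * ln (real d))"
  have X: "X \<ge> 2" using A l by (simp add: X_def)
  define E where "E = sqrt X"
  have E: "E > 1" "E\<^sup>2 = X" "E powr 2 = X" using X by (auto simp: E_def)
  have "real m * a d \<le> real m * (A * ln (real d))" using ad by (intro mult_left_mono) auto
  then have "d choose m \<le> cnt d X" using d1 by (intro cnt_ge_binomial) (auto simp: X_def)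
  then have "(real d / real m) ^ m \<le> real (cnt d X)"
    using binomial_ge_n_over_k_pow_k[OF m(3), where 'a=real] by (meson of_nat_le_iff order_trans)
  then have "ln ((real d / real m) ^ m) \<le> ln (real (cnt d X))" using d1 m by (intro ln_mono) auto
  then have "real m * ln (real d / real m) \<le> ln (real (cnt d X))" using d1 m by (simp add: ln_realpow)
  moreover have "(1 - t) / 2 * ln (real d) \<le> ln (real d / real m)"
  proof -
    have "ln (real m) \<le> ln (2 * real d powr t)" using m d1 by (intro ln_mono) auto
    also have "\<dots> = ln 2 + t * ln (real d)" using d1 by (simp add: ln_mult ln_powr)
    finally have "ln (real d / real m) \<ge> (1 - t) * ln (real d) - ln 2" using m d1 by (simp add: ln_div algebra_simps)
    moreover have "ln 2 \<le> (1 - t) / 2 * ln (real d)" using l(2) t by (simp add: field_simps)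
    ultimately show ?thesis by (simp add: field_simps)
  qed
  then have "real m * ((1 - t) / 2 * ln (real d)) \<le> real m * ln (real d / real m)" by (intro mult_left_mono) auto
  ultimately have "real m * ((1 - t) / 2 * ln (real d)) \<le> e * (E powr 2 + real d powr t)"
    using R[OF d1(1) E(1)] d1(2) E by simp
  also have "\<dots> \<le> e * ((A + 3) * (real m * ln (real d)))"
  proof (intro mult_left_mono)
    have ml: "real m * 1 \<le> real m * ln (real d)" using l by (intro mult_left_mono) auto
    have "2 + real d powr t \<le> 3 * (real m * ln (real d))" using ml m(1,4) by linarith
    moreover have "E powr 2 = 2 + A * (real m * ln (real d))" by (simp add: E(3) X_def mult.left_commute)
    ultimately show "E powr 2 + real d powr t \<le> (A + 3) * (real m * ln (real d))"
      unfolding distrib_right by linarith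
  qed (use e in simp)
  also have "\<dots> = e * (A + 3) * (real m * ln (real d))" by (simp only: mult.assoc)
  also have "e * (A + 3) = (1 - t) / 4" using A by (simp add: e_def field_simps)
  finally have "real m * ((1 - t) / 2 * ln (real d)) \<le> (1 - t) / 4 * (real m * ln (real d))" .
  moreover have "real m * ((1 - t) / 2 * ln (real d)) = 2 * ((1 - t) / 4 * (real m * ln (real d)))" by simp
  moreover have "0 < ln (real d)" using l(1) by linarith
  then have "0 < (1 - t) / 4 * (real m * ln (real d))" using m(4) t by (intro mult_pos_pos) simp_all
  ultimately show False by linarith
qed

section \<open>Sufficient conditions from the theta bound\<close>

lemma theta_powr_bound:
  assumes "q > 0"
  obtains C where "C > 0" "\<And>\<tau> j L. \<tau> > 0 \<Longrightarrow> j \<ge> 1 \<Longrightarrow> ln (theta_sum \<beta> L (\<tau> * a j)) \<le> C * (\<tau> * a j) powr (- q)"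
    "\<And>\<tau> j L. \<tau> > 0 \<Longrightarrow> j \<ge> 1 \<Longrightarrow> ln (theta_sum \<beta> L (\<tau> * a j)) \<le> C * (\<tau> * a 1) powr (- q)"
proof -
  obtain C where C: "C > 0" "\<And>y L. y > 0 \<Longrightarrow> ln (theta_sum \<beta> L y) \<le> C * y powr (- q)"
    using ln_theta_sum_powr[OF \<beta>_pos assms] by blast
  have 1: "ln (theta_sum \<beta> L (\<tau> * a j)) \<le> C * (\<tau> * a j) powr (- q)" if "\<tau> > 0" "j \<ge> 1" for \<tau> j L
    using that seq_a_pos by (intro C) auto
  \<comment> \<open>A version uniform in \<open>j\<close>, meant for the initial
    coordinates.\<close>
  moreover have "ln (theta_sum \<beta> L (\<tau> * a j)) \<le> C * (\<tau> * a 1) powr (- q)" if "\<tau> > 0" "j \<ge> 1" for \<tau> j L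
  proof -
    have "C * (\<tau> * a j) powr (- q) \<le> C * (\<tau> * a 1) powr (- q)"
      using that a_ge[of j] a1_pos C(1) assms by (intro mult_left_mono powr_mono2') auto
    with 1[OF that, of L] show ?thesis by linarith
  qed
  ultimately show ?thesis using C(1) that by blast
qed

text \<open>With \<tau> equal to \<eta> the first term is \<open>\<eta> * E\<^sup>2\<close>. Each
  late coordinate contributes at most \<open>C / (\<eta> * a j)\<close>, which is below \<eta> once
  \<open>a j\<close> reaches \<open>C / \<eta>\<^sup>2\<close>; together they give at most
  \<open>\<eta> * d\<close>.\<close>

lemma filterlim_imp_stWT_2_1:
  assumes lim: "filterlim a at_top sequentially"
  shows "stWT 2 1 (info_compl a b)"
proof (rule stWT_I)
  fix \<eta> :: real assume \<eta>: "\<eta> > 0"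
  obtain C where C: "C > 0" "\<And>\<tau> j L. \<tau> > 0 \<Longrightarrow> j \<ge> 1 \<Longrightarrow> ln (theta_sum \<beta> L (\<tau> * a j)) \<le> C * (\<tau> * a j) powr (- 1)"
    "\<And>\<tau> j L. \<tau> > 0 \<Longrightarrow> j \<ge> 1 \<Longrightarrow> ln (theta_sum \<beta> L (\<tau> * a j)) \<le> C * (\<tau> * a 1) powr (- 1)"
    using theta_powr_bound[of 1] by auto
  obtain J where J: "\<And>j. j \<ge> J \<Longrightarrow> C / \<eta>\<^sup>2 \<le> a j"
    using lim unfolding filterlim_at_top eventually_sequentially by blast
  define M where "M = C * (\<eta> * a 1) powr (- 1)"
  have "ln (real (cnt d (E\<^sup>2))) \<le> \<eta> * (E powr 2 + real d powr 1) + real J * M" if d: "d \<ge> 1" and E: "E > 1" for d E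
  proof -
    have X: "E\<^sup>2 > 1" using E by (simp add: one_less_power)
    obtain L where L: "ln (real (cnt d (E\<^sup>2))) \<le> \<eta> * E\<^sup>2 + (\<Sum>j\<in>{1..d}. ln (theta_sum \<beta> L (\<eta> * a j)))"
      using ln_cnt_le_theta[OF \<eta> X] by blast
    have "(\<Sum>j\<in>{1..d}. ln (theta_sum \<beta> L (\<eta> * a j))) \<le> real J * M + (\<Sum>j\<in>{1..d}. \<eta>)"
    proof (rule sum_split_bound)
      fix j assume j: "j \<in> {1..d}" "j \<ge> J"
      have "ln (theta_sum \<beta> L (\<eta> * a j)) \<le> C * (\<eta> * a j) powr (- 1)" using j \<eta> by (intro C) auto
      also have "\<dots> = C / (\<eta> * a j)" using \<eta> seq_a_pos[of j] j by (simp add: powr_minus field_simps)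
      also have "\<dots> \<le> \<eta>" using J[OF j(2)] \<eta> seq_a_pos[of j] j by (simp add: field_simps power2_eq_square)
      finally show "ln (theta_sum \<beta> L (\<eta> * a j)) \<le> \<eta>" .
    qed (use C \<eta> in \<open>auto simp: M_def\<close>)
    with L show ?thesis using E by (simp add: algebra_simps)
  qed
  then show "\<exists>C. \<forall>d\<ge>1. \<forall>E>1. ln (real (cnt d (E\<^sup>2))) \<le> \<eta> * (E powr 2 + real d powr 1) + C"
    by blast
qed auto

text \<open>Again \<tau> is \<eta>, but now \<open>\<eta> * a j \<ge> 2 * ln j\<close> for late
  \<open>j\<close>, so the exponential bound makes the contributions at most
  \<open>C' / j\<^sup>2\<close>, summable uniformly in \<open>d\<close>. Asking for
  \<open>ln j \<ge> 1\<close> keeps the arguments in the exponential range.\<close>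

lemma filterlim_ln_imp_stWT_2:
  assumes t: "t > 0" and lim: "filterlim (\<lambda>j. a j / ln (real j)) at_top sequentially"
  shows "stWT 2 t (info_compl a b)"
proof (rule stWT_I)
  fix \<eta> :: real assume \<eta>: "\<eta> > 0"
  obtain C where C: "C > 0" "\<And>\<tau> j L. \<tau> > 0 \<Longrightarrow> j \<ge> 1 \<Longrightarrow> ln (theta_sum \<beta> L (\<tau> * a j)) \<le> C * (\<tau> * a j) powr (- 1)"
    "\<And>\<tau> j L. \<tau> > 0 \<Longrightarrow> j \<ge> 1 \<Longrightarrow> ln (theta_sum \<beta> L (\<tau> * a j)) \<le> C * (\<tau> * a 1) powr (- 1)"
    using theta_powr_bound[of 1] by auto
  obtain C' where C': "C' > 0" "\<And>y L. y \<ge> 1 \<Longrightarrow> ln (theta_sum \<beta> L y) \<le> C' * exp (- y)"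
    using ln_theta_sum_exp[OF \<beta>_pos] by blast
  have "filterlim (\<lambda>d. ln (real d)) at_top sequentially" by real_asymp
  then have "eventually (\<lambda>d. ln (real d) \<ge> 1) sequentially" by (simp only: filterlim_at_top)
  moreover have "eventually (\<lambda>j. 2 / \<eta> \<le> a j / ln (real j)) sequentially"
    using lim by (simp only: filterlim_at_top)
  ultimately have "eventually (\<lambda>j. \<eta> * a j \<ge> 2 * ln (real j) \<and> ln (real j) \<ge> 1) sequentially"
    by eventually_elim (use \<eta> in \<open>simp add: field_simps\<close>)
  then obtain J where J: "\<And>j. j \<ge> J \<Longrightarrow> \<eta> * a j \<ge> 2 * ln (real j) \<and> ln (real j) \<ge> 1"
    by (auto simp: eventually_sequentially)
  define M where "M = C * (\<eta> * a 1) powr (- 1)"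
  have "ln (real (cnt d (E\<^sup>2))) \<le> \<eta> * (E powr 2 + real d powr t) + (real J * M + 2 * C')" if d: "d \<ge> 1" and E: "E > 1" for d E
  proof -
    have X: "E\<^sup>2 > 1" using E by (simp add: one_less_power)
    obtain L where L: "ln (real (cnt d (E\<^sup>2))) \<le> \<eta> * E\<^sup>2 + (\<Sum>j\<in>{1..d}. ln (theta_sum \<beta> L (\<eta> * a j)))"
      using ln_cnt_le_theta[OF \<eta> X] by blast
    also have "(\<Sum>j\<in>{1..d}. ln (theta_sum \<beta> L (\<eta> * a j))) \<le> real J * M + (\<Sum>j\<in>{1..d}. C' * (1 / (real j)\<^sup>2))"
    proof (rule sum_split_bound)
      fix j assume j: "j \<in> {1..d}" "j \<ge> J"
      have "ln (theta_sum \<beta> L (\<eta> * a j)) \<le> C' * exp (- (\<eta> * a j))" using J[OF j(2)] by (intro C') auto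
      also have "\<dots> \<le> C' * exp (- (2 * ln (real j)))" using J[OF j(2)] C' by (intro mult_left_mono) auto
      also have "exp (- (2 * ln (real j))) = 1 / (real j)\<^sup>2"
        using j by (simp add: exp_minus exp_double field_simps)
      finally show "ln (theta_sum \<beta> L (\<eta> * a j)) \<le> C' * (1 / (real j)\<^sup>2)" .
    qed (use C C' \<eta> in \<open>auto simp: M_def\<close>)
    also have "(\<Sum>j\<in>{1..d}. C' * (1 / (real j)\<^sup>2)) \<le> C' * 2"
      unfolding sum_distrib_left[symmetric] using C' by (intro mult_left_mono sum_inverse_squares_le) auto
    also have "\<eta> * E\<^sup>2 \<le> \<eta> * (E powr 2 + real d powr t)" using E \<eta> by (simp add: add_increasing2)
    finally show ?thesis by simp
  qed
  then show "\<exists>C. \<forall>d\<ge>1. \<forall>E>1. ln (real (cnt d (E\<^sup>2))) \<le> \<eta> * (E powr 2 + real d powr t) + C"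
    by blast
qed (use t in auto)

text \<open>The choice of \<tau> turns \<open>\<tau> * E\<^sup>2\<close> into
  \<open>\<eta> * E powr s\<close>. For late \<open>j\<close> the hypothesis gives
  \<open>\<tau> * a j \<ge> (j / m) powr r\<close> with \<open>m\<close> of order
  \<open>E powr s\<close>. The decay exponents \<open>1 / (2 * r)\<close> and \<open>2 / r\<close>
  are those for which the contributions become the square root and the square of
  \<open>m / j\<close>, so their sum is linear in \<open>m\<close>.\<close>

lemma filterlim_powr_imp_stWT:
  assumes s: "0 < s" "s < 2" and t: "t > 0"
    and lim: "filterlim (\<lambda>j. a j / real j powr ((2 - s) / s)) at_top sequentially"
  shows "stWT s t (info_compl a b)"
proof (rule stWT_I)
  fix \<eta>' :: real assume \<eta>': "\<eta>' > 0"
  \<comment> \<open>One third each for the exponential factor, the initial coordinates and the late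
    ones.\<close>
  define \<eta> where "\<eta> = \<eta>' / 3"
  have \<eta>: "\<eta> > 0" using \<eta>' by (simp add: \<eta>_def)
  define r where "r = (2 - s) / s"
  have r: "r > 0" using s by (simp add: r_def)
  have "(s - 2) * (- (1 / r)) = (2 - s) * (1 / r)" by (simp add: algebra_simps)
  also have "\<dots> = s" using s by (simp add: r_def)
  finally have ex: "(s - 2) * (- (1 / r)) = s" .
  have "(s - 2) * (- (1 / (2 * r))) = (s - 2) * (- (1 / r)) / 2" by simp
  then have ex2: "(s - 2) * (- (1 / (2 * r))) = s / 2" unfolding ex .
  obtain C1 where C1: "C1 > 0" "\<And>\<tau> j L. \<tau> > 0 \<Longrightarrow> j \<ge> 1 \<Longrightarrow> ln (theta_sum \<beta> L (\<tau> * a j)) \<le> C1 * (\<tau> * a j) powr (- (1 / (2 * r)))"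
    "\<And>\<tau> j L. \<tau> > 0 \<Longrightarrow> j \<ge> 1 \<Longrightarrow> ln (theta_sum \<beta> L (\<tau> * a j)) \<le> C1 * (\<tau> * a 1) powr (- (1 / (2 * r)))"
    using theta_powr_bound[of "1 / (2 * r)"] r by (metis divide_pos_pos zero_less_one mult_pos_pos zero_less_numeral)
  obtain C2 where C2: "C2 > 0" "\<And>\<tau> j L. \<tau> > 0 \<Longrightarrow> j \<ge> 1 \<Longrightarrow> ln (theta_sum \<beta> L (\<tau> * a j)) \<le> C2 * (\<tau> * a j) powr (- (2 / r))"
    using theta_powr_bound[of "2 / r"] r by (metis divide_pos_pos zero_less_numeral)
  define C where "C = max C1 C2"
  have C: "C > 0" "C1 \<le> C" "C2 \<le> C" using C1 C2 by (auto simp: C_def)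
  \<comment> \<open>Solves \<open>3 * C * (\<eta> * A) powr (- (1 / r)) = \<eta>\<close>, so that
    \<open>3 * C * m\<close> is exactly \<open>\<eta> * E powr s\<close>.\<close>
  define A where "A = (3 * C / \<eta>) powr r / \<eta>"
  have A: "A > 0" using C \<eta> by (simp add: A_def)
  have "eventually (\<lambda>j. A \<le> a j / real j powr r) sequentially"
    using lim by (simp only: filterlim_at_top r_def)
  then obtain J where J: "\<And>j. j \<ge> J \<Longrightarrow> A \<le> a j / real j powr r" by (auto simp: eventually_sequentially)
  \<comment> \<open>The initial coordinates grow like \<open>E powr (s / 2)\<close>, since \<tau>
    depends on \<open>E\<close>; this is of lower order than \<open>E powr s\<close>.\<close>
  obtain C3 where C3: "\<And>u. u \<ge> 1 \<Longrightarrow> real J * (C1 * (\<eta> * a 1) powr (- (1 / (2 * r)))) * u powr (s / 2) \<le> \<eta> * u powr s + C3"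
    by (rule powr_le_eps_powr[of "s / 2" s \<eta> "real J * (C1 * (\<eta> * a 1) powr (- (1 / (2 * r))))"]) (use s \<eta> in auto)
  have "ln (real (cnt d (E\<^sup>2))) \<le> \<eta>' * (E powr s + real d powr t) + (C3 + 3 * C)" if d: "d \<ge> 1" and E: "E > 1" for d E
  proof -
    have X: "E\<^sup>2 > 1" using E by (simp add: one_less_power)
    define \<tau> where "\<tau> = \<eta> * E powr (s - 2)"
    have \<tau>: "\<tau> > 0" using \<eta> E by (simp add: \<tau>_def)
    define m where "m = (\<tau> * A) powr (- (1 / r))"
    have m: "m > 0" using \<tau> A by (simp add: m_def)
    obtain L where L: "ln (real (cnt d (E\<^sup>2))) \<le> \<tau> * E\<^sup>2 + (\<Sum>j\<in>{1..d}. ln (theta_sum \<beta> L (\<tau> * a j)))"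
      using ln_cnt_le_theta[OF \<tau> X] by blast
    define M where "M = C1 * (\<tau> * a 1) powr (- (1 / (2 * r)))"
    have lower: "\<tau> * A * real j powr r \<le> \<tau> * a j" if "j \<ge> 1" "j \<ge> J" for j
      using J[OF that(2)] that(1) \<tau> by (simp add: pos_le_divide_eq)
    have scaled: "(\<tau> * a j) powr (- q) \<le> (m / real j) powr (r * q)" if "j \<ge> 1" "j \<ge> J" "q > 0" for j q
    proof -
      have "(\<tau> * a j) powr (- q) \<le> (\<tau> * A * real j powr r) powr (- q)"
        using lower[OF that(1,2)] \<tau> A that by (intro powr_mono2') auto
      also have "\<dots> = (m / real j) powr (r * q)"
        using \<tau> A that r by (simp add: m_def powr_mult powr_divide powr_powr powr_minus field_simps)
      finally show ?thesis .
    qed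
    define g where "g j = min (sqrt (m / real j)) ((m / real j)\<^sup>2)" for j
    have "(\<Sum>j\<in>{1..d}. ln (theta_sum \<beta> L (\<tau> * a j))) \<le> real J * M + (\<Sum>j\<in>{1..d}. C * g j)"
    proof (rule sum_split_bound)
      fix j assume j: "j \<in> {1..d}" "j \<ge> J"
      have pos: "m / real j > 0" using m j by simp
      have "ln (theta_sum \<beta> L (\<tau> * a j)) \<le> C1 * (\<tau> * a j) powr (- (1 / (2 * r)))" using j \<tau> by (intro C1) auto
      also have "\<dots> \<le> C * (m / real j) powr (r * (1 / (2 * r)))"
        using j r C by (intro mult_mono scaled) auto
      finally have 1: "ln (theta_sum \<beta> L (\<tau> * a j)) \<le> C * sqrt (m / real j)"
        using r pos by (simp add: powr_half_sqrt)
      have "ln (theta_sum \<beta> L (\<tau> * a j)) \<le> C2 * (\<tau> * a j) powr (- (2 / r))" using j \<tau> by (intro C2) auto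
      also have "\<dots> \<le> C * (m / real j) powr (r * (2 / r))"
        using j r C by (intro mult_mono scaled) auto
      finally have 2: "ln (theta_sum \<beta> L (\<tau> * a j)) \<le> C * (m / real j)\<^sup>2"
        using r pos by simp
      show "ln (theta_sum \<beta> L (\<tau> * a j)) \<le> C * g j"
        using 1 2 by (simp add: g_def min_def)
    qed (use C C1 \<tau> m in \<open>auto simp: M_def g_def\<close>)
    also have "(\<Sum>j\<in>{1..d}. C * g j) \<le> C * (3 * m + 3)"
      unfolding sum_distrib_left[symmetric] using C m
      by (intro mult_left_mono sum_two_sided_powr_le) (auto simp: g_def)
    also have "C * m = C * (\<eta> * A) powr (- (1 / r)) * E powr s"
    proof -
      have "m = (\<eta> * A) powr (- (1 / r)) * (E powr (s - 2)) powr (- (1 / r))"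
        using \<eta> A by (simp add: m_def \<tau>_def powr_mult mult_ac)
      also have "(E powr (s - 2)) powr (- (1 / r)) = E powr s"
        by (simp only: powr_powr ex)
      finally show ?thesis by simp
    qed
    then have "C * (3 * m + 3) = 3 * C * (\<eta> * A) powr (- (1 / r)) * E powr s + 3 * C"
      by (simp add: distrib_left)
    also have "3 * C * (\<eta> * A) powr (- (1 / r)) = \<eta>"
      using \<eta> C r by (simp add: A_def powr_powr powr_minus field_simps)
    also have "real J * M \<le> \<eta> * E powr s + C3"
    proof -
      have "(\<tau> * a 1) powr (- (1 / (2 * r))) = (\<eta> * a 1) powr (- (1 / (2 * r))) * (E powr (s - 2)) powr (- (1 / (2 * r)))"
        using \<eta> a1_pos by (simp add: \<tau>_def powr_mult mult_ac)
      also have "(E powr (s - 2)) powr (- (1 / (2 * r))) = E powr (s / 2)"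
        by (simp only: powr_powr ex2)
      finally have "real J * M = real J * (C1 * (\<eta> * a 1) powr (- (1 / (2 * r)))) * E powr (s / 2)"
        by (simp add: M_def)
      then show ?thesis using C3[OF less_imp_le[OF E]] by (simp only:)
    qed
    finally have "(\<Sum>j\<in>{1..d}. ln (theta_sum \<beta> L (\<tau> * a j))) \<le> \<eta> * E powr s + C3 + (\<eta> * E powr s + 3 * C)"
      by simp
    moreover have "\<tau> * E\<^sup>2 = \<eta> * E powr s"
    proof -
      have "E powr (s - 2) * E powr 2 = E powr s" by (simp flip: powr_add)
      then show ?thesis using E by (simp add: \<tau>_def)
    qed
    ultimately have "ln (real (cnt d (E\<^sup>2))) \<le> \<eta>' * E powr s + (C3 + 3 * C)"
      using L by (simp add: \<eta>_def)
    also have "\<eta>' * E powr s \<le> \<eta>' * (E powr s + real d powr t)" using \<eta>' by simp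
    finally show ?thesis by simp
  qed
  then show "\<exists>C. \<forall>d\<ge>1. \<forall>E>1. ln (real (cnt d (E\<^sup>2))) \<le> \<eta>' * (E powr s + real d powr t) + C"
    by blast
qed (use s t in auto)

end

section \<open>Polynomial and quasi-polynomial tractability\<close>

lemma SPT_imp_PT: "SPT N \<Longrightarrow> PT N"
proof -
  assume "SPT N"
  then obtain C p where Cp: "C \<ge> 0" "p \<ge> 0" "\<And>d \<epsilon>. d \<ge> 1 \<Longrightarrow> \<epsilon> \<in> {0<..<1} \<Longrightarrow> real (N \<epsilon> d) \<le> C * (1 / \<epsilon>) powr p"
    unfolding SPT_def by blast
  then have "\<forall>d\<ge>1. \<forall>\<epsilon>\<in>{0<..<1}. real (N \<epsilon> d) \<le> C * real d powr 0 * (1 / \<epsilon>) powr p" by simp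
  then show "PT N" unfolding PT_def using Cp(1,2) by blast
qed

context weight_seq
begin

section \<open>Unconditional ranges of (s,t) and uniform weak tractability\<close>

lemma ln_cnt_le_product:
  assumes "E > 1"
  shows "ln (real (cnt d (E\<^sup>2))) \<le> real (card {j \<in> {1..d}. a j < E\<^sup>2}) * ln 3
    + (\<Sum>j\<in>{1..d}. 1 / b j) * (ln E + ln (max 1 (1 / a 1)) / 2)"
proof -
  define m where "m = card {j \<in> {1..d}. a j < E\<^sup>2}"
  define S where "S = (\<Sum>j\<in>{1..d}. 1 / b j)"
  \<comment> \<open>\<open>E\<^sup>2 * c\<close> dominates both arguments of
    \<open>max 1 (E\<^sup>2 / a 1)\<close>, and its logarithm splits as
    \<open>2 * ln E + ln c\<close>.\<close>
  define c where "c = max 1 (1 / a 1)"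
  have X: "E\<^sup>2 > 1" using assms by (simp add: one_less_power)
  have S2: "(\<Sum>j\<in>{1..d}. 1 / (2 * b j)) = S / 2"
    unfolding S_def sum_divide_distrib by (intro sum.cong) auto
  have S: "S \<ge> 0" unfolding S_def by (intro sum_nonneg) (auto intro: less_imp_le[OF seq_b_pos])
  have "real (cnt d (E\<^sup>2)) \<le> 3 ^ m * (max 1 (E\<^sup>2 / a 1)) powr (S / 2)"
    using cnt_le_product[of "E\<^sup>2" d] X unfolding m_def S2 by linarith
  also have "\<dots> \<le> 3 ^ m * (E\<^sup>2 * c) powr (S / 2)"
  proof (intro mult_left_mono powr_mono2)
    have "1 * 1 \<le> E\<^sup>2 * c" using X by (intro mult_mono) (auto simp: c_def)
    moreover have "E\<^sup>2 * (1 / a 1) \<le> E\<^sup>2 * c" by (intro mult_left_mono) (auto simp: c_def)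
    ultimately show "max 1 (E\<^sup>2 / a 1) \<le> E\<^sup>2 * c" by simp
  qed (use S in auto)
  finally have "ln (real (cnt d (E\<^sup>2))) \<le> ln (3 ^ m * (E\<^sup>2 * c) powr (S / 2))"
    using cnt_ge1[OF X, of d] by (intro ln_mono) auto
  also have "\<dots> = real m * ln 3 + S / 2 * (2 * ln E + ln c)"
  proof -
    have "c > 0" by (simp add: c_def)
    then show ?thesis using assms by (simp add: ln_mult ln_powr ln_realpow)
  qed
  also have "\<dots> = real m * ln 3 + S * (ln E + ln c / 2)" by (simp add: field_simps)
  finally show ?thesis by (simp add: m_def S_def c_def)
qed

text \<open>Bounding every \<open>1 / b j\<close> by \<open>1 / \<beta>\<close>, the product bound
  becomes \<open>K * d * (1 + ln E)\<close>. It is linear in \<open>d\<close>, so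
  \<open>t > 1\<close> leaves room for the logarithm of \<open>E\<close>.\<close>

lemma stWT_of_t_gt_1:
  assumes "s > 0" "t > 1"
  shows "stWT s t (info_compl a b)"
proof (rule stWT_I)
  fix \<eta> :: real assume \<eta>: "\<eta> > 0"
  define c where "c = ln (max 1 (1 / a 1)) / 2"
  have c: "c \<ge> 0" by (simp add: c_def)
  define K where "K = ln 3 + 1 / \<beta> * (1 + c)"
  have K: "K > 0" unfolding K_def using \<beta>_pos c by (intro add_pos_nonneg) auto
  obtain C where C: "\<And>u v. u \<ge> 1 \<Longrightarrow> v \<ge> 1 \<Longrightarrow> u powr 1 * (1 + ln v) \<le> \<eta> / K * (u powr t + v powr s) + C"
    by (rule powr_times_ln_le[of 1 t s "\<eta> / K"]) (use assms \<eta> K in auto)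
  have "ln (real (cnt d (E\<^sup>2))) \<le> \<eta> * (E powr s + real d powr t) + K * C" if d: "d \<ge> 1" and E: "E > 1" for d E
  proof -
    have lE: "ln E \<ge> 0" using E by simp
    have "card {j \<in> {1..d}. a j < E\<^sup>2} \<le> card {1..d}" by (intro card_mono) auto
    then have "real (card {j \<in> {1..d}. a j < E\<^sup>2}) * ln 3 \<le> real d * ln 3" by (intro mult_right_mono) auto
    moreover have "(\<Sum>j\<in>{1..d}. 1 / b j) * (ln E + c) \<le> (real d * (1 / \<beta>)) * (ln E + c)"
    proof (intro mult_right_mono)
      have "(\<Sum>j\<in>{1..d}. 1 / b j) \<le> (\<Sum>j\<in>{1..d}. 1 / \<beta>)"
        using b_ge seq_b_pos \<beta>_pos by (intro sum_mono divide_left_mono) auto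
      then show "(\<Sum>j\<in>{1..d}. 1 / b j) \<le> real d * (1 / \<beta>)" by simp
    qed (use lE c in auto)
    ultimately have "ln (real (cnt d (E\<^sup>2))) \<le> real d * ln 3 + (real d * (1 / \<beta>)) * (ln E + c)"
      using ln_cnt_le_product[OF E, of d, folded c_def] by linarith
    also have "\<dots> \<le> real d * ln 3 * (1 + ln E) + (real d * (1 / \<beta>)) * ((1 + c) * (1 + ln E))"
    proof (intro add_mono mult_left_mono)
      show "ln E + c \<le> (1 + c) * (1 + ln E)" using lE c by (simp add: algebra_simps)
      have "real d * ln 3 * 1 \<le> real d * ln 3 * (1 + ln E)" using lE by (intro mult_left_mono) auto
      then show "real d * ln 3 \<le> real d * ln 3 * (1 + ln E)" by simp
    qed (use \<beta>_pos in auto)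
    also have "\<dots> = K * (real d powr 1 * (1 + ln E))" using d \<beta>_pos by (simp add: K_def field_simps)
    also have "\<dots> \<le> K * (\<eta> / K * (real d powr t + E powr s) + C)"
      using d E K by (intro mult_left_mono C) auto
    also have "\<dots> = \<eta> * (E powr s + real d powr t) + K * C" using K by (simp add: field_simps)
    finally show ?thesis .
  qed
  then show "\<exists>C. \<forall>d\<ge>1. \<forall>E>1. ln (real (cnt d (E\<^sup>2))) \<le> \<eta> * (E powr s + real d powr t) + C" by blast
qed (use assms in auto)

text \<open>\<tau> is chosen so that every \<open>\<tau> * a j\<close> is at least
  \<open>1 + ln d\<close>; each of the \<open>d\<close> coordinates then contributes at most
  \<open>C' / d\<close>. The price \<open>E\<^sup>2 * (1 + ln d) / a 1\<close> is affordable because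
  \<open>s > 2\<close>.\<close>

lemma stWT_of_s_gt_2:
  assumes "s > 2" "t > 0"
  shows "stWT s t (info_compl a b)"
proof (rule stWT_I)
  fix \<eta> :: real assume \<eta>: "\<eta> > 0"
  obtain C' where C': "C' > 0" "\<And>y L. y \<ge> 1 \<Longrightarrow> ln (theta_sum \<beta> L y) \<le> C' * exp (- y)"
    using ln_theta_sum_exp[OF \<beta>_pos] by blast
  obtain C where C: "\<And>u v. u \<ge> 1 \<Longrightarrow> v \<ge> 1 \<Longrightarrow> u powr 2 * (1 + ln v) \<le> (\<eta> * a 1) * (u powr s + v powr t) + C"
    by (rule powr_times_ln_le[of 2 s t "\<eta> * a 1"]) (use assms \<eta> a1_pos in auto)
  have "ln (real (cnt d (E\<^sup>2))) \<le> \<eta> * (E powr s + real d powr t) + (C / a 1 + C')" if d: "d \<ge> 1" and E: "E > 1" for d E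
  proof -
    have X: "E\<^sup>2 > 1" using E by (simp add: one_less_power)
    define \<tau> where "\<tau> = (1 + ln (real d)) / a 1"
    have \<tau>: "\<tau> > 0" using a1_pos d by (auto simp: \<tau>_def intro!: divide_pos_pos add_pos_nonneg)
    obtain L where L: "ln (real (cnt d (E\<^sup>2))) \<le> \<tau> * E\<^sup>2 + (\<Sum>j\<in>{1..d}. ln (theta_sum \<beta> L (\<tau> * a j)))"
      using ln_cnt_le_theta[OF \<tau> X] by blast
    also have "(\<Sum>j\<in>{1..d}. ln (theta_sum \<beta> L (\<tau> * a j))) \<le> (\<Sum>j\<in>{1..d}. C' / real d)"
    proof (rule sum_mono)
      fix j assume j: "j \<in> {1..d}"
      have "\<tau> * a 1 \<le> \<tau> * a j" using a_ge[of j] j \<tau> by (intro mult_left_mono) auto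
      then have le: "1 + ln (real d) \<le> \<tau> * a j" using a1_pos by (simp add: \<tau>_def)
      moreover have "ln (real d) \<ge> 0" using d by simp
      ultimately have "ln (theta_sum \<beta> L (\<tau> * a j)) \<le> C' * exp (- (\<tau> * a j))" by (intro C') linarith
      also have "\<dots> \<le> C' * exp (- ln (real d))" using le C' by (intro mult_left_mono) auto
      also have "\<dots> = C' / real d" using d by (simp add: exp_minus field_simps)
      finally show "ln (theta_sum \<beta> L (\<tau> * a j)) \<le> C' / real d" .
    qed
    also have "(\<Sum>j\<in>{1..d}. C' / real d) = C'" using d by simp
    also have "\<tau> * E\<^sup>2 = E powr 2 * (1 + ln (real d)) / a 1" using E by (simp add: \<tau>_def)
    also have "\<dots> \<le> ((\<eta> * a 1) * (E powr s + real d powr t) + C) / a 1"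
      using C[of E "real d"] d E a1_pos by (intro divide_right_mono) auto
    also have "\<dots> = \<eta> * (E powr s + real d powr t) + C / a 1" using a1_pos by (simp add: add_divide_distrib)
    finally show ?thesis by simp
  qed
  then show "\<exists>C. \<forall>d\<ge>1. \<forall>E>1. ln (real (cnt d (E\<^sup>2))) \<le> \<eta> * (E powr s + real d powr t) + C" by blast
qed (use assms in auto)

text \<open>As \<open>s\<close> tends to 0 the exponent \<open>(2 - s) / s\<close> becomes
  arbitrarily large, so the power conditions for all small \<open>s\<close> together say that
  \<open>a\<close> outgrows every power of \<open>j\<close>.\<close>

lemma UWT_iff: "UWT (info_compl a b) \<longleftrightarrow> filterlim (\<lambda>j. ln (a j) / ln (real j)) at_top sequentially"
proof
  assume U: "UWT (info_compl a b)"
  show "filterlim (\<lambda>j. ln (a j) / ln (real j)) at_top sequentially"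
    unfolding filterlim_at_top
  proof
    fix Z :: real
    define Y where "Y = max Z 1"
    \<comment> \<open>Solves \<open>(2 - s) / s = Y\<close>.\<close>
    define s where "s = 2 / (Y + 1)"
    have s: "s > 0" "(2 - s) / s = Y" by (auto simp: s_def Y_def field_simps)
    have "stWT s 1 (info_compl a b)" using U s by (simp add: UWT_def)
    from stWT_imp_filterlim_powr[OF this s(1)]
    have "filterlim (\<lambda>j. a j / real j powr Y) at_top sequentially" by (simp add: s(2))
    then have "eventually (\<lambda>j. 1 \<le> a j / real j powr Y) sequentially" by (simp only: filterlim_at_top)
    then show "eventually (\<lambda>j. Z \<le> ln (a j) / ln (real j)) sequentially"
      using eventually_ge_at_top[of 2]
    proof eventually_elim
      case (elim j)
      then have "real j powr Y \<le> a j" by (simp add: pos_le_divide_eq)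
      then have "ln (real j powr Y) \<le> ln (a j)" using elim by (intro ln_mono) auto
      then have "Y * ln (real j) \<le> ln (a j)" using elim by (simp add: ln_powr)
      then have "Y \<le> ln (a j) / ln (real j)" using elim by (simp add: pos_le_divide_eq)
      then show ?case by (simp add: Y_def)
    qed
  qed
next
  assume lim: "filterlim (\<lambda>j. ln (a j) / ln (real j)) at_top sequentially"
  show "UWT (info_compl a b)"
    unfolding UWT_def
  proof (intro allI impI)
    fix \<alpha> \<beta>' :: real assume pos: "\<alpha> > 0" "\<beta>' > 0"
    define s where "s = min \<alpha> 1"
    have s: "s > 0" "s < 2" "s \<le> \<alpha>" using pos by (auto simp: s_def)
    define r where "r = (2 - s) / s"
    \<comment> \<open>One power more than \<open>r\<close> turns mere boundedness from below into
      divergence.\<close>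
    have "eventually (\<lambda>j. r + 1 \<le> ln (a j) / ln (real j)) sequentially"
      using lim by (simp only: filterlim_at_top)
    then have "eventually (\<lambda>j. real j \<le> a j / real j powr r) sequentially"
      using eventually_ge_at_top[of 2]
    proof eventually_elim
      case (elim j)
      then have "ln (real j powr (r + 1)) \<le> ln (a j)" by (simp add: pos_le_divide_eq ln_powr)
      then have "real j powr (r + 1) \<le> a j" using elim seq_a_pos[of j] by (subst (asm) ln_le_cancel_iff) auto
      then show ?case using elim by (simp add: pos_le_divide_eq powr_add mult.commute)
    qed
    then have "filterlim (\<lambda>j. a j / real j powr ((2 - s) / s)) at_top sequentially"
      unfolding r_def by (rule filterlim_at_top_mono[OF filterlim_real_sequentially])
    then have "stWT s \<beta>' (info_compl a b)" using s pos by (intro filterlim_powr_imp_stWT)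
    then show "stWT \<alpha> \<beta>' (info_compl a b)" by (rule stWT_mono) (use s in auto)
  qed
qed

section \<open>Polynomial and strong polynomial tractability\<close>

lemma card_small_a_le:
  assumes "Y \<ge> 0" "\<And>j. j \<in> {1..d} \<Longrightarrow> j \<ge> J \<Longrightarrow> a j < X \<Longrightarrow> real j \<le> Y"
  shows "real (card {j \<in> {1..d}. a j < X}) \<le> real J + Y"
proof -
  have "{j \<in> {1..d}. a j < X} \<subseteq> {..<J} \<union> {1..nat \<lfloor>Y\<rfloor>}"
  proof
    fix j assume "j \<in> {j \<in> {1..d}. a j < X}"
    then show "j \<in> {..<J} \<union> {1..nat \<lfloor>Y\<rfloor>}"
      using assms(2)[of j] by (cases "j < J") (auto simp: le_nat_floor)
  qed
  then have "card {j \<in> {1..d}. a j < X} \<le> card ({..<J} \<union> {1..nat \<lfloor>Y\<rfloor>})" by (intro card_mono) auto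
  also have "\<dots> \<le> J + nat \<lfloor>Y\<rfloor>" by (rule order_trans[OF card_Un_le]) simp
  finally show ?thesis using assms(1) by linarith
qed

text \<open>At fixed \<open>d\<close> the count grows at least like \<open>E\<close> to the power of
  this sum as \<open>E\<close> tends to infinity. The constant \<open>D\<close> may depend on
  \<open>d\<close>, so the factors in \<open>d\<close> of the tractability notions do no
  harm.\<close>

lemma sum_inverse_b_le:
  assumes d: "d \<ge> 1" and bound: "\<And>E. E \<ge> 2 \<Longrightarrow> real (cnt d (E\<^sup>2)) \<le> D * E powr p"
  shows "(\<Sum>j\<in>{1..d}. 1 / b j) \<le> p"
proof (rule ccontr)
  define S where "S = (\<Sum>j\<in>{1..d}. 1 / b j)"
  assume "\<not> S \<le> p" 
  then have gt: "S - p > 0" by simp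
  have S2: "(\<Sum>j\<in>{1..d}. 1 / (2 * b j)) = S / 2"
    unfolding S_def sum_divide_distrib by (intro sum.cong) auto
  obtain c where c: "c > 0" "\<And>X. X \<ge> 2 \<Longrightarrow> c * X powr (S / 2) \<le> real (cnt d X)"
    using cnt_ge_powr[OF d] unfolding S2 by blast
  define B where "B = max 0 (D / c) + 1"
  \<comment> \<open>Large enough that \<open>E\<close> to the power \<open>S - p\<close> reaches
    \<open>B\<close>, which exceeds \<open>D / c\<close>; the 2 meets the range of the
    hypothesis.\<close>
  define E where "E = max 2 (B powr (1 / (S - p)))"
  have E: "E \<ge> 2" by (simp add: E_def)
  have "E\<^sup>2 \<ge> 2" using power_mono[OF E, of 2] by simp
  then have "c * (E\<^sup>2) powr (S / 2) \<le> D * E powr p" using c(2)[of "E\<^sup>2"] bound[OF E] by linarith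
  moreover have "(E\<^sup>2) powr (S / 2) = E powr S" using E by (simp add: powr_powr flip: powr_numeral)
  moreover have "E powr S = E powr (S - p) * E powr p" by (simp flip: powr_add)
  ultimately have "c * E powr (S - p) \<le> D" using E by (simp flip: mult.assoc)
  then have "E powr (S - p) \<le> D / c" using c by (simp add: field_simps)
  moreover have "(B powr (1 / (S - p))) powr (S - p) \<le> E powr (S - p)"
    using gt by (intro powr_mono2) (auto simp: E_def)
  then have "B \<le> E powr (S - p)" using gt by (simp add: powr_powr B_def)
  ultimately show False by (simp add: B_def)
qed

text \<open>The choice \<open>\<epsilon>\<^sup>-\<^sup>2 = 2 + d a\<^sub>d\<close> puts all \<open>0\<close>-\<open>1\<close> vectors below the threshold.\<close>

lemma power2_le_cnt:
  assumes "d \<ge> 1"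
  obtains E where "E > 1" "real d * ln 2 \<le> ln (real (cnt d (E\<^sup>2)))"
    "2 * ln E \<le> ln (real d) + ln (a d) + ln (1 + 2 / a 1)"
proof -
  define X where "X = 2 + real d * a d"
  have pos: "a d > 0" using seq_a_pos assms by simp
  have X: "X \<ge> 2" using pos by (simp add: X_def)
  have "2 ^ d \<le> real (cnt d X)" using assms by (intro cnt_ge_power2) (auto simp: X_def)
  then have "ln (2 ^ d) \<le> ln (real (cnt d X))" by (intro ln_mono) auto
  then have 1: "real d * ln 2 \<le> ln (real (cnt d X))" by (simp add: ln_realpow)
  \<comment> \<open>Since \<open>a 1 \<le> d * a d\<close>, the additive 2 in \<open>X\<close>
    becomes the factor \<open>1 + 2 / a 1\<close>, and the logarithm splits.\<close>
  have "a 1 * 1 \<le> a d * real d" using a_ge[OF assms] a1_pos assms by (intro mult_mono) auto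
  then have "2 / a 1 * (a 1 * 1) \<le> 2 / a 1 * (a d * real d)" using a1_pos by (intro mult_left_mono) auto
  then have "X \<le> real d * a d * (1 + 2 / a 1)" using a1_pos by (simp add: X_def algebra_simps)
  then have "ln X \<le> ln (real d * a d * (1 + 2 / a 1))" using X by (intro ln_mono) auto
  also have "\<dots> = ln (real d) + ln (a d) + ln (1 + 2 / a 1)"
  proof -
    have "1 + 2 / a 1 > 0" using a1_pos by (intro add_pos_pos) auto
    then show ?thesis using pos assms by (simp add: ln_mult_pos)
  qed
  finally have 2: "ln X \<le> ln (real d) + ln (a d) + ln (1 + 2 / a 1)" .
  show ?thesis
  proof (rule that[of "sqrt X"])
    show "2 * ln (sqrt X) \<le> ln (real d) + ln (a d) + ln (1 + 2 / a 1)"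
      using 2 X by (simp add: ln_sqrt)
  qed (use 1 X in auto)
qed

lemma info_compl_ball:
  "(\<forall>\<epsilon>\<in>{0<..<1}. P (1 / \<epsilon>) (info_compl a b \<epsilon> d)) \<longleftrightarrow> (\<forall>E>1. P E (cnt d (E\<^sup>2)))"
proof safe
  fix E :: real assume "\<forall>\<epsilon>\<in>{0<..<1}. P (1 / \<epsilon>) (info_compl a b \<epsilon> d)" "E > 1"
  then show "P E (cnt d (E\<^sup>2))" by (auto dest!: bspec[of _ _ "1 / E"] simp: info_compl_eq_cnt)
qed (auto simp: info_compl_eq_cnt)

lemma PT_imp_sum_inverse_b:
  assumes "PT (info_compl a b)"
  shows "summable (\<lambda>j. 1 / b (Suc j))"
proof -
  obtain C p q where C: "\<And>d E. d \<ge> 1 \<Longrightarrow> E > 1 \<Longrightarrow> real (cnt d (E\<^sup>2)) \<le> C * real d powr q * E powr p"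
    using assms unfolding PT_def info_compl_ball[of "\<lambda>E n. real n \<le> _ * E powr _"] by blast
  have bound: "(\<Sum>j\<in>{1..d}. 1 / b j) \<le> p" if "d \<ge> 1" for d
    using that C[OF that] by (intro sum_inverse_b_le[of d "C * real d powr q"]) auto
  have "1 / b 1 \<le> p" "0 < 1 / b 1" using bound[of 1] seq_b_pos[of 1] by simp_all
  then have "p \<ge> 0" by linarith
  show ?thesis
  proof (rule summableI_nonneg_bounded)
    show "0 \<le> 1 / b (Suc j)" for j using seq_b_pos[of "Suc j"] by simp
    have "(\<Sum>j<n. 1 / b (Suc j)) = (\<Sum>j\<in>{1..n}. 1 / b j)" for n
      by (simp add: sum.atLeast1_atMost_eq)
    then show "(\<Sum>j<n. 1 / b (Suc j)) \<le> p" for n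
      using bound[of n] \<open>p \<ge> 0\<close> by (cases "n = 0") auto
  qed
qed

text \<open>Counting 0-1 vectors gives \<open>d * ln 2\<close> at most a multiple of
  \<open>ln d\<close> plus a constant plus \<open>p / 2 * ln (a d)\<close>; the logarithms of
  \<open>d\<close> are eventually below half of the left side.\<close>

lemma PT_imp_ln_a:
  assumes "PT (info_compl a b)"
  shows "\<exists>\<delta>>0. eventually (\<lambda>j. ln (a j) / real j \<ge> \<delta>) sequentially"
proof -
  obtain C p' q where pq: "C \<ge> 0" "p' \<ge> 0" "q \<ge> 0" 
    and C: "\<And>d E. d \<ge> 1 \<Longrightarrow> E > 1 \<Longrightarrow> real (cnt d (E\<^sup>2)) \<le> C * real d powr q * E powr p'"
    using assms unfolding PT_def info_compl_ball[of "\<lambda>E n. real n \<le> _ * E powr _"] by blast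
  \<comment> \<open>A positive exponent, since the resulting \<delta> is
    \<open>ln 2 / p\<close>.\<close>
  define p where "p = p' + 1"
  have p: "p > 0" using pq by (simp add: p_def)
  define c where "c = ln (1 + 2 / a 1)"
  \<comment> \<open>The count at \<open>d = 1\<close>, \<open>E = 2\<close> is at least 1, so
    \<open>C\<close> is positive and \<open>ln C\<close> is meaningful.\<close>
  have "C * 1 powr q * 2 powr p' \<ge> 1"
    using C[of 1 2] cnt_ge1[of "2\<^sup>2" 1] by simp
  then have "C > 0" using pq(1) by (cases "C = 0") auto
  have le: "real d * ln 2 \<le> ln C + q * ln (real d) + p / 2 * (ln (real d) + ln (a d) + c)" if d: "d \<ge> 1" for d
  proof -
    obtain E where E: "E > 1" "real d * ln 2 \<le> ln (real (cnt d (E\<^sup>2)))" "2 * ln E \<le> ln (real d) + ln (a d) + c"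
      using power2_le_cnt[OF d] unfolding c_def by blast
    have "real (cnt d (E\<^sup>2)) > 0" using cnt_ge1[of "E\<^sup>2" d] E by (simp add: one_less_power)
    then have "ln (real (cnt d (E\<^sup>2))) \<le> ln (C * real d powr q * E powr p')"
      using C[OF d E(1)] by (intro ln_mono)
    also have "\<dots> = ln C + q * ln (real d) + p' * ln E"
      using \<open>C > 0\<close> d E by (simp add: ln_mult ln_powr)
    also have "p' * ln E \<le> p * ln E" using E by (simp add: p_def)
    also have "p * ln E \<le> p / 2 * (ln (real d) + ln (a d) + c)"
      using mult_left_mono[OF E(3), of "p / 2"] p by simp
    finally show ?thesis using E(2) by simp
  qed
  have "eventually (\<lambda>d. ln C + q * ln (real d) + p / 2 * (ln (real d) + c) \<le> real d * (ln 2 / 2)) sequentially"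
    by real_asymp
  then have "eventually (\<lambda>d. ln (a d) / real d \<ge> ln 2 / p) sequentially"
    using eventually_ge_at_top[of 1]
  proof eventually_elim
    case (elim d)
    have "p / 2 * (ln (real d) + ln (a d) + c) = p / 2 * (ln (real d) + c) + p / 2 * ln (a d)"
      by (simp add: algebra_simps)
    then have "real d * (ln 2 / 2) \<le> p / 2 * ln (a d)" using le[OF elim(2)] elim(1) by linarith
    then show ?case using p elim by (simp add: field_simps)
  qed
  then show ?thesis using p by (intro exI[of _ "ln 2 / p"]) auto
qed

text \<open>Late indices with \<open>a j < E\<^sup>2\<close> satisfy
  \<open>j \<le> 2 * ln E / \<delta>\<close>, so the powers of 3 amount to a fixed power of
  \<open>E\<close>; the reciprocals of \<open>b\<close> contribute the power \<open>S\<close>. Both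
  exponents are free of \<open>d\<close>.\<close>

lemma SPT_I:
  assumes sum: "summable (\<lambda>j. 1 / b (Suc j))"
    and \<delta>: "\<delta> > 0" "eventually (\<lambda>j. ln (a j) / real j \<ge> \<delta>) sequentially"
  shows "SPT (info_compl a b)"
proof -
  define S where "S = (\<Sum>j. 1 / b (Suc j))"
  have nn: "0 \<le> 1 / b (Suc j)" for j using seq_b_pos[of "Suc j"] by simp
  have S: "(\<Sum>j\<in>{1..d}. 1 / b j) \<le> S" for d
  proof -
    have "(\<Sum>j\<in>{1..d}. 1 / b j) = (\<Sum>j<d. 1 / b (Suc j))" by (simp add: sum.atLeast1_atMost_eq)
    also have "\<dots> \<le> S" unfolding S_def using sum nn by (intro sum_le_suminf) auto
    finally show ?thesis .
  qed
  have S0: "S \<ge> 0" using S[of 0] by simp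
  obtain J where J: "\<And>j. j \<ge> J \<Longrightarrow> ln (a j) / real j \<ge> \<delta>"
    using \<delta>(2) by (auto simp: eventually_sequentially)
  define c where "c = ln (max 1 (1 / a 1)) / 2"
  have c: "c \<ge> 0" by (simp add: c_def)
  define p where "p = 2 * ln 3 / \<delta> + S"
  have p: "p \<ge> 0" using \<delta> S0 by (simp add: p_def)
  have "real (cnt d (E\<^sup>2)) \<le> exp (real J * ln 3 + S * c) * E powr p" if d: "d \<ge> 1" and E: "E > 1" for d E
  proof -
    have lE: "ln E > 0" using E by simp
    have "real (card {j \<in> {1..d}. a j < E\<^sup>2}) \<le> real J + 2 * ln E / \<delta>"
    proof (rule card_small_a_le)
      fix j assume j: "j \<in> {1..d}" "j \<ge> J" "a j < E\<^sup>2"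
      have "\<delta> * real j \<le> ln (a j)" using J[OF j(2)] j(1) by (simp add: pos_le_divide_eq)
      also have "\<dots> \<le> ln (E\<^sup>2)" using j seq_a_pos[of j] by (intro ln_mono) auto
      also have "\<dots> = 2 * ln E" using E by (simp add: ln_realpow)
      finally show "real j \<le> 2 * ln E / \<delta>" using \<delta>(1) by (simp add: pos_le_divide_eq mult.commute)
    qed (use lE \<delta> in auto)
    then have "real (card {j \<in> {1..d}. a j < E\<^sup>2}) * ln 3 \<le> (real J + 2 * ln E / \<delta>) * ln 3"
      by (intro mult_right_mono) auto
    moreover have "(\<Sum>j\<in>{1..d}. 1 / b j) * (ln E + c) \<le> S * (ln E + c)"
      using S[of d] lE c by (intro mult_right_mono) auto
    ultimately have "ln (real (cnt d (E\<^sup>2))) \<le> (real J + 2 * ln E / \<delta>) * ln 3 + S * (ln E + c)"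
      using ln_cnt_le_product[OF E, of d, folded c_def] by linarith
    also have "\<dots> = (real J * ln 3 + S * c) + p * ln E" by (simp add: p_def algebra_simps)
    finally have "exp (ln (real (cnt d (E\<^sup>2)))) \<le> exp ((real J * ln 3 + S * c) + p * ln E)" by simp
    moreover have "real (cnt d (E\<^sup>2)) > 0" using cnt_ge1[of "E\<^sup>2" d] E by (simp add: one_less_power)
    ultimately show ?thesis using E by (simp add: exp_add powr_def)
  qed
  then show ?thesis
    unfolding SPT_def info_compl_ball[of "\<lambda>E n. real n \<le> _ * E powr _"] using p
    by (intro exI[of _ "exp (real J * ln 3 + S * c)"] exI[of _ p]) auto
qed

section \<open>Quasi-polynomial tractability\<close>

lemma QPT_imp_sum_inverse_b:
  assumes "QPT (info_compl a b)"
  shows "\<exists>M. \<forall>d\<ge>1. (\<Sum>j\<in>{1..d}. 1 / b j) / (1 + ln (real d)) \<le> M"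
proof -
  obtain C t where C: "\<And>d E. d \<ge> 1 \<Longrightarrow> E > 1 \<Longrightarrow> real (cnt d (E\<^sup>2)) \<le> C * exp (t * (1 + ln E) * (1 + ln (real d)))"
    using assms unfolding QPT_def info_compl_ball[of "\<lambda>E n. real n \<le> _ * exp (_ * (1 + ln E) * _)"] by blast
  have "(\<Sum>j\<in>{1..d}. 1 / b j) / (1 + ln (real d)) \<le> t" if d: "d \<ge> 1" for d
  proof -
    define G where "G = 1 + ln (real d)"
    have G: "G > 0" using d by (auto simp: G_def intro: add_pos_nonneg)
    have "(\<Sum>j\<in>{1..d}. 1 / b j) \<le> t * G"
    proof (rule sum_inverse_b_le[OF d])
      fix E :: real assume E: "E \<ge> 2"
      then have "E powr (t * G) = exp (t * G * ln E)" by (simp add: powr_def)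
      then have "exp (t * (1 + ln E) * G) = exp (t * G) * E powr (t * G)"
        by (simp add: algebra_simps flip: exp_add)
      then show "real (cnt d (E\<^sup>2)) \<le> C * exp (t * G) * E powr (t * G)"
        using C[OF d, of E] E by (simp add: G_def)
    qed
    then show ?thesis using G by (simp add: G_def[symmetric] pos_divide_le_eq)
  qed
  then show ?thesis by blast
qed

text \<open>The same 0-1 vectors as for PT; the exponent of \<open>E\<close> is now proportional to
  \<open>1 + ln d\<close>, which multiplies \<open>ln (a d)\<close> and leaves an error of order
  \<open>(ln d)\<^sup>2\<close>, still negligible against \<open>d\<close>.\<close>

lemma QPT_imp_ln_a:
  assumes "QPT (info_compl a b)"
  shows "\<exists>\<delta>>0. eventually (\<lambda>j. (1 + ln (real j)) * ln (a j) / real j \<ge> \<delta>) sequentially"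
proof -
  obtain C t where t: "C > 0" "t > 0" 
    and C: "\<And>d E. d \<ge> 1 \<Longrightarrow> E > 1 \<Longrightarrow> real (cnt d (E\<^sup>2)) \<le> C * exp (t * (1 + ln E) * (1 + ln (real d)))"
    using assms unfolding QPT_def info_compl_ball[of "\<lambda>E n. real n \<le> _ * exp (_ * (1 + ln E) * _)"] by blast
  define c where "c = ln (1 + 2 / a 1)"
  have le: "real d * ln 2 \<le> ln C + t * (1 + (ln (real d) + ln (a d) + c) / 2) * (1 + ln (real d))" if d: "d \<ge> 1" for d
  proof -
    obtain E where E: "E > 1" "real d * ln 2 \<le> ln (real (cnt d (E\<^sup>2)))" "2 * ln E \<le> ln (real d) + ln (a d) + c"
      using power2_le_cnt[OF d] unfolding c_def by blast
    have "real (cnt d (E\<^sup>2)) > 0" using cnt_ge1[of "E\<^sup>2" d] E by (simp add: one_less_power)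
    then have "ln (real (cnt d (E\<^sup>2))) \<le> ln (C * exp (t * (1 + ln E) * (1 + ln (real d))))"
      using C[OF d E(1)] by (intro ln_mono)
    also have "\<dots> = ln C + t * (1 + ln E) * (1 + ln (real d))"
      using t by (simp add: ln_mult)
    also have "t * (1 + ln E) * (1 + ln (real d)) \<le> t * (1 + (ln (real d) + ln (a d) + c) / 2) * (1 + ln (real d))"
      using E(3) t d by (intro mult_right_mono mult_left_mono add_nonneg_nonneg) auto
    finally show ?thesis using E(2) by simp
  qed
  have "eventually (\<lambda>d. ln C + t * (1 + (ln (real d) + c) / 2) * (1 + ln (real d)) \<le> real d * (ln 2 / 2)) sequentially"
    using t by real_asymp
  then have "eventually (\<lambda>d. (1 + ln (real d)) * ln (a d) / real d \<ge> ln 2 / t) sequentially"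
    using eventually_ge_at_top[of 1]
  proof eventually_elim
    case (elim d)
    have "t * (1 + (ln (real d) + ln (a d) + c) / 2) * (1 + ln (real d))
      = t * (1 + (ln (real d) + c) / 2) * (1 + ln (real d)) + t / 2 * ((1 + ln (real d)) * ln (a d))"
      by (simp add: field_simps)
    then have "real d * (ln 2 / 2) \<le> t / 2 * ((1 + ln (real d)) * ln (a d))" using le[OF elim(2)] elim(1) by simp
    then have "real d * ln 2 \<le> t * ((1 + ln (real d)) * ln (a d))" by simp
    then show ?case using t elim by (simp add: pos_le_divide_eq pos_divide_le_eq mult_ac)
  qed
  then show ?thesis using t by (intro exI[of _ "ln 2 / t"]) auto
qed

text \<open>Replacing \<open>ln j\<close> by \<open>ln d\<close>, late indices with
  \<open>a j < E\<^sup>2\<close> satisfy \<open>j \<le> 2 * ln E * (1 + ln d) / \<delta>\<close>.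
  Both parts of the product bound are then at most multiples of
  \<open>(1 + ln E) * (1 + ln d)\<close>, up to a constant.\<close>

lemma QPT_I:
  assumes M: "\<And>d. d \<ge> 1 \<Longrightarrow> (\<Sum>j\<in>{1..d}. 1 / b j) / (1 + ln (real d)) \<le> M"
    and \<delta>: "\<delta> > 0" "eventually (\<lambda>j. (1 + ln (real j)) * ln (a j) / real j \<ge> \<delta>) sequentially"
  shows "QPT (info_compl a b)"
proof -
  obtain J where J: "\<And>j. j \<ge> J \<Longrightarrow> (1 + ln (real j)) * ln (a j) / real j \<ge> \<delta>"
    using \<delta>(2) by (auto simp: eventually_sequentially)
  have "1 / b 1 \<le> M" "0 < 1 / b 1" using M[of 1] seq_b_pos[of 1] by simp_all
  then have M0: "M \<ge> 0" by linarith
  define c where "c = ln (max 1 (1 / a 1)) / 2"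
  have c: "c \<ge> 0" by (simp add: c_def)
  define t where "t = 2 * ln 3 / \<delta> + M * (1 + c)"
  have t: "t > 0" unfolding t_def using \<delta> M0 c by (intro add_pos_nonneg) auto
  have "real (cnt d (E\<^sup>2)) \<le> exp (real J * ln 3) * exp (t * (1 + ln E) * (1 + ln (real d)))" if d: "d \<ge> 1" and E: "E > 1" for d E
  proof -
    define G where "G = 1 + ln (real d)"
    have G: "G > 0" using d by (auto simp: G_def intro: add_pos_nonneg)
    have lE: "ln E > 0" using E by simp
    have "real (card {j \<in> {1..d}. a j < E\<^sup>2}) \<le> real J + 2 * ln E * G / \<delta>"
    proof (rule card_small_a_le)
      fix j assume j: "j \<in> {1..d}" "j \<ge> J" "a j < E\<^sup>2"
      have l: "1 + ln (real j) > 0" "1 + ln (real j) \<le> G" using j by (auto simp: G_def intro: add_pos_nonneg)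
      have "\<delta> * real j \<le> (1 + ln (real j)) * ln (a j)" using J[OF j(2)] j(1) by (simp add: pos_le_divide_eq)
      also have "\<dots> \<le> (1 + ln (real j)) * ln (E\<^sup>2)" using j seq_a_pos[of j] l by (intro mult_left_mono ln_mono) auto
      also have "\<dots> \<le> G * (2 * ln E)" using E l lE by (simp add: ln_realpow mult_right_mono)
      finally show "real j \<le> 2 * ln E * G / \<delta>" using \<delta>(1) by (simp add: pos_le_divide_eq mult_ac)
    qed (use lE \<delta> G in auto)
    then have "real (card {j \<in> {1..d}. a j < E\<^sup>2}) * ln 3 \<le> (real J + 2 * ln E * G / \<delta>) * ln 3"
      by (intro mult_right_mono) auto
    moreover have "(\<Sum>j\<in>{1..d}. 1 / b j) * (ln E + c) \<le> (M * G) * (ln E + c)"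
      using M[OF d] G lE c by (intro mult_right_mono) (auto simp: G_def[symmetric] pos_divide_le_eq)
    ultimately have "ln (real (cnt d (E\<^sup>2))) \<le> (real J + 2 * ln E * G / \<delta>) * ln 3 + (M * G) * (ln E + c)"
      using ln_cnt_le_product[OF E, of d, folded c_def] by linarith
    also have "\<dots> = real J * ln 3 + (2 * ln 3 / \<delta>) * G * ln E + M * G * (ln E + c)" by (simp add: algebra_simps)
    also have "\<dots> \<le> real J * ln 3 + (2 * ln 3 / \<delta>) * G * (1 + ln E) + M * G * ((1 + c) * (1 + ln E))"
    proof (intro add_mono mult_left_mono order.refl)
      show "ln E + c \<le> (1 + c) * (1 + ln E)" using lE c by (simp add: algebra_simps)
    qed (use G \<delta> M0 in auto)
    also have "\<dots> = real J * ln 3 + t * (1 + ln E) * G" by (simp add: t_def algebra_simps)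
    finally have "exp (ln (real (cnt d (E\<^sup>2)))) \<le> exp (real J * ln 3 + t * (1 + ln E) * G)" by simp
    moreover have "real (cnt d (E\<^sup>2)) > 0" using cnt_ge1[of "E\<^sup>2" d] E by (simp add: one_less_power)
    ultimately show ?thesis by (simp add: exp_add G_def)
  qed
  then show ?thesis
    unfolding QPT_def info_compl_ball[of "\<lambda>E n. real n \<le> _ * exp (_ * (1 + ln E) * _)"] using t
    by (intro exI[of _ "exp (real J * ln 3)"] conjI exI[of _ t]) auto
qed

end

section \<open>The characterisations of all tractability notions\<close>

theorem theorem2p8:
  fixes a b :: "nat \<Rightarrow> real"
  assumes a_pos: "a 1 > 0"
    and a_mono: "\<And>j. j \<ge> 1 \<Longrightarrow> a j \<le> a (Suc j)"
    and b_pos: "\<And>j. j \<ge> 1 \<Longrightarrow> b j > 0"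
    and b_inf: "\<exists>\<beta>>0. \<forall>j\<ge>1. b j \<ge> \<beta>"
  shows
    "((SPT (info_compl a b) \<longleftrightarrow> PT (info_compl a b)) \<and>
      (PT (info_compl a b) \<longleftrightarrow>
        summable (\<lambda>j. 1 / b (Suc j)) \<and>
        Liminf sequentially (\<lambda>j. ereal (ln (a j) / real j)) > 0)) \<and>
     (QPT (info_compl a b) \<longleftrightarrow>
        (\<exists>M. \<forall>d\<ge>1. (\<Sum>j\<in>{1..d}. 1 / b j) / (1 + ln (real d)) \<le> M) \<and>
        Liminf sequentially (\<lambda>j. ereal ((1 + ln (real j)) * ln (a j) / real j)) > 0) \<and>
     (UWT (info_compl a b) \<longleftrightarrow> filterlim (\<lambda>j. ln (a j) / ln (real j)) at_top sequentially) \<and>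
     (WT (info_compl a b) \<longleftrightarrow> filterlim (\<lambda>j. a j / real j) at_top sequentially) \<and>
     (\<forall>s t. s > 0 \<longrightarrow> t > 0 \<longrightarrow> max (s/2) t > 1 \<longrightarrow> stWT s t (info_compl a b)) \<and>
     (stWT 2 1 (info_compl a b) \<longleftrightarrow> filterlim a at_top sequentially) \<and>
     (\<forall>t. 0 < t \<longrightarrow> t < 1 \<longrightarrow>
        (stWT 2 t (info_compl a b) \<longleftrightarrow> filterlim (\<lambda>j. a j / ln (real j)) at_top sequentially)) \<and>
     (\<forall>s t. 0 < s \<longrightarrow> s < 2 \<longrightarrow> 0 < t \<longrightarrow> t \<le> 1 \<longrightarrow>
        (stWT s t (info_compl a b) \<longleftrightarrow>
         filterlim (\<lambda>j. a j / real j powr ((2 - s) / s)) at_top sequentially))"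
proof -
  obtain \<beta> where "\<beta> > 0" "\<And>j. j \<ge> 1 \<Longrightarrow> \<beta> \<le> b j" using b_inf by blast
  then interpret weight_seq a b \<beta>
    by (intro weight_seq.intro a_pos a_mono)
  let ?N = "info_compl a b"
  have powr_iff: "stWT s t ?N \<longleftrightarrow> filterlim (\<lambda>j. a j / real j powr ((2 - s) / s)) at_top sequentially"
    if "0 < s" "s < 2" "0 < t" "t \<le> 1" for s t
    using stWT_imp_filterlim_powr[OF _ that(1,3,4)] filterlim_powr_imp_stWT[OF that(1-3)] by (rule iffI)
  have PT_cond: "PT ?N \<Longrightarrow> summable (\<lambda>j. 1 / b (Suc j)) \<and> Liminf sequentially (\<lambda>j. ereal (ln (a j) / real j)) > 0"
    unfolding Liminf_pos_iff using PT_imp_sum_inverse_b PT_imp_ln_a by blast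
  have cond_SPT: "summable (\<lambda>j. 1 / b (Suc j)) \<and> Liminf sequentially (\<lambda>j. ereal (ln (a j) / real j)) > 0 \<Longrightarrow> SPT ?N"
    unfolding Liminf_pos_iff by (elim conjE exE) (rule SPT_I)
  have 1: "(SPT ?N \<longleftrightarrow> PT ?N) \<and> (PT ?N \<longleftrightarrow> summable (\<lambda>j. 1 / b (Suc j)) \<and>
      Liminf sequentially (\<lambda>j. ereal (ln (a j) / real j)) > 0)"
    using PT_cond cond_SPT SPT_imp_PT[of ?N] by argo
  have 2: "QPT ?N \<longleftrightarrow> (\<exists>M. \<forall>d\<ge>1. (\<Sum>j\<in>{1..d}. 1 / b j) / (1 + ln (real d)) \<le> M) \<and>
      Liminf sequentially (\<lambda>j. ereal ((1 + ln (real j)) * ln (a j) / real j)) > 0"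
    unfolding Liminf_pos_iff
  proof
    assume "QPT ?N"
    then show "(\<exists>M. \<forall>d\<ge>1. (\<Sum>j\<in>{1..d}. 1 / b j) / (1 + ln (real d)) \<le> M) \<and>
      (\<exists>\<delta>>0. eventually (\<lambda>j. (1 + ln (real j)) * ln (a j) / real j \<ge> \<delta>) sequentially)"
      by (intro conjI QPT_imp_sum_inverse_b QPT_imp_ln_a)
  next
    assume "(\<exists>M. \<forall>d\<ge>1. (\<Sum>j\<in>{1..d}. 1 / b j) / (1 + ln (real d)) \<le> M) \<and>
      (\<exists>\<delta>>0. eventually (\<lambda>j. (1 + ln (real j)) * ln (a j) / real j \<ge> \<delta>) sequentially)"
    then obtain M \<delta> where "\<And>d. d \<ge> 1 \<Longrightarrow> (\<Sum>j\<in>{1..d}. 1 / b j) / (1 + ln (real d)) \<le> M"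
      "\<delta> > 0" "eventually (\<lambda>j. (1 + ln (real j)) * ln (a j) / real j \<ge> \<delta>) sequentially" by blast
    then show "QPT ?N" by (rule QPT_I)
  qed
  have 4: "WT ?N \<longleftrightarrow> filterlim (\<lambda>j. a j / real j) at_top sequentially"
    using powr_iff[of 1 1] by (simp add: WT_def)
  have 5: "stWT s t ?N" if "s > 0" "t > 0" "max (s/2) t > 1" for s t
    using that stWT_of_t_gt_1[of s t] stWT_of_s_gt_2[of s t] by (auto simp: max_def split: if_splits)
  have 6: "stWT 2 1 ?N \<longleftrightarrow> filterlim a at_top sequentially"
  proof
    assume "stWT 2 1 ?N"
    then have "filterlim (\<lambda>j. a j / real j powr ((2 - 2) / 2)) at_top sequentially"
      by (rule stWT_imp_filterlim_powr) auto
    \<comment> \<open>The exponent is 0 here, but \<open>0 powr 0 = 0\<close>, so the quotient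
      equals \<open>a j\<close> only from \<open>j = 1\<close> on.\<close>
    moreover have "eventually (\<lambda>j. a j / real j powr ((2 - 2) / 2) = a j) sequentially"
      using eventually_ge_at_top[of 1] by eventually_elim simp
    ultimately show "filterlim a at_top sequentially"
      by (simp only: filterlim_cong[OF refl refl])
  qed (rule filterlim_imp_stWT_2_1)
  have 7: "stWT 2 t ?N \<longleftrightarrow> filterlim (\<lambda>j. a j / ln (real j)) at_top sequentially" if "0 < t" "t < 1" for t
    using stWT_2_imp_filterlim_ln[OF _ that] filterlim_ln_imp_stWT_2[OF that(1)] by (rule iffI)
  show ?thesis
    by (intro conjI 1[THEN conjunct1] 1[THEN conjunct2] 2 UWT_iff 4 6 allI impI 5 7 powr_iff)
qed

end
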